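(* Let $N\ge 2$, let $\omega\subset\mathbb{R}^{N-1}$ be open and bounded, $\Omega:=\omega\times(0,1)$, and $1<p<\infty$. Let $f:\Omega\times\mathbb{R}^N\to\mathbb{R}$ be a Carathéodory function for which there is a constant $C>0$ such that $$|f(x,\mu)|\le C|\mu|^p+C\quad\text{and}\quad f(x,\mu)\ge \tfrac1C|\mu|^p-C\qquad\text{for every }\mu\in\mathbb{R}^N\text{ and a.e. }x\in\Omega.$$ For $\varepsilon>0$ define $F_\varepsilon:L^p(\Omega;\mathbb{R}^N)\to\mathbb{R}\cup\{+\infty\}$ by $F_\varepsilon(u):=\int_\Omega f(x,u(x))\,dx$ if $u\in\mathcal{U}_\varepsilon$ and $F_\varepsilon(u):=+\infty$ otherwise. Then $\Gamma\text{-}\lim_{\varepsilon\to0^+}F_\varepsilon$ with respect to weak convergence in $L^p$ exists, and for every $u\in L^p(\Omega;\mathbb{R}^N)$ $$\Gamma\text{-}\lim F_\varepsilon(u)=\begin{cases}F^{**}(u):=\int_\Omega f^{**}(x,u(x))\,dx&\text{if }u\in\mathcal{U}_0,\\+\infty&\text{if }u\in L^p(\Omega;\mathbb{R}^N)\setminus\mathcal{U}_0,\end{cases}$$ where for each $x$, $f^{**}(x,\cdot)$ denotes the convex envelope of $f(x,\cdot)$.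
   Context: Points of $\mathbb{R}^N$ are written $x=(x',x_N)\in\mathbb{R}^{N-1}\times\mathbb{R}$ and vector fields $u=(u',u^N)=(u^1,\dots,u^N)$. For $\varepsilon>0$, $\operatorname{div}_\varepsilon u:=\sum_{\alpha=1}^{N-1}\partial_\alpha u^\alpha+\frac1\varepsilon\partial_N u^N$. All differential constraints are in the sense of distributions on $\Omega$. $\mathcal{U}_\varepsilon:=\{u\in L^p(\Omega;\mathbb{R}^N): \operatorname{div}_\varepsilon u=0\text{ in }\Omega\}$ for $\varepsilon>0$, and $\mathcal{U}_0:=\{u\in L^p(\Omega;\mathbb{R}^N):\partial_N u^N=0\text{ in }\Omega\}$. A Carathéodory function is measurable in its first and continuous in its second variable. $\Gamma\text{-}\liminf F_\varepsilon(u):=\inf\{\liminf_{\varepsilon\to0^+}F_\varepsilon(u_\varepsilon): u_\varepsilon\rightharpoonup u\text{ weakly in }L^p\}$ and $\Gamma\text{-}\limsup F_\varepsilon(u):=\inf\{\limsup_{\varepsilon\to0^+}F_\varepsilon(u_\varepsilon): u_\varepsilon\rightharpoonup u\text{ weakly in }L^p\}$; the $\Gamma$-limit exists if these two coincide, and is then their common value. *)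

theory Defs
  imports "HOL-Analysis.Analysis"
begin

text \<open>
  A point \<open>x = (x', x\<^sub>N)\<close> of \<open>\<real>\<^sup>N = \<real>\<^sup>N\<^sup>-\<^sup>1 \<times> \<real>\<close> has type \<open>(real ^ 'n) \<times> real\<close>, so that
  \<open>N = CARD('n) + 1 \<ge> 2\<close>; the norm of this product type is the Euclidean one.
  Elements of \<open>L\<^sup>p\<close> are represented by functions; only their values on \<open>\<Omega>\<close>, up to null sets, matter.
\<close>

type_synonym 'n pt = "(real ^ 'n) \<times> real"

definition Lp :: "real \<Rightarrow> 'a::euclidean_space set \<Rightarrow> ('a \<Rightarrow> 'b::euclidean_space) set" where
  "Lp p \<Omega> = {u \<in> borel_measurable (lebesgue_on \<Omega>).
              integrable (lebesgue_on \<Omega>) (\<lambda>x. norm (u x) powr p)}"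

definition Lp_norm :: "real \<Rightarrow> 'a::euclidean_space set \<Rightarrow> ('a \<Rightarrow> 'b::euclidean_space) \<Rightarrow> real" where
  "Lp_norm p \<Omega> u = (\<integral>x. norm (u x) powr p \<partial>lebesgue_on \<Omega>) powr (1 / p)"

text \<open>Continuous linear functionals on \<open>L\<^sup>p\<close>. The norm bound makes them respect equality almost everywhere.\<close>

definition Lp_dual ::
  "real \<Rightarrow> 'a::euclidean_space set \<Rightarrow> (('a \<Rightarrow> 'b::euclidean_space) \<Rightarrow> real) set" where
  "Lp_dual p \<Omega> = {l.
     (\<forall>u\<in>Lp p \<Omega>. \<forall>v\<in>Lp p \<Omega>. l (\<lambda>x. u x + v x) = l u + l v) \<and>
     (\<forall>c. \<forall>u\<in>Lp p \<Omega>. l (\<lambda>x. c *\<^sub>R u x) = c * l u) \<and>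
     (\<exists>K. \<forall>u\<in>Lp p \<Omega>. \<bar>l u\<bar> \<le> K * Lp_norm p \<Omega> u)}"

definition Lp_weak_tendsto :: "real \<Rightarrow> 'a::euclidean_space set \<Rightarrow>
    ('i \<Rightarrow> 'a \<Rightarrow> 'b::euclidean_space) \<Rightarrow> ('a \<Rightarrow> 'b) \<Rightarrow> 'i filter \<Rightarrow> bool" where
  "Lp_weak_tendsto p \<Omega> v u G \<longleftrightarrow> (\<forall>l\<in>Lp_dual p \<Omega>. ((\<lambda>i. l (v i)) \<longlongrightarrow> l u) G)"

primrec C_diff :: "nat \<Rightarrow> ('a::euclidean_space \<Rightarrow> real) \<Rightarrow> bool" where
  "C_diff 0 \<phi> \<longleftrightarrow> continuous_on UNIV \<phi>"
| "C_diff (Suc k) \<phi> \<longleftrightarrow> (\<forall>x. \<phi> differentiable (at x)) \<and>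
     (\<forall>v. C_diff k (\<lambda>x. frechet_derivative \<phi> (at x) v))"

definition test_fun :: "'a::euclidean_space set \<Rightarrow> ('a \<Rightarrow> real) set" where
  "test_fun \<Omega> = {\<phi>. (\<forall>k. C_diff k \<phi>) \<and>
     compact (closure {x. \<phi> x \<noteq> 0}) \<and> closure {x. \<phi> x \<noteq> 0} \<subseteq> \<Omega>}"

text \<open>The distributional derivative of \<open>g\<close> in direction \<open>v\<close>, as a functional on test functions.\<close>

definition distr_deriv ::
  "'a::euclidean_space set \<Rightarrow> 'a \<Rightarrow> ('a \<Rightarrow> real) \<Rightarrow> ('a \<Rightarrow> real) \<Rightarrow> real" where
  "distr_deriv \<Omega> v g \<phi> = - (\<integral>x. g x * frechet_derivative \<phi> (at x) v \<partial>lebesgue_on \<Omega>)"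

definition distr_div :: "real \<Rightarrow> 'n::finite pt set \<Rightarrow> ('n pt \<Rightarrow> 'n pt) \<Rightarrow> ('n pt \<Rightarrow> real) \<Rightarrow> real" where
  "distr_div \<epsilon> \<Omega> u \<phi> =
     (\<Sum>\<alpha>\<in>UNIV. distr_deriv \<Omega> (axis \<alpha> 1, 0) (\<lambda>x. fst (u x) $ \<alpha>) \<phi>)
     + 1 / \<epsilon> * distr_deriv \<Omega> (0, 1) (\<lambda>x. snd (u x)) \<phi>"

definition U_eps :: "real \<Rightarrow> 'n::finite pt set \<Rightarrow> real \<Rightarrow> ('n pt \<Rightarrow> 'n pt) set" where
  "U_eps p \<Omega> \<epsilon> = {u \<in> Lp p \<Omega>. \<forall>\<phi>\<in>test_fun \<Omega>. distr_div \<epsilon> \<Omega> u \<phi> = 0}"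

definition U_zero :: "real \<Rightarrow> 'n::finite pt set \<Rightarrow> ('n pt \<Rightarrow> 'n pt) set" where
  "U_zero p \<Omega> = {u \<in> Lp p \<Omega>. \<forall>\<phi>\<in>test_fun \<Omega>. distr_deriv \<Omega> (0, 1) (\<lambda>x. snd (u x)) \<phi> = 0}"

definition caratheodory ::
  "'a::euclidean_space set \<Rightarrow> ('a \<Rightarrow> 'b::euclidean_space \<Rightarrow> real) \<Rightarrow> bool" where
  "caratheodory \<Omega> f \<longleftrightarrow> (\<forall>\<mu>. (\<lambda>x. f x \<mu>) \<in> borel_measurable (lebesgue_on \<Omega>)) \<and>
     (\<forall>x\<in>\<Omega>. continuous_on UNIV (f x))"

text \<open>
  The largest convex function below \<open>g\<close>. This is meaningful only if \<open>g\<close> has some convex minorant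
  (otherwise the envelope would be \<open>-\<infinity>\<close>, while \<open>Sup {}\<close> is an unspecified real).
\<close>

definition convex_envelope :: "('b::euclidean_space \<Rightarrow> real) \<Rightarrow> 'b \<Rightarrow> real" where
  "convex_envelope g \<mu> = Sup {h \<mu> | h. convex_on UNIV h \<and> (\<forall>\<xi>. h \<xi> \<le> g \<xi>)}"

definition F_eps ::
  "real \<Rightarrow> 'n::finite pt set \<Rightarrow> ('n pt \<Rightarrow> 'n pt \<Rightarrow> real) \<Rightarrow> real \<Rightarrow> ('n pt \<Rightarrow> 'n pt) \<Rightarrow> ereal" where
  "F_eps p \<Omega> f \<epsilon> u =
     (if u \<in> U_eps p \<Omega> \<epsilon> then ereal (\<integral>x. f x (u x) \<partial>lebesgue_on \<Omega>) else \<infinity>)"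

definition Gamma_liminf :: "real \<Rightarrow> 'a::euclidean_space set \<Rightarrow>
    (real \<Rightarrow> ('a \<Rightarrow> 'b::euclidean_space) \<Rightarrow> ereal) \<Rightarrow> ('a \<Rightarrow> 'b) \<Rightarrow> ereal" where
  "Gamma_liminf p \<Omega> F u = Inf {Liminf (at_right 0) (\<lambda>\<epsilon>. F \<epsilon> (v \<epsilon>)) | v.
     (\<forall>\<epsilon>>0. v \<epsilon> \<in> Lp p \<Omega>) \<and> Lp_weak_tendsto p \<Omega> v u (at_right 0)}"

definition Gamma_limsup :: "real \<Rightarrow> 'a::euclidean_space set \<Rightarrow>
    (real \<Rightarrow> ('a \<Rightarrow> 'b::euclidean_space) \<Rightarrow> ereal) \<Rightarrow> ('a \<Rightarrow> 'b) \<Rightarrow> ereal" where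
  "Gamma_limsup p \<Omega> F u = Inf {Limsup (at_right 0) (\<lambda>\<epsilon>. F \<epsilon> (v \<epsilon>)) | v.
     (\<forall>\<epsilon>>0. v \<epsilon> \<in> Lp p \<Omega>) \<and> Lp_weak_tendsto p \<Omega> v u (at_right 0)}"

definition has_Gamma_limit :: "real \<Rightarrow> 'a::euclidean_space set \<Rightarrow>
    (real \<Rightarrow> ('a \<Rightarrow> 'b::euclidean_space) \<Rightarrow> ereal) \<Rightarrow> (('a \<Rightarrow> 'b) \<Rightarrow> ereal) \<Rightarrow> bool" where
  "has_Gamma_limit p \<Omega> F G \<longleftrightarrow>
     (\<forall>u\<in>Lp p \<Omega>. Gamma_liminf p \<Omega> F u = G u \<and> Gamma_limsup p \<Omega> F u = G u)"

end

theory Submission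
  imports Defs
begin

text \<open>
  Lower bound. Off a null set \<open>f\<^sup>*\<^sup>*(x, \<cdot>)\<close> is the supremum of the affine functions \<open>b \<bullet> \<mu> - f\<^sup>*(x, b)\<close> with \<open>b\<close> in a
  countable dense set. Choosing measurably the best of finitely many of them at \<open>u x\<close> gives a weakly
  continuous minorant of the energy, and the minorants increase to \<open>F\<^sup>*\<^sup>*(u)\<close>.

  Upper bound. A field \<open>u = (u', u\<^sup>N)\<close> of \<open>U_zero\<close> is a strong limit of fields \<open>u\<^sub>\<epsilon> = (w', u\<^sup>N - \<epsilon> W)\<close> of \<open>U_eps\<close>, where \<open>w'\<close>
  is smooth and \<open>\<partial>\<^sub>N W = div w'\<close>. For fixed \<open>\<epsilon>\<close> the energy of \<open>u\<^sub>\<epsilon>\<close> is then lowered by lamination: since \<open>N \<ge> 2\<close>, every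
  vector \<open>\<xi>\<close> admits waves \<open>\<plusminus>\<xi>\<close> with rescaled divergence zero, and they can be localised to a measurable set
  because they derive from a potential. So \<open>g\<close> may be replaced by the minimum of \<open>g(x, \<mu>)\<close> and
  \<open>(g(x, \<mu> + \<xi>) + g(x, \<mu> - \<xi>)) / 2\<close>; repeating this with \<open>\<xi>\<close> in a dense set, every direction infinitely often,
  turns \<open>f\<close> into \<open>f\<^sup>*\<^sup>*\<close>.

  Weak convergence of the oscillating part is tested on exponentials \<open>exp (a \<bullet> x)\<close>, which suffices for bounded families
  by an approximate Riesz theorem for \<open>L\<^sup>p\<close>.
\<close>

subsection \<open>Continuously differentiable functions and integration by parts\<close>

text \<open>Nothing in the lamination is uniform in \<epsilon>: its amplitude \<open>K0\<close>
  depends on \<epsilon> through \<open>Teps\<close>. The uniform bound in \<open>L^p\<close>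
  therefore has to come afterwards, from coercivity and the energy that has been reached. Until then
  weak closeness is recorded by exponential moments with \<open>norm a <= R\<close> and error
  \<delta>; setting \<open>R = 1 / eps\<close> and \<open>\<delta> = eps\<close> at the very end
  replaces a diagonal argument.

  A second obstacle is the energy of an oscillating field when the base field and the set of
  lamination are merely measurable. Averaging over \<open>\<psi>\<close> and \<open>- \<psi>\<close>
  makes the integrand an even function of the slope of the wave. It is then enough that the modulus
  of this slope tends to 1 almost everywhere: the frequency stays fixed while the wave is sharpened,
  and no equidistribution argument occurs. The price is that only equal weights are produced, so one
  step gives a midpoint inequality in one direction. This is why the envelope is reached by
  iteration, and why convexity has to be recovered from midpoint inequalities along a dense set of
  directions.\<close>

abbreviation dd :: "('a::euclidean_space \<Rightarrow> real) \<Rightarrow> 'a \<Rightarrow> 'a \<Rightarrow> real" where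
  "dd \<phi> x v \<equiv> frechet_derivative \<phi> (at x) v"

text \<open>Test functions are smooth, but the potentials multiplied by the cut-offs of
  \<open>C1_cutoff\<close> are known only to be continuously differentiable. The whole calculus is
  therefore set up at this level.\<close>

abbreviation C1 :: "('a::euclidean_space \<Rightarrow> real) \<Rightarrow> bool" where
  "C1 \<equiv> C_diff (Suc 0)"

declare C_diff.simps [simp del]

lemma C1_has_derivative: "C1 \<phi> \<Longrightarrow> (\<phi> has_derivative dd \<phi> x) (at x)"
  by (auto simp: C_diff.simps frechet_derivative_works[symmetric])

lemma C1_continuous: "C1 \<phi> \<Longrightarrow> continuous_on UNIV \<phi>"
  by (auto simp: C_diff.simps continuous_on_eq_continuous_at intro: differentiable_imp_continuous_within)

lemma C1_continuous_dd: "C1 \<phi> \<Longrightarrow> continuous_on UNIV (\<lambda>x. dd \<phi> x v)"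
  by (simp add: C_diff.simps)

lemma dd_eqI: "(\<phi> has_derivative \<phi>') (at x) \<Longrightarrow> dd \<phi> x v = \<phi>' v"
  using frechet_derivative_at by metis

lemma C1I:
  assumes "\<And>x. (\<phi> has_derivative \<phi>' x) (at x)" "\<And>v. continuous_on UNIV (\<lambda>x. \<phi>' x v)"
  shows "C1 \<phi>"
proof -
  have "dd \<phi> x v = \<phi>' x v" for x v
    by (rule dd_eqI[OF assms(1)])
  then show ?thesis using assms by (auto simp: C_diff.simps differentiable_def)
qed

lemma linear_dd: "C1 \<phi> \<Longrightarrow> linear (dd \<phi> x)"
  using C1_has_derivative has_derivative_linear by blast

lemma C1_mult:
  assumes "C1 \<phi>" "C1 \<psi>" shows "C1 (\<lambda>x. \<phi> x * \<psi> x)"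
  by (rule C1I[OF has_derivative_mult[OF assms[THEN C1_has_derivative]]])
     (intro continuous_on_add continuous_on_mult assms[THEN C1_continuous] assms[THEN C1_continuous_dd])

lemma dd_mult: "C1 \<phi> \<Longrightarrow> C1 \<psi> \<Longrightarrow> dd (\<lambda>x. \<phi> x * \<psi> x) x v = \<phi> x * dd \<psi> x v + dd \<phi> x v * \<psi> x"
  by (rule dd_eqI[OF has_derivative_mult[OF C1_has_derivative C1_has_derivative]])

lemma C1_add:
  assumes "C1 \<phi>" "C1 \<psi>" shows "C1 (\<lambda>x. \<phi> x + \<psi> x)"
  by (rule C1I[OF has_derivative_add[OF assms[THEN C1_has_derivative]]])
     (intro continuous_on_add assms[THEN C1_continuous_dd])

lemma C1_const: "C1 (\<lambda>x. c)"
  by (rule C1I[OF has_derivative_const]) auto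

lemma C1_sum: "finite I \<Longrightarrow> (\<And>i. i \<in> I \<Longrightarrow> C1 (\<phi> i)) \<Longrightarrow> C1 (\<lambda>x. \<Sum>i\<in>I. \<phi> i x)"
  by (induction I rule: finite_induct) (simp_all add: C1_const C1_add)

lemma C1_inner: "C1 (\<lambda>x. a \<bullet> x)"
  by (rule C1I[where \<phi>' = "\<lambda>x v. a \<bullet> v"]) (auto intro!: derivative_eq_intros)

lemma has_derivative_compose_real:
  assumes "C1 \<phi>" "\<And>t. (g has_real_derivative g' t) (at t)"
  shows "((\<lambda>x. g (\<phi> x)) has_derivative (\<lambda>v. g' (\<phi> x) * dd \<phi> x v)) (at x)"
  using has_derivative_compose[OF C1_has_derivative[OF assms(1)]
      assms(2)[of "\<phi> x", unfolded has_field_derivative_def]]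
  by simp

lemma C1_compose_real:
  assumes "C1 \<phi>" "\<And>t. (g has_real_derivative g' t) (at t)" "continuous_on UNIV g'"
  shows "C1 (\<lambda>x. g (\<phi> x))"
proof (rule C1I[OF has_derivative_compose_real[OF assms(1,2)]])
  fix v
  have "continuous_on UNIV (\<lambda>x. g' (\<phi> x))"
    using continuous_on_compose2[OF assms(3) C1_continuous[OF assms(1)]] by simp
  then show "continuous_on UNIV (\<lambda>x. g' (\<phi> x) * dd \<phi> x v)"
    by (intro continuous_on_mult C1_continuous_dd assms(1))
qed

lemma C1_shift:
  assumes "C1 \<phi>" shows "C1 (\<lambda>x. \<phi> (x + a))" and "dd (\<lambda>x. \<phi> (x + a)) x v = dd \<phi> (x + a) v"
proof -
  have 1: "((\<lambda>x. \<phi> (x + a)) has_derivative dd \<phi> (x + a)) (at x)" for x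
    by (rule has_derivative_compose[of "\<lambda>x. x + a" "\<lambda>v. v" x UNIV \<phi>, OF _ C1_has_derivative[OF assms]])
       (auto intro!: derivative_eq_intros)
  show "C1 (\<lambda>x. \<phi> (x + a))"
    by (rule C1I[OF 1]) (rule continuous_on_compose2[OF C1_continuous_dd[OF assms]],
          auto intro!: continuous_intros)
  show "dd (\<lambda>x. \<phi> (x + a)) x v = dd \<phi> (x + a) v"
    by (rule dd_eqI[OF 1])
qed

lemma C1_line_deriv:
  assumes "C1 \<phi>"
  shows "((\<lambda>s. \<phi> (x + s *\<^sub>R v)) has_real_derivative dd \<phi> (x + s *\<^sub>R v) v) (at s)"
proof -
  have "((\<lambda>s. \<phi> (x + s *\<^sub>R v)) has_derivative (\<lambda>h. dd \<phi> (x + s *\<^sub>R v) (h *\<^sub>R v))) (at s)"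
    by (rule has_derivative_compose[OF _ C1_has_derivative[OF assms]])
       (auto intro!: derivative_eq_intros)
  then show ?thesis
    by (simp add: linear_cmul[OF linear_dd[OF assms]] has_field_derivative_def mult_commute_abs)
qed

lemma integrable_continuous_bounded_support:
  fixes f :: "'a::euclidean_space \<Rightarrow> real"
  assumes "continuous_on UNIV f" "\<And>x. x \<notin> cball 0 R \<Longrightarrow> f x = 0"
  shows "integrable lborel f"
proof -
  have "integrable lborel (\<lambda>x. indicator (cball 0 R) x *\<^sub>R f x)"
    by (rule borel_integrable_compact) (use assms in \<open>auto intro: continuous_on_subset\<close>)
  moreover have "(\<lambda>x. indicator (cball 0 R) x *\<^sub>R f x) = f"
    using assms(2) by (auto simp: indicator_def fun_eq_iff)
  ultimately show ?thesis by simp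
qed

lemma dd_zero_outside:
  assumes "C1 \<phi>" "\<And>x. x \<notin> cball 0 R \<Longrightarrow> \<phi> x = 0" "x \<notin> cball 0 R"
  shows "dd \<phi> x v = 0"
proof -
  have "open (- cball (0::'a) R)" by auto
  then have "((\<lambda>x. 0) has_derivative dd \<phi> x) (at x)"
    by (rule has_derivative_transform_within_open[OF C1_has_derivative[OF assms(1)]])
       (use assms in auto)
  then show ?thesis
    using dd_eqI has_derivative_const has_derivative_unique by metis
qed

text \<open>A sequence of step lengths suits dominated convergence, and \<open>Suc n\<close> keeps
  every step in \<open>(0, 1]\<close>, so supports move by at most \<open>norm v\<close>.\<close>

definition dq :: "nat \<Rightarrow> ('a::euclidean_space \<Rightarrow> real) \<Rightarrow> 'a \<Rightarrow> 'a \<Rightarrow> real" where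
  "dq n \<phi> v x = (\<phi> (x + (1 / real (Suc n)) *\<^sub>R v) - \<phi> x) * real (Suc n)"

lemma dq_mean_value:
  assumes "C1 \<phi>"
  obtains s where "0 < s" "s < 1" "dq n \<phi> v x = dd \<phi> (x + s *\<^sub>R v) v"
proof -
  let ?t = "1 / real (Suc n)"
  have "\<exists>z. 0 < z \<and> z < ?t \<and> \<phi> (x + ?t *\<^sub>R v) - \<phi> (x + 0 *\<^sub>R v) = (?t - 0) * dd \<phi> (x + z *\<^sub>R v) v"
    by (rule MVT2) (use C1_line_deriv[OF assms] in auto)
  then obtain z where z: "0 < z" "z < ?t" "\<phi> (x + ?t *\<^sub>R v) - \<phi> x = ?t * dd \<phi> (x + z *\<^sub>R v) v"
    by auto
  have "?t \<le> 1" by simp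
  then have "z < 1" using z(2) by linarith
  then show thesis using that[of z] z by (auto simp: dq_def simp del: of_nat_Suc)
qed

lemma dq_tendsto:
  assumes "C1 \<phi>"
  shows "(\<lambda>n. dq n \<phi> v x) \<longlonglongrightarrow> dd \<phi> x v"
proof -
  have "((\<lambda>h. (\<phi> (x + h *\<^sub>R v) - \<phi> x) / h) \<longlongrightarrow> dd \<phi> x v) (at 0)"
    using C1_line_deriv[OF assms, of x v 0] by (simp add: has_field_derivative_iff)
  moreover have "filterlim (\<lambda>n. 1 / real (Suc n)) (at 0) sequentially"
    unfolding filterlim_at using LIMSEQ_inverse_real_of_nat by (auto simp: inverse_eq_divide)
  ultimately have "(\<lambda>n. (\<phi> (x + (1 / real (Suc n)) *\<^sub>R v) - \<phi> x) / (1 / real (Suc n))) \<longlonglongrightarrow> dd \<phi> x v"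
    by (rule filterlim_compose)
  then show ?thesis by (simp add: dq_def)
qed

lemma continuous_dq:
  assumes "continuous_on UNIV \<phi>" shows "continuous_on UNIV (dq n \<phi> v)"
proof -
  have "continuous_on UNIV (\<lambda>x. \<phi> (x + a))" for a
    by (rule continuous_on_compose2[OF assms]) (auto intro!: continuous_intros)
  then show ?thesis
    unfolding dq_def using assms by (intro continuous_intros)
qed

text \<open>The mean value theorem replaces each quotient by a derivative at an intermediate point,
  which yields an integrable majorant. The support condition is put on the product because sometimes
  \<open>h\<close> and sometimes \<phi> has bounded support.\<close>

lemma integral_dq_tendsto:
  assumes \<phi>: "C1 \<phi>" and h: "continuous_on UNIV h"
    and supp: "\<And>x s. x \<notin> cball 0 R \<Longrightarrow> 0 \<le> s \<Longrightarrow> s \<le> 1 \<Longrightarrow> dd \<phi> (x + s *\<^sub>R v) v * h x = 0"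
  shows "(\<lambda>n. \<integral>x. dq n \<phi> v x * h x \<partial>lborel) \<longlonglongrightarrow> (\<integral>x. dd \<phi> x v * h x \<partial>lborel)"
proof -
  \<comment> \<open>The enlarged ball contains the intermediate points
    \<open>x + s *\<^sub>R v\<close> for all \<open>x\<close> in \<open>cball 0 R\<close>.\<close>
  let ?B = "cball (0::'a) (R + norm v)"
  have c1: "continuous_on ?B (\<lambda>x. dd \<phi> x v)"
    using C1_continuous_dd[OF \<phi>] continuous_on_subset by blast
  have "bounded ((\<lambda>x. dd \<phi> x v) ` ?B)"
    by (intro compact_imp_bounded compact_continuous_image c1) auto
  then obtain M1 where M1: "\<And>x. x \<in> ?B \<Longrightarrow> \<bar>dd \<phi> x v\<bar> \<le> M1"
    by (force simp: bounded_iff)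
  have "continuous_on (cball 0 R) h"
    using h continuous_on_subset by blast
  then have "bounded (h ` cball 0 R)"
    by (intro compact_imp_bounded compact_continuous_image compact_cball)
  then obtain M2 where M2: "\<And>x. x \<in> cball 0 R \<Longrightarrow> \<bar>h x\<bar> \<le> M2"
    by (force simp: bounded_iff)
  show ?thesis
  proof (rule integral_dominated_convergence[where w = "\<lambda>x. (M1 * M2) * indicator (cball 0 R) x"])
    show "(\<lambda>x. dd \<phi> x v * h x) \<in> borel_measurable lborel"
      using continuous_on_mult[OF C1_continuous_dd[OF \<phi>] h]
      by (simp add: borel_measurable_continuous_onI)
    show "(\<lambda>x. dq n \<phi> v x * h x) \<in> borel_measurable lborel" for n
      using continuous_on_mult[OF continuous_dq[OF C1_continuous[OF \<phi>]] h]
      by (simp add: borel_measurable_continuous_onI)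
    show "integrable lborel (\<lambda>x. (M1 * M2) * indicator (cball 0 R) x :: real)"
      by (intro integrable_mult_right integrable_real_indicator emeasure_bounded_finite bounded_cball) simp
    show "AE x in lborel. (\<lambda>n. dq n \<phi> v x * h x) \<longlonglongrightarrow> dd \<phi> x v * h x"
      by (intro AE_I2 tendsto_mult dq_tendsto \<phi> tendsto_const)
    show "AE x in lborel. norm (dq n \<phi> v x * h x) \<le> (M1 * M2) * indicator (cball 0 R) x" for n
    proof (rule AE_I2)
      fix x
      obtain s where s: "0 < s" "s < 1" "dq n \<phi> v x = dd \<phi> (x + s *\<^sub>R v) v"
        using dq_mean_value[OF \<phi>] by blast
      show "norm (dq n \<phi> v x * h x) \<le> (M1 * M2) * indicator (cball 0 R) x"
      proof (cases "x \<in> cball 0 R")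
        case True
        have "norm (x + s *\<^sub>R v) \<le> norm x + \<bar>s\<bar> * norm v" using norm_triangle_ineq[of x "s *\<^sub>R v"] by simp
        also have "\<dots> \<le> R + norm v" using True s by (auto intro!: add_mono mult_left_le_one_le)
        finally have "\<bar>dd \<phi> (x + s *\<^sub>R v) v\<bar> \<le> M1" by (intro M1) auto
        then have "\<bar>dd \<phi> (x + s *\<^sub>R v) v * h x\<bar> \<le> M1 * M2"
          using M2[OF True] by (auto simp: abs_mult intro!: mult_mono)
        then show ?thesis using True s by simp
      next
        case False
        then show ?thesis using supp[OF False, of s] s by simp
      qed
    qed
  qed
qed

lemma integral_lborel_shift:
  fixes f :: "'a::euclidean_space \<Rightarrow> real"
  assumes "f \<in> borel_measurable borel"
  shows "(\<integral>x. f (x + a) \<partial>lborel) = (\<integral>x. f x \<partial>lborel)"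
proof -
  have "(\<integral>x. f x \<partial>lborel) = (\<integral>x. f x \<partial>distr lborel borel ((+) a))"
    by (simp add: lborel_distr_plus)
  also have "\<dots> = (\<integral>x. f (a + x) \<partial>lborel)"
    using assms by (intro integral_distr) auto
  finally show ?thesis by (simp add: add.commute)
qed

lemma integrable_lborel_shift:
  fixes f :: "'a::euclidean_space \<Rightarrow> real"
  assumes "integrable lborel f"
  shows "integrable lborel (\<lambda>x. f (x + a))"
proof -
  have "integrable (distr lborel borel ((+) a)) f"
    using assms by (simp add: lborel_distr_plus)
  then have "integrable lborel (\<lambda>x. f (a + x))"
    using borel_measurable_integrable[OF assms] by (subst (asm) integrable_distr_eq) auto
  then show ?thesis by (simp add: add.commute)
qed

text \<open>By translation invariance every difference quotient of an integrable function has
  integral zero, and this passes to the limit.\<close>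

lemma integral_dd_eq_0:
  assumes F: "C1 F" and supp: "\<And>x. x \<notin> cball 0 R \<Longrightarrow> F x = 0"
  shows "(\<integral>x. dd F x v \<partial>lborel) = 0"
proof -
  have int: "integrable lborel F"
    by (rule integrable_continuous_bounded_support[OF C1_continuous[OF F] supp])
  have "dd F (x + s *\<^sub>R v) v * 1 = 0" if "x \<notin> cball 0 (R + norm v)" "0 \<le> s" "s \<le> 1" for x s
  proof -
    have "norm x \<le> norm (x + s *\<^sub>R v) + norm (s *\<^sub>R v)"
      using norm_triangle_ineq4[of "x + s *\<^sub>R v" "s *\<^sub>R v"] by simp
    also have "norm (s *\<^sub>R v) \<le> norm v" using that by (simp add: mult_left_le_one_le)
    finally have "x + s *\<^sub>R v \<notin> cball 0 R" using that by auto
    then show ?thesis using dd_zero_outside[OF F supp] by auto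
  qed
  then have "(\<lambda>n. \<integral>x. dq n F v x * 1 \<partial>lborel) \<longlonglongrightarrow> (\<integral>x. dd F x v * 1 \<partial>lborel)"
    by (intro integral_dq_tendsto[OF F, of _ "R + norm v"]) auto
  moreover have "(\<integral>x. dq n F v x * 1 \<partial>lborel) = 0" for n
  proof -
    let ?a = "(1 / real (Suc n)) *\<^sub>R v"
    have "F \<in> borel_measurable borel"
      by (rule borel_measurable_continuous_onI[OF C1_continuous[OF F]])
    then have "(\<integral>x. F (x + ?a) \<partial>lborel) = (\<integral>x. F x \<partial>lborel)"
      by (rule integral_lborel_shift)
    moreover have "integrable lborel (\<lambda>x. F (x + ?a))"
      by (rule integrable_lborel_shift[OF int])
    ultimately have "(\<integral>x. F (x + ?a) - F x \<partial>lborel) = 0"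
      using int by simp
    then show ?thesis unfolding dq_def mult_1_right integral_mult_left_zero by simp
  qed
  ultimately have "(\<lambda>n. 0) \<longlonglongrightarrow> (\<integral>x. dd F x v \<partial>lborel)" by simp
  then show ?thesis using LIMSEQ_unique[OF _ tendsto_const] by auto
qed

text \<open>Symmetry of second derivatives in weak form; finite differences replace the second derivatives,
  so that \<open>C\<^sup>1\<close> suffices.\<close>

lemma integral_dd_swap:
  assumes \<phi>: "C1 \<phi>" and \<theta>: "C1 \<theta>" and supp: "\<And>x. x \<notin> cball 0 R \<Longrightarrow> \<theta> x = 0"
  shows "(\<integral>x. dd \<phi> x a * dd \<theta> x b \<partial>lborel) = (\<integral>x. dd \<phi> x b * dd \<theta> x a \<partial>lborel)"
proof -
  define t where "t n = 1 / real (Suc n)" for n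
  note C1_continuous[OF \<phi>, continuous_intros] C1_continuous[OF \<theta>, continuous_intros]
    C1_continuous_dd[OF \<phi>, continuous_intros] C1_continuous_dd[OF \<theta>, continuous_intros]
  have dsupp: "dd \<theta> x v = 0" if "x \<notin> cball 0 R" for x v
    using dd_zero_outside[OF \<theta> supp that] .
  have t: "0 < t n" "t n \<le> 1" for n by (auto simp: t_def)
  have lim1: "(\<lambda>n. \<integral>x. dq n \<phi> a x * dd \<theta> x b \<partial>lborel) \<longlonglongrightarrow> (\<integral>x. dd \<phi> x a * dd \<theta> x b \<partial>lborel)"
    by (rule integral_dq_tendsto[OF \<phi>, of _ R]) (use dsupp C1_continuous_dd[OF \<theta>] in auto)
  have out: "x + s *\<^sub>R (- a) \<notin> cball 0 R" if "x \<notin> cball 0 (R + norm a)" "0 \<le> s" "s \<le> 1" for x s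
  proof -
    have "norm x \<le> norm (x + s *\<^sub>R (- a)) + norm (s *\<^sub>R (- a))"
      using norm_triangle_ineq4[of "x + s *\<^sub>R (- a)" "s *\<^sub>R (- a)"] by simp
    also have "norm (s *\<^sub>R (- a)) \<le> norm a" using that by (simp add: mult_left_le_one_le)
    finally show "x + s *\<^sub>R (- a) \<notin> cball 0 R" using that by auto
  qed
  have lim2: "(\<lambda>n. \<integral>x. dq n \<theta> (- a) x * dd \<phi> x b \<partial>lborel) \<longlonglongrightarrow> (\<integral>x. dd \<theta> x (- a) * dd \<phi> x b \<partial>lborel)"
    by (rule integral_dq_tendsto[OF \<theta>, of _ "R + norm a"])
       (use out dsupp C1_continuous_dd[OF \<phi>] in auto)
  have cs: "continuous_on UNIV (\<lambda>x. dd \<phi> (x + z) b)" for z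
    by (rule continuous_on_compose2[OF C1_continuous_dd[OF \<phi>]]) (auto intro!: continuous_intros)
  have cs\<theta>: "continuous_on UNIV (\<lambda>x. \<theta> (x + z))" for z
    by (rule continuous_on_compose2[OF C1_continuous[OF \<theta>]]) (auto intro!: continuous_intros)
  \<comment> \<open>Integration by parts in direction \<open>b\<close> takes the derivative off
    \<theta>, and a translation of the integral then moves the difference quotient from \<phi> to
    \<theta>. Only first derivatives appear; the sign and the \<open>- a\<close> come from the
    reversed shift.\<close>
  have eq: "(\<integral>x. dq n \<phi> a x * dd \<theta> x b \<partial>lborel) = - (\<integral>x. dq n \<theta> (- a) x * dd \<phi> x b \<partial>lborel)" for n
  proof -
    have dq_alt: "dq n \<phi> a = (\<lambda>x. real (Suc n) * \<phi> (x + t n *\<^sub>R a) + (- real (Suc n)) * \<phi> x)"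
      by (auto simp: dq_def t_def fun_eq_iff algebra_simps)
    have C1dq: "C1 (dq n \<phi> a)"
      unfolding dq_alt by (intro C1_add C1_mult C1_const C1_shift \<phi>)
    have dd_dq: "dd (dq n \<phi> a) x b = real (Suc n) * (dd \<phi> (x + t n *\<^sub>R a) b - dd \<phi> x b)" for x
      unfolding dq_alt
      by (rule dd_eqI[THEN trans, OF has_derivative_add[OF
              has_derivative_mult_right[OF C1_has_derivative[OF C1_shift(1)[OF \<phi>]]]
              has_derivative_mult_right[OF C1_has_derivative[OF \<phi>]]]])
        (simp add: C1_shift(2)[OF \<phi>] algebra_simps)
    have "(\<integral>x. dd (\<lambda>x. dq n \<phi> a x * \<theta> x) x b \<partial>lborel) = 0"
      by (rule integral_dd_eq_0[OF C1_mult[OF C1dq \<theta>], of R]) (simp add: supp)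
    then have 0: "(\<integral>x. dq n \<phi> a x * dd \<theta> x b + real (Suc n) * (dd \<phi> (x + t n *\<^sub>R a) b * \<theta> x)
        - real (Suc n) * (dd \<phi> x b * \<theta> x) \<partial>lborel) = 0"
      unfolding dd_mult[OF C1dq \<theta>] dd_dq by (simp add: algebra_simps del: of_nat_Suc)
    have i1: "integrable lborel (\<lambda>x. dq n \<phi> a x * dd \<theta> x b)"
      by (rule integrable_continuous_bounded_support[of _ R])
         (auto simp: dsupp intro!: continuous_intros C1_continuous[OF C1dq] C1_continuous_dd[OF \<theta>])
    have i2: "integrable lborel (\<lambda>x. dd \<phi> (x + t n *\<^sub>R a) b * \<theta> x)"
      by (rule integrable_continuous_bounded_support[of _ R])
         (auto simp: supp intro!: continuous_intros cs C1_continuous[OF \<theta>])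
    have i3: "integrable lborel (\<lambda>x. dd \<phi> x b * \<theta> x)"
      by (rule integrable_continuous_bounded_support[of _ R])
         (auto simp: supp intro!: continuous_intros C1_continuous_dd[OF \<phi>] C1_continuous[OF \<theta>])
    have i4: "integrable lborel (\<lambda>x. dd \<phi> x b * \<theta> (x + - (t n *\<^sub>R a)))"
      using integrable_lborel_shift[OF i2, of "- (t n *\<^sub>R a)"] by simp
    have e2: "(\<integral>x. dd \<phi> (x + t n *\<^sub>R a) b * \<theta> x \<partial>lborel) = (\<integral>x. dd \<phi> x b * \<theta> (x + - (t n *\<^sub>R a)) \<partial>lborel)"
      using integral_lborel_shift[of "\<lambda>x. dd \<phi> (x + t n *\<^sub>R a) b * \<theta> x" "- (t n *\<^sub>R a)"]
        borel_measurable_continuous_onI[OF continuous_on_mult[OF cs C1_continuous[OF \<theta>]]] by simp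
    have "(\<integral>x. dq n \<phi> a x * dd \<theta> x b \<partial>lborel) =
        - real (Suc n) * ((\<integral>x. dd \<phi> (x + t n *\<^sub>R a) b * \<theta> x \<partial>lborel) - (\<integral>x. dd \<phi> x b * \<theta> x \<partial>lborel))"
    proof -
      have "(\<integral>x. dq n \<phi> a x * dd \<theta> x b + real (Suc n) * (dd \<phi> (x + t n *\<^sub>R a) b * \<theta> x)
          - real (Suc n) * (dd \<phi> x b * \<theta> x) \<partial>lborel) = (\<integral>x. dq n \<phi> a x * dd \<theta> x b \<partial>lborel)
          + real (Suc n) * (\<integral>x. dd \<phi> (x + t n *\<^sub>R a) b * \<theta> x \<partial>lborel)
          - real (Suc n) * (\<integral>x. dd \<phi> x b * \<theta> x \<partial>lborel)"
        using i1 i2 i3 by (simp del: of_nat_Suc)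
      then show ?thesis using 0 by (simp add: algebra_simps del: of_nat_Suc)
    qed
    also have "\<dots> = - (\<integral>x. dq n \<theta> (- a) x * dd \<phi> x b \<partial>lborel)"
    proof -
      have "dq n \<theta> (- a) x * dd \<phi> x b =
          real (Suc n) * (dd \<phi> x b * \<theta> (x + - (t n *\<^sub>R a)) - dd \<phi> x b * \<theta> x)" for x
        by (simp add: dq_def t_def algebra_simps del: of_nat_Suc)
      then have "(\<integral>x. dq n \<theta> (- a) x * dd \<phi> x b \<partial>lborel) =
          real (Suc n) * ((\<integral>x. dd \<phi> x b * \<theta> (x + - (t n *\<^sub>R a)) \<partial>lborel) - (\<integral>x. dd \<phi> x b * \<theta> x \<partial>lborel))"
        unfolding Bochner_Integration.integral_diff[OF i4 i3, symmetric] by (simp del: of_nat_Suc)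
      then show ?thesis unfolding e2 by (simp only: mult_minus_left)
    qed
    finally show ?thesis .
  qed
  have "(\<integral>x. dd \<phi> x a * dd \<theta> x b \<partial>lborel) = - (\<integral>x. dd \<theta> x (- a) * dd \<phi> x b \<partial>lborel)"
    using LIMSEQ_unique[OF lim1 tendsto_minus[OF lim2, folded eq]] .
  then show ?thesis
    by (simp add: linear_neg[OF linear_dd[OF \<theta>]] mult.commute)
qed

subsection \<open>\<open>L\<^sup>p\<close> on sets of finite measure\<close>

text \<open>A crude substitute for Minkowski's inequality: constants are harmless because all errors
  can be made arbitrarily small.\<close>

lemma norm_add_powr_le:
  fixes a b :: "'b::real_normed_vector"
  assumes "p > 0"
  shows "norm (a + b) powr p \<le> 2 powr p * (norm a powr p + norm b powr p)"
proof -
  have "norm (a + b) powr p \<le> (2 * max (norm a) (norm b)) powr p"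
    using assms by (intro powr_mono2) (auto intro: order_trans[OF norm_triangle_ineq])
  also have "\<dots> = 2 powr p * max (norm a) (norm b) powr p"
    by (simp add: powr_mult)
  also have "\<dots> \<le> 2 powr p * (norm a powr p + norm b powr p)"
    by (intro mult_left_mono) (auto simp: max_def)
  finally show ?thesis .
qed

text \<open>On a set of finite measure this puts \<open>L^p\<close> inside
  \<open>L^1\<close>.\<close>

lemma le_one_plus_powr: "p \<ge> 1 \<Longrightarrow> t \<ge> 0 \<Longrightarrow> t \<le> 1 + t powr p" for p t :: real
proof (cases "t \<le> 1")
  case False
  assume "p \<ge> 1" "t \<ge> 0"
  then have "t powr 1 \<le> t powr p" using False by (intro powr_mono) auto
  then show ?thesis using False by simp
qed (simp add: add_increasing2)

locale finite_domain =
  fixes \<Omega> :: "'a::euclidean_space set" and p :: real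
  assumes lm: "\<Omega> \<in> lmeasurable" and p_gt_1: "1 < p"
begin

abbreviation "M \<equiv> lebesgue_on \<Omega>"

lemma sets_Omega: "\<Omega> \<in> sets lebesgue"
  using lm by auto

sublocale finite_measure M
  by (rule finite_measure_lebesgue_on[OF lm])

lemma space_M: "space M = \<Omega>"
  by simp

lemma p_pos: "0 < p" using p_gt_1 by simp

lemma measurable_continuous:
  fixes g :: "'a \<Rightarrow> 'b::topological_space"
  assumes "continuous_on UNIV g" shows "g \<in> borel_measurable M"
proof -
  have "g \<in> borel_measurable lebesgue"
    using assms by (intro measurable_completion) (simp add: borel_measurable_continuous_onI)
  then show ?thesis by (rule measurable_restrict_space1)
qed

lemma integrable_bounded:
  fixes g :: "'a \<Rightarrow> 'b::{banach,second_countable_topology}"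
  assumes "g \<in> borel_measurable M" "\<And>x. x \<in> \<Omega> \<Longrightarrow> norm (g x) \<le> K"
  shows "integrable M g"
  by (rule integrable_const_bound[of _ K]) (use assms in \<open>auto intro: AE_I2\<close>)

lemma LpD: "u \<in> Lp p \<Omega> \<Longrightarrow> u \<in> borel_measurable M" "u \<in> Lp p \<Omega> \<Longrightarrow> integrable M (\<lambda>x. norm (u x) powr p)"
  by (auto simp: Lp_def)

lemma LpI: "u \<in> borel_measurable M \<Longrightarrow> integrable M (\<lambda>x. norm (u x) powr p) \<Longrightarrow> u \<in> Lp p \<Omega>"
  by (auto simp: Lp_def)

lemma Lp_dominated:
  fixes u :: "'a \<Rightarrow> 'b::euclidean_space"
  assumes "u \<in> borel_measurable M" "integrable M h" "\<And>x. x \<in> \<Omega> \<Longrightarrow> norm (u x) powr p \<le> h x"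
  shows "u \<in> Lp p \<Omega>"
proof (rule LpI[OF assms(1)])
  note assms(1)[measurable]
  show "integrable M (\<lambda>x. norm (u x) powr p)"
    by (rule Bochner_Integration.integrable_bound[OF assms(2)])
       (use assms(3) in \<open>auto intro!: AE_I2 intro: order_trans[OF _ abs_ge_self]\<close>)
qed

lemma Lp_bounded:
  fixes g :: "'a \<Rightarrow> 'b::euclidean_space"
  assumes "g \<in> borel_measurable M" "\<And>x. x \<in> \<Omega> \<Longrightarrow> norm (g x) \<le> K"
  shows "g \<in> Lp p \<Omega>"
  by (rule Lp_dominated[of _ "\<lambda>x. K powr p"]) (use assms p_pos in \<open>auto intro!: powr_mono2\<close>)

lemma Lp_add:
  fixes u v :: "'a \<Rightarrow> 'b::euclidean_space"
  assumes "u \<in> Lp p \<Omega>" "v \<in> Lp p \<Omega>"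
  shows "(\<lambda>x. u x + v x) \<in> Lp p \<Omega>"
proof (rule Lp_dominated)
  show "(\<lambda>x. u x + v x) \<in> borel_measurable M"
    by (intro borel_measurable_add assms[THEN LpD(1)])
  show "integrable M (\<lambda>x. 2 powr p * (norm (u x) powr p + norm (v x) powr p))"
    using assms[THEN LpD(2)] by simp
qed (rule norm_add_powr_le[OF p_pos])

lemma Lp_scaleR:
  fixes u :: "'a \<Rightarrow> 'b::euclidean_space"
  assumes "u \<in> Lp p \<Omega>"
  shows "(\<lambda>x. c *\<^sub>R u x) \<in> Lp p \<Omega>"
proof (rule Lp_dominated)
  show "(\<lambda>x. c *\<^sub>R u x) \<in> borel_measurable M"
    by (intro borel_measurable_scaleR borel_measurable_const LpD(1)[OF assms])
  show "integrable M (\<lambda>x. \<bar>c\<bar> powr p * norm (u x) powr p)"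
    using LpD(2)[OF assms] by simp
qed (simp add: powr_mult)

lemma Lp_diff:
  fixes u v :: "'a \<Rightarrow> 'b::euclidean_space"
  assumes "u \<in> Lp p \<Omega>" "v \<in> Lp p \<Omega>"
  shows "(\<lambda>x. u x - v x) \<in> Lp p \<Omega>"
  using Lp_add[OF assms(1) Lp_scaleR[OF assms(2), of "-1"]] by simp

lemma Lp_integrable:
  fixes u :: "'a \<Rightarrow> 'b::euclidean_space"
  assumes "u \<in> Lp p \<Omega>"
  shows "integrable M u" "integrable M (\<lambda>x. norm (u x))"
proof -
  show *: "integrable M (\<lambda>x. norm (u x))"
  proof (rule Bochner_Integration.integrable_bound)
    show "integrable M (\<lambda>x. 1 + norm (u x) powr p)"
      using LpD(2)[OF assms] by simp
    show "(\<lambda>x. norm (u x)) \<in> borel_measurable M"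
      by (rule measurable_compose[OF LpD(1)[OF assms] borel_measurable_norm])
    have "norm (norm (u x)) \<le> norm (1 + norm (u x) powr p)" for x
      using le_one_plus_powr[of p "norm (u x)"] p_gt_1 by simp
    then show "AE x in M. norm (norm (u x)) \<le> norm (1 + norm (u x) powr p)"
      by (intro AE_I2)
  qed
  show "integrable M u"
    using * LpD(1)[OF assms] by (subst integrable_norm_iff[symmetric])
qed

lemma Lp_inner_integrable:
  fixes u :: "'a \<Rightarrow> 'b::euclidean_space"
  assumes "u \<in> Lp p \<Omega>" "B \<in> borel_measurable M" "\<And>x. x \<in> \<Omega> \<Longrightarrow> norm (B x) \<le> K"
  shows "integrable M (\<lambda>x. B x \<bullet> u x)"
proof (rule Bochner_Integration.integrable_bound[of _ "\<lambda>x. K * norm (u x)"])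
  show "integrable M (\<lambda>x. K * norm (u x))" using Lp_integrable(2)[OF assms(1)] by auto
  show "(\<lambda>x. B x \<bullet> u x) \<in> borel_measurable M" by (intro borel_measurable_inner assms(2) LpD(1)[OF assms(1)])
  show "AE x in M. norm (B x \<bullet> u x) \<le> norm (K * norm (u x))"
  proof (rule AE_I2)
    fix x assume "x \<in> space M"
    then have "norm (B x) \<le> K" using assms(3) by auto
    have "norm (B x \<bullet> u x) \<le> norm (B x) * norm (u x)" using Cauchy_Schwarz_ineq2 by simp
    also have "\<dots> \<le> K * norm (u x)" using \<open>norm (B x) \<le> K\<close> by (intro mult_right_mono) auto
    finally show "norm (B x \<bullet> u x) \<le> norm (K * norm (u x))" by simp
  qed
qed

text \<open>A cheap form of Hoelder's inequality: apply \<open>t <= 1 + t^p\<close> to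
  \<open>norm (u x) / s\<close> with \<open>s\<close> the norm of \<open>u\<close>, and integrate.
  The constant is not sharp.\<close>

lemma integral_norm_le_Lp_norm:
  fixes u :: "'a \<Rightarrow> 'b::euclidean_space"
  assumes u: "u \<in> Lp p \<Omega>"
  shows "(\<integral>x. norm (u x) \<partial>M) \<le> (measure M \<Omega> + 1) * Lp_norm p \<Omega> u"
proof -
  define I where "I = (\<integral>x. norm (u x) powr p \<partial>M)"
  have int: "integrable M (\<lambda>x. norm (u x) powr p)" using LpD[OF u] by simp
  have I0: "0 \<le> I" unfolding I_def by simp
  show ?thesis
  proof (cases "I = 0")
    case True
    then have "AE x in M. norm (u x) powr p = 0"
      unfolding I_def using int by (subst (asm) integral_nonneg_eq_0_iff_AE) auto
    then have "AE x in M. norm (u x) = 0" by (auto elim!: eventually_mono)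
    then have "(\<integral>x. norm (u x) \<partial>M) = 0" by (rule integral_eq_zero_AE)
    then show ?thesis by (simp add: Lp_norm_def)
  next
    case False
    define s where "s = I powr (1 / p)"
    have s: "s > 0" "s powr p = I" using False I0 p_pos by (auto simp: s_def powr_powr)
    have "norm (u x) \<le> s * (1 + norm (u x) powr p / I)" for x
    proof -
      have "norm (u x) / s \<le> 1 + (norm (u x) / s) powr p"
        using s p_gt_1 by (intro le_one_plus_powr) auto
      then show ?thesis using s by (simp add: powr_divide field_simps)
    qed
    then have "(\<integral>x. norm (u x) \<partial>M) \<le> (\<integral>x. s * (1 + norm (u x) powr p / I) \<partial>M)"
      using int Lp_integrable[OF u] by (intro integral_mono) auto
    also have "\<dots> = s * (measure M \<Omega> + I / I)"
      using int by (simp add: I_def)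
    finally show ?thesis using False by (simp add: Lp_norm_def s_def I_def mult.commute)
  qed
qed

text \<open>Weak convergence is exploited only through bounded densities: slopes of affine minorants
  in the lower bound, gradients of test functions in the passage to the limit constraint.\<close>

lemma inner_in_Lp_dual:
  fixes B :: "'a \<Rightarrow> 'b::euclidean_space"
  assumes "B \<in> borel_measurable M" "\<And>x. x \<in> \<Omega> \<Longrightarrow> norm (B x) \<le> K" "0 \<le> K"
  shows "(\<lambda>v. \<integral>x. B x \<bullet> v x \<partial>M) \<in> Lp_dual p \<Omega>"
  unfolding Lp_dual_def
proof (intro CollectI conjI ballI allI exI[of _ "K * (measure M \<Omega> + 1)"])
  note int = Lp_inner_integrable[OF _ assms(1,2)]
  fix u v :: "'a \<Rightarrow> 'b" assume u: "u \<in> Lp p \<Omega>"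
  show "(\<integral>x. B x \<bullet> (c *\<^sub>R u x) \<partial>M) = c * (\<integral>x. B x \<bullet> u x \<partial>M)" for c
    by simp
  have "\<bar>\<integral>x. B x \<bullet> u x \<partial>M\<bar> \<le> (\<integral>x. \<bar>B x \<bullet> u x\<bar> \<partial>M)"
    by (rule integral_abs_bound)
  also have "\<dots> \<le> (\<integral>x. K * norm (u x) \<partial>M)"
  proof (rule integral_mono)
    show "integrable M (\<lambda>x. \<bar>B x \<bullet> u x\<bar>)" using int[OF u] by simp
    show "integrable M (\<lambda>x. K * norm (u x))" using Lp_integrable[OF u] by simp
    show "\<bar>B x \<bullet> u x\<bar> \<le> K * norm (u x)" if "x \<in> space M" for x
      using that assms(2)[of x] by (intro order_trans[OF Cauchy_Schwarz_ineq2] mult_right_mono) auto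
  qed
  also have "\<dots> \<le> K * ((measure M \<Omega> + 1) * Lp_norm p \<Omega> u)"
    using integral_norm_le_Lp_norm[OF u] assms(3) by (simp add: mult_left_mono)
  finally show "\<bar>\<integral>x. B x \<bullet> u x \<partial>M\<bar> \<le> K * (measure M \<Omega> + 1) * Lp_norm p \<Omega> u"
    by (simp add: mult.assoc)
  assume v: "v \<in> Lp p \<Omega>"
  show "(\<integral>x. B x \<bullet> (u x + v x) \<partial>M) = (\<integral>x. B x \<bullet> u x \<partial>M) + (\<integral>x. B x \<bullet> v x \<partial>M)"
    unfolding inner_add_right using int[OF u] int[OF v] by (rule Bochner_Integration.integral_add)
qed

end

subsection \<open>Test functions and the rescaled divergence\<close>

lemma test_fun_C1: "\<theta> \<in> test_fun \<Omega> \<Longrightarrow> C1 \<theta>"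
  by (simp add: test_fun_def)

lemma test_fun_dd_outside:
  assumes "\<theta> \<in> test_fun \<Omega>" "x \<notin> \<Omega>" shows "dd \<theta> x v = 0"
proof -
  let ?K = "closure {x. \<theta> x \<noteq> 0}"
  have "x \<in> - ?K" "open (- ?K)" using assms by (auto simp: test_fun_def)
  then have "((\<lambda>x. 0) has_derivative dd \<theta> x) (at x)"
    by (intro has_derivative_transform_within_open[OF C1_has_derivative[OF test_fun_C1[OF assms(1)]]])
       (use closure_subset[of "{x. \<theta> x \<noteq> 0}"] in auto)
  then show ?thesis
    using dd_eqI has_derivative_const has_derivative_unique by metis
qed

lemma test_fun_bounded_support:
  assumes "\<theta> \<in> test_fun \<Omega>"
  obtains R where "\<And>x. x \<notin> cball 0 R \<Longrightarrow> \<theta> x = 0"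
proof -
  have "bounded (closure {x. \<theta> x \<noteq> 0})" using assms by (auto simp: test_fun_def compact_imp_bounded)
  then obtain R where "closure {x. \<theta> x \<noteq> 0} \<subseteq> cball 0 R"
    using bounded_subset_ballD[of _ 0] ball_subset_cball by (metis order_trans)
  then have "x \<in> cball 0 R" if "\<theta> x \<noteq> 0" for x
    using that closure_subset[of "{x. \<theta> x \<noteq> 0}"] by auto
  then show thesis using that[of R] by blast
qed

definition grad :: "('a::euclidean_space \<Rightarrow> real) \<Rightarrow> 'a \<Rightarrow> 'a" where
  "grad \<theta> x = (\<Sum>b\<in>Basis. dd \<theta> x b *\<^sub>R b)"

lemma dd_eq_grad:
  assumes "C1 \<theta>" shows "dd \<theta> x w = grad \<theta> x \<bullet> w"
proof -
  have "dd \<theta> x w = dd \<theta> x (\<Sum>b\<in>Basis. (w \<bullet> b) *\<^sub>R b)" by (simp add: euclidean_representation)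
  also have "\<dots> = (\<Sum>b\<in>Basis. (w \<bullet> b) * dd \<theta> x b)"
    using linear_dd[OF assms, of x] by (simp add: linear_sum linear_cmul)
  also have "\<dots> = grad \<theta> x \<bullet> w"
    unfolding grad_def inner_sum_left by (simp add: inner_commute mult.commute)
  finally show ?thesis .
qed

lemma continuous_grad: "C1 \<theta> \<Longrightarrow> continuous_on UNIV (grad \<theta>)"
  unfolding grad_def[abs_def] by (intro continuous_intros C1_continuous_dd)

lemma continuous_bounded_on:
  fixes g :: "'a::euclidean_space \<Rightarrow> 'b::real_normed_vector"
  assumes "continuous_on UNIV g" "bounded S"
  obtains K where "K > 0" "\<And>x. x \<in> S \<Longrightarrow> norm (g x) \<le> K"
proof -
  have "bounded (g ` closure S)"
    using continuous_on_subset[OF assms(1)] assms(2)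
    by (intro compact_imp_bounded compact_continuous_image) (auto simp: compact_closure)
  then have "bounded (g ` S)" by (rule bounded_subset) (intro image_mono closure_subset)
  then show thesis using that unfolding bounded_pos by blast
qed

lemma integral_lebesgue_on_eq_lborel:
  fixes h :: "'a::euclidean_space \<Rightarrow> real"
  assumes "continuous_on UNIV h" "\<And>x. x \<notin> \<Omega> \<Longrightarrow> h x = 0" "\<Omega> \<in> sets lebesgue"
  shows "(\<integral>x. h x \<partial>lebesgue_on \<Omega>) = (\<integral>x. h x \<partial>lborel)"
proof -
  have "(\<integral>x. h x \<partial>lebesgue_on \<Omega>) = (\<integral>x. indicator \<Omega> x *\<^sub>R h x \<partial>lebesgue)"
    using assms(3) by (intro integral_restrict_space) simp
  also have "(\<lambda>x. indicator \<Omega> x *\<^sub>R h x) = h"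
    using assms(2) by (auto simp: fun_eq_iff indicator_def)
  also have "integral\<^sup>L lebesgue h = integral\<^sup>L lborel h"
    using assms(1) by (intro integral_completion) (simp add: borel_measurable_continuous_onI)
  finally show ?thesis .
qed

text \<open>\<open>Teps\<close> turns the rescaled divergence into the ordinary one:
  \<open>u\<close> is in \<open>U_eps\<close> exactly if \<open>Teps \<epsilon> u\<close> is
  divergence free in the weak sense. \<open>Tinv\<close> carries divergence-free fields
  back.\<close>

definition Teps :: "real \<Rightarrow> 'n::finite pt \<Rightarrow> 'n pt" where
  "Teps \<epsilon> v = (fst v, snd v / \<epsilon>)"

definition Tinv :: "real \<Rightarrow> 'n::finite pt \<Rightarrow> 'n pt" where
  "Tinv \<epsilon> v = (fst v, \<epsilon> * snd v)"

lemma Teps_Tinv: "\<epsilon> \<noteq> 0 \<Longrightarrow> Teps \<epsilon> (Tinv \<epsilon> v) = v"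
  by (simp add: Teps_def Tinv_def)

lemma Tinv_Teps: "\<epsilon> \<noteq> 0 \<Longrightarrow> Tinv \<epsilon> (Teps \<epsilon> v) = v"
  by (simp add: Teps_def Tinv_def)

lemma linear_Teps: "linear (Teps \<epsilon>)" and linear_Tinv: "linear (Tinv \<epsilon>)"
  by (auto intro!: linearI simp: Teps_def Tinv_def prod_eq_iff algebra_simps add_divide_distrib)

lemma continuous_Tinv: "continuous_on A (Tinv \<epsilon>)"
  by (rule linear_continuous_on) (use linear_Tinv linear_conv_bounded_linear in blast)

lemma pt_decomp: "v = (\<Sum>\<alpha>\<in>UNIV. (fst v $ \<alpha>) *\<^sub>R (axis \<alpha> 1, 0)) + snd v *\<^sub>R (0, 1)" for v :: "'n::finite pt"
proof -
  have "(\<Sum>\<alpha>\<in>UNIV. (fst v $ \<alpha>) *\<^sub>R axis \<alpha> (1::real)) = fst v"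
    using basis_expansion[of "fst v"] by (simp add: scalar_mult_eq_scaleR)
  then show ?thesis by (simp add: prod_eq_iff fst_sum snd_sum)
qed

lemma dd_vertical: "C1 \<theta> \<Longrightarrow> dd \<theta> x (0, s) = s * dd \<theta> x (0, 1)" for \<theta> :: "'n::finite pt \<Rightarrow> real"
  using linear_cmul[OF linear_dd, of \<theta> x s "(0, 1)"] by simp

section \<open>Fields with vanishing rescaled divergence\<close>

locale cylinder = finite_domain \<Omega> p for \<Omega> :: "'n::finite pt set" and p +
  assumes openO: "open \<Omega>" and boundedO: "bounded \<Omega>"
begin

lemma grad_measurable: "C1 \<theta> \<Longrightarrow> grad \<theta> \<in> borel_measurable M"
  by (rule measurable_continuous[OF continuous_grad])

lemma grad_bounded:
  assumes "C1 \<theta>" obtains K where "K > 0" "\<And>x. x \<in> \<Omega> \<Longrightarrow> norm (grad \<theta> x) \<le> K"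
  using continuous_bounded_on[OF continuous_grad[OF assms] boundedO] by blast

lemma integrable_dd:
  assumes "C1 \<theta>" "u \<in> Lp p \<Omega>" shows "integrable M (\<lambda>x. dd \<theta> x (u x))"
proof -
  obtain K where "\<And>x. x \<in> \<Omega> \<Longrightarrow> norm (grad \<theta> x) \<le> K" using grad_bounded[OF assms(1)] by blast
  then show ?thesis unfolding dd_eq_grad[OF assms(1)]
    by (rule Lp_inner_integrable[OF assms(2) grad_measurable[OF assms(1)]])
qed

lemma Lp_linear:
  fixes T :: "'n pt \<Rightarrow> 'b::euclidean_space"
  assumes "linear T" "u \<in> Lp p \<Omega>"
  shows "(\<lambda>x. T (u x)) \<in> Lp p \<Omega>"
proof -
  obtain K where K: "K > 0" "\<And>x. norm (T x) \<le> K * norm x"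
    using linear_bounded_pos[OF assms(1)] by blast
  have T: "T \<in> borel_measurable borel"
    using assms(1) linear_continuous_on linear_conv_bounded_linear borel_measurable_continuous_onI by blast
  show ?thesis
  proof (rule Lp_dominated[of _ "\<lambda>x. K powr p * norm (u x) powr p"])
    show "(\<lambda>x. T (u x)) \<in> borel_measurable M"
      using LpD(1)[OF assms(2)] T by simp
    show "norm (T (u x)) powr p \<le> K powr p * norm (u x) powr p" for x
      using K p_pos powr_mono2[of p "norm (T (u x))" "K * norm (u x)"] by (simp add: powr_mult)
  qed (use LpD(2)[OF assms(2)] in auto)
qed

lemma distr_div_eq:
  assumes u: "u \<in> Lp p \<Omega>" and \<theta>: "C1 \<theta>"
  shows "distr_div \<epsilon> \<Omega> u \<theta> = - (\<integral>x. dd \<theta> x (Teps \<epsilon> (u x)) \<partial>M)"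
proof -
  define e where "e \<alpha> = ((axis \<alpha> 1, 0) :: 'n pt)" for \<alpha>
  have "linear (\<lambda>v :: 'n pt. (fst v $ \<alpha>) *\<^sub>R e \<alpha>)" for \<alpha>
    by (auto intro!: linearI simp: algebra_simps)
  from integrable_dd[OF \<theta> Lp_linear[OF this u]]
  have i1: "integrable M (\<lambda>x. fst (u x) $ \<alpha> * dd \<theta> x (e \<alpha>))" for \<alpha>
    by (simp add: linear_cmul[OF linear_dd[OF \<theta>]])
  have "linear (\<lambda>v :: 'n pt. snd v *\<^sub>R (0 :: real ^ 'n, 1 :: real))"
    by (auto intro!: linearI simp: algebra_simps)
  from integrable_dd[OF \<theta> Lp_linear[OF this u]]
  have i2: "integrable M (\<lambda>x. snd (u x) * dd \<theta> x (0, 1))"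
    by (simp add: dd_vertical[OF \<theta>, of x "snd (u x)" for x])
  have "dd \<theta> x (Teps \<epsilon> v) = (\<Sum>\<alpha>\<in>UNIV. fst v $ \<alpha> * dd \<theta> x (e \<alpha>)) + 1 / \<epsilon> * (snd v * dd \<theta> x (0, 1))" for x v
    by (subst pt_decomp[of "Teps \<epsilon> v"],
        unfold linear_add[OF linear_dd[OF \<theta>]] linear_sum[OF linear_dd[OF \<theta>]] linear_cmul[OF linear_dd[OF \<theta>]])
       (simp add: Teps_def e_def)
  then have "(\<integral>x. dd \<theta> x (Teps \<epsilon> (u x)) \<partial>M) =
      (\<Sum>\<alpha>\<in>UNIV. \<integral>x. fst (u x) $ \<alpha> * dd \<theta> x (e \<alpha>) \<partial>M) + 1 / \<epsilon> * (\<integral>x. snd (u x) * dd \<theta> x (0, 1) \<partial>M)"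
    using i1 i2 by simp
  then show ?thesis
    by (simp add: distr_div_def distr_deriv_def e_def sum_negf)
qed

lemma U_eps_iff: "u \<in> U_eps p \<Omega> \<epsilon> \<longleftrightarrow> u \<in> Lp p \<Omega> \<and> (\<forall>\<theta>\<in>test_fun \<Omega>. (\<integral>x. dd \<theta> x (Teps \<epsilon> (u x)) \<partial>M) = 0)"
  by (auto simp: U_eps_def distr_div_eq test_fun_C1)

lemma U_zero_iff: "u \<in> U_zero p \<Omega> \<longleftrightarrow> u \<in> Lp p \<Omega> \<and> (\<forall>\<theta>\<in>test_fun \<Omega>. (\<integral>x. dd \<theta> x (0, snd (u x)) \<partial>M) = 0)"
  by (auto simp: U_zero_def distr_deriv_def dd_vertical[of _ x "snd (u x)" for x] test_fun_C1)

lemma U_eps_add: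
  assumes "u \<in> U_eps p \<Omega> \<epsilon>" "v \<in> U_eps p \<Omega> \<epsilon>"
  shows "(\<lambda>x. u x + v x) \<in> U_eps p \<Omega> \<epsilon>"
proof -
  have L: "u \<in> Lp p \<Omega>" "v \<in> Lp p \<Omega>" using assms by (auto simp: U_eps_iff)
  have "(\<integral>x. dd \<theta> x (Teps \<epsilon> (u x + v x)) \<partial>M) = 0" if "\<theta> \<in> test_fun \<Omega>" for \<theta>
  proof -
    have \<theta>: "C1 \<theta>" using that by (rule test_fun_C1)
    have "(\<integral>x. dd \<theta> x (Teps \<epsilon> (u x + v x)) \<partial>M) = (\<integral>x. dd \<theta> x (Teps \<epsilon> (u x)) \<partial>M) + (\<integral>x. dd \<theta> x (Teps \<epsilon> (v x)) \<partial>M)"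
      unfolding linear_add[OF linear_Teps] linear_add[OF linear_dd[OF \<theta>]]
      by (rule Bochner_Integration.integral_add[OF L[THEN Lp_linear[OF linear_Teps], THEN integrable_dd[OF \<theta>]]])
    then show ?thesis using assms that by (simp add: U_eps_iff)
  qed
  then show ?thesis using Lp_add[OF L] by (simp add: U_eps_iff)
qed

lemma U_eps_minus:
  assumes "u \<in> U_eps p \<Omega> \<epsilon>" shows "(\<lambda>x. - u x) \<in> U_eps p \<Omega> \<epsilon>"
  using assms Lp_scaleR[of u "-1"]
  by (auto simp: U_eps_iff linear_neg[OF linear_Teps] linear_neg[OF linear_dd[OF test_fun_C1]])

lemma U_eps_zero: "(\<lambda>x. 0) \<in> U_eps p \<Omega> \<epsilon>"
  using Lp_bounded[of "\<lambda>x. 0" 0]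
  by (auto simp: U_eps_iff linear_0[OF linear_Teps] linear_0[OF linear_dd[OF test_fun_C1]])

text \<open>Up to \<open>Tinv\<close>, the field is the rotated gradient of a stream function in the
  plane of \<open>a\<close> and \<open>b\<close>. Its divergence is the difference of the mixed
  derivatives along \<open>a\<close> and \<open>b\<close>, which vanishes weakly by
  \<open>integral_dd_swap\<close>.\<close>

lemma potential_in_U_eps:
  assumes P: "C1 P" and "\<epsilon> > 0"
  shows "(\<lambda>x. Tinv \<epsilon> (dd P x b *\<^sub>R a - dd P x a *\<^sub>R b)) \<in> U_eps p \<Omega> \<epsilon>"
proof -
  let ?v = "\<lambda>x. Tinv \<epsilon> (dd P x b *\<^sub>R a - dd P x a *\<^sub>R b)"
  have c: "continuous_on UNIV ?v"
    by (intro continuous_on_compose2[OF continuous_Tinv[of UNIV]] continuous_intros C1_continuous_dd P) auto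
  obtain K where "\<And>x. x \<in> \<Omega> \<Longrightarrow> norm (?v x) \<le> K"
    using continuous_bounded_on[OF c boundedO] by blast
  then have L: "?v \<in> Lp p \<Omega>"
    by (rule Lp_bounded[OF measurable_continuous[OF c]])
  have "(\<integral>x. dd \<theta> x (Teps \<epsilon> (?v x)) \<partial>M) = 0" if th: "\<theta> \<in> test_fun \<Omega>" for \<theta>
  proof -
    have \<theta>: "C1 \<theta>" using th by (rule test_fun_C1)
    obtain R where R: "\<And>x. x \<notin> cball 0 R \<Longrightarrow> \<theta> x = 0" using test_fun_bounded_support[OF th] by blast
    have cont: "continuous_on UNIV (\<lambda>x. dd P x d * dd \<theta> x e)" for d e
      by (intro continuous_intros C1_continuous_dd P \<theta>)
    have int: "integrable lborel (\<lambda>x. dd P x d * dd \<theta> x e)" for d e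
      by (rule integrable_continuous_bounded_support[OF cont, of R]) (use dd_zero_outside[OF \<theta> R] in simp)
    have eq: "dd \<theta> x (Teps \<epsilon> (?v x)) = dd P x b * dd \<theta> x a - dd P x a * dd \<theta> x b" for x
      using \<open>\<epsilon> > 0\<close> by (simp add: Teps_Tinv linear_diff[OF linear_dd[OF \<theta>]] linear_cmul[OF linear_dd[OF \<theta>]])
    \<comment> \<open>The derivative of \<theta> vanishes off \<Omega>, so the integral extends to
      the whole space, where the symmetry lemma lives.\<close>
    have "(\<integral>x. dd \<theta> x (Teps \<epsilon> (?v x)) \<partial>M) = (\<integral>x. dd P x b * dd \<theta> x a - dd P x a * dd \<theta> x b \<partial>lborel)"
      unfolding eq
      by (rule integral_lebesgue_on_eq_lborel[OF _ _ sets_Omega])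
         (intro continuous_on_diff cont, simp add: test_fun_dd_outside[OF th])
    also have "\<dots> = 0"
      using int integral_dd_swap[OF P \<theta> R, where a = b and b = a] by simp
    finally show ?thesis .
  qed
  then show ?thesis using L by (simp add: U_eps_iff)
qed

end

subsection \<open>Exponential sums are dense in \<open>L\<^sup>p\<close>\<close>

text \<open>Products of exponentials are exponentials, which gives the algebra for
  Stone-Weierstrass; their primitives in the vertical direction are explicit, and their derivatives
  are multiples of themselves.\<close>

inductive expsum :: "('a::euclidean_space \<Rightarrow> real) \<Rightarrow> bool" where
  base: "expsum (\<lambda>x. c * exp (a \<bullet> x))"
| add: "expsum f \<Longrightarrow> expsum g \<Longrightarrow> expsum (\<lambda>x. f x + g x)"

lemma expsum_const: "expsum (\<lambda>x. c)"
  using expsum.base[of c 0] by simp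

lemma expsum_mult_base: "expsum f \<Longrightarrow> expsum (\<lambda>x. f x * (c * exp (a \<bullet> x)))"
proof (induction rule: expsum.induct)
  case (base d b)
  have "(\<lambda>x. d * exp (b \<bullet> x) * (c * exp (a \<bullet> x))) = (\<lambda>x. (d * c) * exp ((a + b) \<bullet> x))"
    by (auto simp: fun_eq_iff inner_add_left exp_add)
  then show ?case using expsum.base[of "d * c" "a + b"] by simp
qed (simp add: distrib_right expsum.add)

lemma expsum_mult:
  assumes "expsum f" "expsum g" shows "expsum (\<lambda>x. f x * g x)"
  using assms(2)
proof (induction rule: expsum.induct)
  case (base c a)
  then show ?case using expsum_mult_base[OF assms(1)] by simp
qed (simp add: distrib_left expsum.add)

lemma expsum_continuous: "expsum f \<Longrightarrow> continuous_on A f"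
  by (induction rule: expsum.induct) (auto intro!: continuous_intros)

lemma expsum_uniformly_dense:
  fixes h :: "'a::euclidean_space \<Rightarrow> real"
  assumes "compact S" "continuous_on S h" "0 < e"
  obtains w where "expsum w" "\<And>x. x \<in> S \<Longrightarrow> \<bar>h x - w x\<bar> < e"
proof -
  have "\<exists>w. expsum w \<and> (\<forall>x\<in>S. \<bar>h x - w x\<bar> < e)"
  proof (rule Stone_Weierstrass_HOL[OF assms(1)])
    \<comment> \<open>The exponent \<open>x - y\<close> separates the two points, since its values
      there differ by the squared distance.\<close>
    fix x y :: 'a assume "x \<in> S \<and> y \<in> S \<and> x \<noteq> y"
    then have "1 * exp ((x - y) \<bullet> x) \<noteq> 1 * exp ((x - y) \<bullet> y)"
      by (metis exp_inj_iff inner_diff_right inner_eq_zero_iff mult_1 right_minus_eq)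
    then show "\<exists>f. expsum f \<and> f x \<noteq> f y"
      using expsum.base[of 1 "x - y"] by blast
  qed (use assms in \<open>auto intro: expsum_const expsum.add expsum_mult expsum_continuous\<close>)
  then show thesis using that by blast
qed

lemma abs_clamp_diff_le:
  "(v::real) \<in> {-N..N} \<Longrightarrow> \<bar>v - max (- N) (min N y)\<bar> \<le> 2 * N"
  "0 \<le> N \<Longrightarrow> \<bar>y - max (- N) (min N y)\<bar> \<le> \<bar>y\<bar>"
  by (auto simp: max_def min_def)

lemma AE_lebesgue_on_not_negligible:
  assumes "negligible N" "S \<in> sets lebesgue"
  shows "AE x in lebesgue_on S. x \<notin> N"
proof -
  have "AE x in lebesgue. x \<notin> N"
    using assms(1) by (intro AE_not_in) (simp add: negligible_iff_null_sets)
  then show ?thesis using assms(2) by (subst AE_restrict_space_iff) auto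
qed

context finite_domain
begin

lemma truncation_Lp_tendsto:
  fixes u :: "'a \<Rightarrow> real"
  assumes u: "u \<in> Lp p \<Omega>"
  shows "(\<lambda>n. \<integral>x. norm (u x - max (- real n) (min (real n) (u x))) powr p \<partial>M) \<longlonglongrightarrow> 0"
proof -
  note LpD(1)[OF u, measurable]
  have "(\<lambda>n. \<integral>x. norm (u x - max (- real n) (min (real n) (u x))) powr p \<partial>M) \<longlonglongrightarrow> (\<integral>x. 0 \<partial>M)"
  proof (rule integral_dominated_convergence[where w = "\<lambda>x. norm (u x) powr p"])
    show "AE x in M. (\<lambda>n. norm (u x - max (- real n) (min (real n) (u x))) powr p) \<longlonglongrightarrow> 0"
    proof (rule AE_I2)
      fix x
      obtain n0 where n0: "\<bar>u x\<bar> \<le> real n0" using real_arch_simple by blast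
      have "norm (u x - max (- real n) (min (real n) (u x))) powr p = 0" if "n \<ge> n0" for n
      proof -
        have "\<bar>u x\<bar> \<le> real n" using n0 that by linarith
        then show ?thesis by (auto simp: max_def min_def)
      qed
      then show "(\<lambda>n. norm (u x - max (- real n) (min (real n) (u x))) powr p) \<longlonglongrightarrow> 0"
        by (intro tendsto_eventually eventually_sequentiallyI[of n0])
    qed
    show "AE x in M. norm (norm (u x - max (- real n) (min (real n) (u x))) powr p) \<le> norm (u x) powr p" for n
      using abs_clamp_diff_le(2)[of "real n"] p_pos by (intro AE_I2) (auto intro!: powr_mono2)
    show "integrable M (\<lambda>x. norm (u x) powr p)" by (rule LpD(2)[OF u])
  qed measurable
  then show ?thesis by simp
qed

text \<open>A measurable function is an almost everywhere limit of continuous ones; clamping them to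
  \<open>[-N, N]\<close> does not disturb the limit and supplies a constant majorant.\<close>

lemma bounded_approx_continuous:
  fixes v :: "'a \<Rightarrow> real"
  assumes v[measurable]: "v \<in> borel_measurable M" and N: "\<And>x. v x \<in> {-N..N}" and "0 < \<delta>"
  obtains h where "continuous_on UNIV h" "(\<integral>x. norm (v x - h x) powr p \<partial>M) < \<delta>"
    "\<And>x. \<bar>h x\<bar> \<le> N"
proof -
  have "0 \<le> N" using N by (metis atLeastAtMost_iff le_minus_iff linorder_linear order_trans neg_0_le_iff_le)
  have "v measurable_on \<Omega>" using v measurable_on_iff_borel_measurable[OF sets_Omega] by blast
  then obtain Z g where Z: "negligible Z" and g: "\<And>n. continuous_on UNIV (g n)"
    and lim: "\<And>x. x \<notin> Z \<Longrightarrow> (\<lambda>n. g n x) \<longlonglongrightarrow> (if x \<in> \<Omega> then v x else 0)"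
    unfolding measurable_on_def by blast
  define h where "h n x = max (- N) (min N (g n x))" for n x
  have h: "continuous_on UNIV (h n)" for n unfolding h_def by (intro continuous_intros g)
  have [measurable]: "h n \<in> borel_measurable M" for n by (rule measurable_continuous[OF h])
  have "(\<lambda>n. \<integral>x. norm (v x - h n x) powr p \<partial>M) \<longlonglongrightarrow> (\<integral>x. 0 \<partial>M)"
  proof (rule integral_dominated_convergence[where w = "\<lambda>x. (2 * N) powr p"])
    have "AE x in M. x \<notin> Z \<and> x \<in> \<Omega>"
      using AE_lebesgue_on_not_negligible[OF Z sets_Omega] AE_space by eventually_elim simp
    then show "AE x in M. (\<lambda>n. norm (v x - h n x) powr p) \<longlonglongrightarrow> 0"
    proof (rule eventually_mono)
      fix x assume x: "x \<notin> Z \<and> x \<in> \<Omega>"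
      have "max (- N) (min N (v x)) = v x" using N[of x] by (auto simp: max_def min_def)
      then have "(\<lambda>n. h n x) \<longlonglongrightarrow> v x"
        unfolding h_def using lim[of x] x tendsto_max[OF tendsto_const tendsto_min[OF tendsto_const], of "\<lambda>n. g n x" "v x" sequentially "- N" N]
        by auto
      then have "(\<lambda>n. norm (v x - h n x)) \<longlonglongrightarrow> norm (v x - v x)"
        by (intro tendsto_intros)
      then show "(\<lambda>n. norm (v x - h n x) powr p) \<longlonglongrightarrow> 0"
        using tendsto_zero_powrI[of "\<lambda>n. norm (v x - h n x)" sequentially "\<lambda>_. p" p] p_pos by simp
    qed
    show "AE x in M. norm (norm (v x - h n x) powr p) \<le> (2 * N) powr p" for n
      using abs_clamp_diff_le(1)[OF N] p_pos by (intro AE_I2) (auto simp: h_def intro!: powr_mono2)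
  qed simp_all
  then have "\<forall>\<^sub>F n in sequentially. (\<integral>x. norm (v x - h n x) powr p \<partial>M) < \<delta>"
    using \<open>0 < \<delta>\<close> by (auto dest: order_tendstoD)
  then obtain n where n: "(\<integral>x. norm (v x - h n x) powr p \<partial>M) < \<delta>"
    by (auto dest: eventually_happens)
  show thesis by (rule that[OF h[of n] n]) (use \<open>0 \<le> N\<close> in \<open>auto simp: h_def\<close>)
qed

lemma expsum_in_Lp:
  assumes "bounded \<Omega>" "expsum w" shows "w \<in> Lp p \<Omega>"
proof -
  obtain K where "\<And>x. x \<in> \<Omega> \<Longrightarrow> norm (w x) \<le> K"
    using continuous_bounded_on[OF expsum_continuous[OF assms(2)] assms(1)] by blast
  then show ?thesis by (rule Lp_bounded[OF measurable_continuous[OF expsum_continuous[OF assms(2)]]])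
qed

lemma integral_norm_add_powr_le:
  fixes u v :: "'a \<Rightarrow> 'b::euclidean_space"
  assumes "u \<in> Lp p \<Omega>" "v \<in> Lp p \<Omega>"
  shows "(\<integral>x. norm (u x + v x) powr p \<partial>M) \<le> 2 powr p * ((\<integral>x. norm (u x) powr p \<partial>M) + (\<integral>x. norm (v x) powr p \<partial>M))"
proof -
  note [simp] = assms[THEN LpD(2)] LpD(2)[OF Lp_add[OF assms]]
  have "(\<integral>x. norm (u x + v x) powr p \<partial>M) \<le> (\<integral>x. 2 powr p * (norm (u x) powr p + norm (v x) powr p) \<partial>M)"
    by (intro integral_mono norm_add_powr_le[OF p_pos]) auto
  also have "\<dots> = 2 powr p * ((\<integral>x. norm (u x) powr p \<partial>M) + (\<integral>x. norm (v x) powr p \<partial>M))"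
    by simp
  finally show ?thesis .
qed

lemma expsum_dense:
  fixes u :: "'a \<Rightarrow> real"
  assumes u: "u \<in> Lp p \<Omega>" and bdd: "bounded \<Omega>" and "0 < \<delta>"
  obtains w where "expsum w" "(\<integral>x. norm (u x - w x) powr p \<partial>M) < \<delta>"
proof -
  note [measurable] = LpD(1)[OF u]
  \<comment> \<open>Three errors below \<open>d\<close> (truncation, continuity, exponentials) are
    joined by two uses of the \<open>2 powr p\<close> inequality; the denominator is the resulting
    constant.\<close>
  define d where "d = \<delta> / (2 powr p * (1 + 2 powr p * 2))"
  have pp: "0 < 2 powr p" by simp
  have c0: "0 < 2 powr p * (1 + 2 powr p * 2)" using pp by (intro mult_pos_pos add_pos_pos) auto
  then have d: "0 < d" using \<open>0 < \<delta>\<close> by (simp add: d_def)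
  have "\<forall>\<^sub>F n in sequentially. (\<integral>x. norm (u x - max (- real n) (min (real n) (u x))) powr p \<partial>M) < d"
    using truncation_Lp_tendsto[OF u] d by (auto dest: order_tendstoD)
  then obtain n where n: "(\<integral>x. norm (u x - max (- real n) (min (real n) (u x))) powr p \<partial>M) < d"
    by (auto dest: eventually_happens)
  define v where "v x = max (- real n) (min (real n) (u x))" for x
  have v: "v \<in> borel_measurable M" unfolding v_def by measurable
  have vN: "v x \<in> {- real n..real n}" for x by (auto simp: v_def)
  obtain h where h: "continuous_on UNIV h" "(\<integral>x. norm (v x - h x) powr p \<partial>M) < d" "\<And>x. \<bar>h x\<bar> \<le> real n"
    using bounded_approx_continuous[OF v vN d] by blast
  define m where "m = measure M \<Omega>"
  have m: "0 \<le> m" by (simp add: m_def)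
  \<comment> \<open>The uniform error whose \<open>p\<close>-th power integrates to less than
    \<open>d\<close>; the summand 1 covers a null set \<Omega>.\<close>
  define e where "e = (d / (m + 1)) powr (1 / p)"
  have e: "0 < e" "e powr p = d / (m + 1)" using d m p_pos by (auto simp: e_def powr_powr)
  obtain w where w: "expsum w" "\<And>x. x \<in> closure \<Omega> \<Longrightarrow> \<bar>h x - w x\<bar> < e"
    using expsum_uniformly_dense[of "closure \<Omega>" h e] bdd h(1) e(1) continuous_on_subset compact_closure by blast
  have "norm (v x) \<le> real n" for x using vN[of x] by auto
  then have vL: "v \<in> Lp p \<Omega>" by (rule Lp_bounded[OF v])
  have hL: "h \<in> Lp p \<Omega>" using h(3) by (intro Lp_bounded[OF measurable_continuous[OF h(1)], of "real n"]) auto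
  note wL = expsum_in_Lp[OF bdd w(1)]
  have "(\<integral>x. norm (h x - w x) powr p \<partial>M) \<le> (\<integral>x. e powr p \<partial>M)"
    using LpD(2)[OF Lp_diff[OF hL wL]] w(2) closure_subset[of \<Omega>] p_pos less_imp_le
    by (intro integral_mono) (auto intro!: powr_mono2 intro: less_imp_le)
  also have "\<dots> = d * m / (m + 1)" using e(2) by (simp add: m_def)
  also have "\<dots> < d" using d m by (simp add: field_simps)
  finally have hw: "(\<integral>x. norm (h x - w x) powr p \<partial>M) < d" .
  have 1: "(\<integral>x. norm ((v x - h x) + (h x - w x)) powr p \<partial>M) \<le> 2 powr p * (d + d)"
    by (rule order_trans[OF integral_norm_add_powr_le[OF Lp_diff[OF vL hL] Lp_diff[OF hL wL]]])
       (use h(2) hw in \<open>intro mult_left_mono add_mono; simp\<close>)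
  have "(\<integral>x. norm ((u x - v x) + (v x - w x)) powr p \<partial>M) \<le>
      2 powr p * ((\<integral>x. norm (u x - v x) powr p \<partial>M) + (\<integral>x. norm (v x - w x) powr p \<partial>M))"
    by (rule integral_norm_add_powr_le[OF Lp_diff[OF u vL] Lp_diff[OF vL wL]])
  also have "\<dots> < 2 powr p * (d + 2 powr p * (d + d))"
    using n 1 by (intro mult_strict_left_mono add_less_le_mono) (auto simp: v_def)
  also have "\<dots> = d * (2 powr p * (1 + 2 powr p * 2))" by (simp add: algebra_simps)
  also have "\<dots> = \<delta>" unfolding d_def using c0 by (metis nonzero_divide_eq_eq order_less_irrefl times_divide_eq_left)
  finally show thesis using that[OF w(1)] by simp
qed

end

subsection \<open>Approximate Riesz representation\<close>

text \<open>The gradient of the \<open>p\<close>-th power of the norm. For \<open>p < 2\<close> the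
  scalar factor is singular at the origin; there the value is 0, and \<open>norm_pgrad\<close> gives
  continuity.\<close>

definition pgrad :: "real \<Rightarrow> 'b::euclidean_space \<Rightarrow> 'b" where
  "pgrad p a = (p * norm a powr (p - 2)) *\<^sub>R a"

lemma norm_pgrad: "p > 0 \<Longrightarrow> norm (pgrad p a) = p * norm a powr (p - 1)"
proof (cases "a = 0")
  case False
  assume "p > 0"
  have "norm a powr (p - 1) = norm a powr (p - 2) * norm a"
    using powr_mult_base[of "norm a" "p - 2"] by (simp add: mult.commute)
  then show ?thesis using \<open>p > 0\<close> by (simp add: pgrad_def)
qed (simp add: pgrad_def)

text \<open>Young's inequality bounds \<open>p * norm x powr (p - 1) * norm y\<close> by
  \<open>norm y powr p + (p - 1) * norm x powr p\<close>, and \<open>pgrad p x \<bullet> x\<close>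
  equals \<open>p * norm x powr p\<close>.\<close>

lemma powr_convex_gradient:
  fixes x y :: "'b::euclidean_space"
  assumes p: "p > 1"
  shows "norm x powr p + pgrad p x \<bullet> (y - x) \<le> norm y powr p"
proof -
  define q where "q = p / (p - 1)"
  have q: "q > 1" "1 / p + 1 / q = 1" "(p - 1) * q = p" using p by (auto simp: q_def field_simps)
  have "norm y * norm x powr (p - 1) \<le> norm y powr p / p + (norm x powr (p - 1)) powr q / q"
    using p q by (intro Youngs_inequality) auto
  also have "(norm x powr (p - 1)) powr q = norm x powr p" using q by (simp add: powr_powr)
  also have "norm x powr p / q = (1 / q) * norm x powr p" by simp
  also have "1 / q = 1 - 1 / p" using q(2) by simp
  finally have "p * (norm y * norm x powr (p - 1)) \<le> p * (norm y powr p / p + (1 - 1 / p) * norm x powr p)"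
    using p by (intro mult_left_mono) auto
  also have "\<dots> = norm y powr p + (p - 1) * norm x powr p" using p by (simp add: field_simps)
  finally have 1: "p * norm x powr (p - 1) * norm y \<le> norm y powr p + (p - 1) * norm x powr p" by (simp add: mult_ac)
  have "pgrad p x \<bullet> y \<le> norm (pgrad p x) * norm y" by (rule norm_cauchy_schwarz)
  also have "\<dots> = p * norm x powr (p - 1) * norm y" using p by (simp add: norm_pgrad)
  finally have 2: "pgrad p x \<bullet> y \<le> norm y powr p + (p - 1) * norm x powr p" using 1 by linarith
  have 3: "pgrad p x \<bullet> x = p * norm x powr p"
  proof (cases "x = 0")
    case False
    have "norm x powr p = norm x powr (p - 2) * norm x powr 2"
      using powr_add[of "norm x" "p - 2" 2] by simp
    also have "norm x powr 2 = x \<bullet> x" using False by (simp add: dot_square_norm powr_numeral)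
    finally show ?thesis by (simp add: pgrad_def)
  qed (simp add: pgrad_def)
  show ?thesis using 2 3 by (simp add: inner_diff_right algebra_simps)
qed

lemma continuous_pgrad:
  assumes p: "p > 1" shows "continuous_on UNIV (pgrad p :: 'b::euclidean_space \<Rightarrow> 'b)"
  unfolding continuous_on_eq_continuous_at[OF open_UNIV]
proof
  fix a :: 'b
  show "isCont (pgrad p) a"
  proof (cases "a = 0")
    case True
    have "((\<lambda>x::'b. p * norm x powr (p - 1)) \<longlongrightarrow> p * 0) (at 0)"
    proof (rule tendsto_mult[OF tendsto_const])
      have "((\<lambda>x::'b. norm x) \<longlongrightarrow> 0) (at 0)" by (rule tendsto_norm_zero) (rule tendsto_ident_at)
      then show "((\<lambda>x::'b. norm x powr (p - 1)) \<longlongrightarrow> 0) (at 0)"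
        by (rule tendsto_zero_powrI[OF _ tendsto_const]) (use p in auto)
    qed
    then have "((\<lambda>x::'b. norm (pgrad p x)) \<longlongrightarrow> 0) (at 0)" using p by (simp add: norm_pgrad)
    then have "(pgrad p \<longlongrightarrow> (0::'b)) (at 0)" by (rule tendsto_norm_zero_cancel)
    then show ?thesis using True by (simp add: isCont_def pgrad_def)
  next
    case False
    then show ?thesis unfolding pgrad_def[abs_def] by (intro continuous_intros) auto
  qed
qed

lemma pgrad_scaleR: "r > 0 \<Longrightarrow> pgrad p (r *\<^sub>R a) = r powr (p - 1) *\<^sub>R pgrad p a"
proof -
  assume r: "r > 0"
  have "r powr (p - 1) = r powr (p - 2) * r"
    using r powr_mult_base[of r "p - 2"] by (simp add: mult.commute)
  then show ?thesis using r by (simp add: pgrad_def powr_mult mult_ac)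
qed

text \<open>By homogeneity the remainder need only be controlled on the unit ball, where \<open>pgrad\<close> is uniformly continuous.\<close>

lemma norm_powr_Taylor:
  assumes p: "p > 1" and "0 < \<delta>"
  obtains t where "0 < t" "t < 1"
    "\<And>a b :: 'b::euclidean_space. norm (a + t *\<^sub>R b) powr p \<le> norm a powr p + t * (pgrad p a \<bullet> b) + t * \<delta> * (norm a powr p + norm b powr p)"
proof -
  have "uniformly_continuous_on (cball (0::'b) 2) (pgrad p)"
    by (rule compact_uniformly_continuous[OF continuous_on_subset[OF continuous_pgrad[OF p]]]) auto
  then have "\<exists>r>0. \<forall>x\<in>cball (0::'b) 2. \<forall>y\<in>cball 0 2. dist y x < r \<longrightarrow> dist (pgrad p y) (pgrad p x) < \<delta>"
    using \<open>0 < \<delta>\<close> unfolding uniformly_continuous_on_def by blast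
  then obtain r where r: "0 < r" "\<And>x y :: 'b. norm x \<le> 2 \<Longrightarrow> norm y \<le> 2 \<Longrightarrow> dist x y < r \<Longrightarrow> dist (pgrad p x) (pgrad p y) < \<delta>"
    by auto
  \<comment> \<open>With \<open>t < r\<close> the shift by \<open>t *\<^sub>R b'\<close> stays
    within the modulus of continuity, and with \<open>t <= 1/2\<close> it stays inside the ball of
    radius 2.\<close>
  define t where "t = min (1/2) (r / 2)"
  have t: "0 < t" "t < 1" "t < r" using r(1) by (auto simp: t_def)
  show thesis
  proof (rule that[OF t(1,2)])
    fix a b :: 'b
    \<comment> \<open>Dividing by \<open>R\<close> puts both vectors into the unit ball, while
      \<open>R powr p\<close> is exactly the weight in the error term.\<close>
    define R where "R = (norm a powr p + norm b powr p) powr (1 / p)"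
    show "norm (a + t *\<^sub>R b) powr p \<le> norm a powr p + t * (pgrad p a \<bullet> b) + t * \<delta> * (norm a powr p + norm b powr p)"
    proof (cases "a = 0 \<and> b = 0")
      case False
      then have pos: "0 < norm a powr p + norm b powr p"
        by (metis add_pos_nonneg add_nonneg_pos powr_ge_zero powr_gt_zero norm_eq_zero)
      then have R: "0 < R" "R powr p = norm a powr p + norm b powr p"
        using p by (auto simp: R_def powr_powr)
      have le: "norm a \<le> R" "norm b \<le> R"
        using R p powr_less_mono2[of p R "norm a"] powr_less_mono2[of p R "norm b"] by (force simp: not_less[symmetric])+
      define a' b' where "a' = a /\<^sub>R R" and "b' = b /\<^sub>R R"
      have ab: "a = R *\<^sub>R a'" "b = R *\<^sub>R b'" using R by (auto simp: a'_def b'_def)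
      have n: "norm a' \<le> 1" "norm b' \<le> 1" using le R by (auto simp: a'_def b'_def field_simps)
      have tb: "norm (t *\<^sub>R b') \<le> t * 1" using n t by (auto simp: mult_left_le)
      have "norm (a' + t *\<^sub>R b') \<le> 2" using norm_triangle_ineq[of a' "t *\<^sub>R b'"] n tb t by linarith
      then have "dist (pgrad p (a' + t *\<^sub>R b')) (pgrad p a') < \<delta>"
        using le_less_trans[OF tb, of r] t n by (intro r(2)) (auto simp: dist_norm)
      then have d: "norm (pgrad p (a' + t *\<^sub>R b') - pgrad p a') \<le> \<delta>" by (simp add: dist_norm)
      have e: "a + t *\<^sub>R b = R *\<^sub>R (a' + t *\<^sub>R b')" by (simp add: ab algebra_simps)
      have "pgrad p (a + t *\<^sub>R b) - pgrad p a = R powr (p - 1) *\<^sub>R (pgrad p (a' + t *\<^sub>R b') - pgrad p a')"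
        unfolding e unfolding ab(1) by (simp only: pgrad_scaleR[OF R(1)] scaleR_diff_right)
      then have "norm (pgrad p (a + t *\<^sub>R b) - pgrad p a) \<le> R powr (p - 1) * \<delta>"
        using d by (simp add: mult_left_mono)
      then have "(pgrad p (a + t *\<^sub>R b) - pgrad p a) \<bullet> b \<le> (R powr (p - 1) * \<delta>) * R"
        using le(2) R \<open>0 < \<delta>\<close> by (intro order_trans[OF norm_cauchy_schwarz] mult_mono) auto
      also have "\<dots> = \<delta> * (R * R powr (p - 1))" by simp
      also have "R * R powr (p - 1) = R powr p" using powr_mult_base[of R "p - 1"] R by simp
      finally have "t * ((pgrad p (a + t *\<^sub>R b) - pgrad p a) \<bullet> b) \<le> t * (\<delta> * (norm a powr p + norm b powr p))"
        using t R by (intro mult_left_mono) auto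
      \<comment> \<open>The gradient inequality is used at the shifted point, because an upper bound
        for the value there is wanted.\<close>
      moreover have "norm (a + t *\<^sub>R b) powr p + pgrad p (a + t *\<^sub>R b) \<bullet> (a - (a + t *\<^sub>R b)) \<le> norm a powr p"
        by (rule powr_convex_gradient[OF p])
      ultimately show ?thesis by (simp add: inner_diff_left algebra_simps)
    qed (use p in \<open>simp add: pgrad_def\<close>)
  qed
qed

lemma linear_le_powr:
  fixes p :: real
  assumes "p > 1" "0 < \<eta>" "0 \<le> K"
  obtains c where "0 \<le> c" "\<And>s. 0 \<le> s \<Longrightarrow> K * s \<le> \<eta> * s powr p + c"
proof -
  \<comment> \<open>The point where \<open>K = \<eta> * s powr (p - 1)\<close>: beyond it the power
    dominates, before it \<open>K * s0\<close> does.\<close>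
  define s0 where "s0 = (K / \<eta>) powr (1 / (p - 1))"
  have "K * s \<le> \<eta> * s powr p + K * s0" if "0 \<le> s" for s
  proof (cases "s \<le> s0")
    case True
    then have "K * s \<le> K * s0" using assms by (intro mult_left_mono)
    then show ?thesis using assms by (simp add: add_increasing)
  next
    case False
    then have s: "0 < s" using s0_def by (metis not_less order_trans powr_ge_zero linorder_not_le that le_less)
    have "K / \<eta> = s0 powr (p - 1)" using assms by (simp add: s0_def powr_powr)
    also have "\<dots> \<le> s powr (p - 1)" using False assms by (intro powr_mono2) (auto simp: s0_def)
    finally have "K \<le> \<eta> * s powr (p - 1)" using assms by (simp add: field_simps)
    then have "K * s \<le> \<eta> * (s * s powr (p - 1))" using s by (simp add: mult_ac)
    also have "s * s powr (p - 1) = s powr p" using powr_mult_base[of s "p - 1"] s by simp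
    finally show ?thesis using assms by (simp add: add_increasing2 s0_def)
  qed
  then show thesis using that[of "K * s0"] assms by (simp add: s0_def)
qed

lemma Young_eps:
  fixes p q :: real
  assumes "p > 1" "0 < \<eta>" and q: "q = p / (p - 1)"
  obtains C where "0 < C" "\<And>\<alpha> \<beta>. 0 \<le> \<alpha> \<Longrightarrow> 0 \<le> \<beta> \<Longrightarrow> \<alpha> * \<beta> \<le> \<eta> * \<beta> powr p + C * \<alpha> powr q"
proof -
  have q1: "q > 1" "1 / p + 1 / q = 1" unfolding q using assms(1) by (auto simp: field_simps)
  \<comment> \<open>Young's inequality for \<open>e * \<beta>\<close> and
    \<open>\<alpha> / e\<close> with \<open>e powr p = \<eta>\<close>; the factors
    \<open>1 / p\<close> and \<open>1 / q\<close> are dropped.\<close>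
  define e where "e = \<eta> powr (1 / p)"
  have e: "0 < e" "e powr p = \<eta>" using assms by (auto simp: e_def powr_powr)
  have "\<alpha> * \<beta> \<le> \<eta> * \<beta> powr p + ((1 / e) powr q) * \<alpha> powr q" if "0 \<le> \<alpha>" "0 \<le> \<beta>" for \<alpha> \<beta>
  proof -
    have "\<alpha> * \<beta> = (e * \<beta>) * (\<alpha> / e)" using e by simp
    also have "\<dots> \<le> (e * \<beta>) powr p / p + (\<alpha> / e) powr q / q"
      using that e assms q1 by (intro Youngs_inequality) auto
    also have "\<dots> \<le> (e * \<beta>) powr p + (\<alpha> / e) powr q"
      using assms(1) q1(1) by (intro add_mono divide_le_eq_1_pos[THEN iffD2]) (auto simp: divide_le_eq mult_le_cancel_left1)
    finally show ?thesis using e that by (simp add: powr_mult powr_divide)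
  qed
  then show thesis using that[of "(1 / e) powr q"] e by simp
qed

context finite_domain
begin

lemma Lp_dualD:
  fixes l :: "('a \<Rightarrow> 'b::euclidean_space) \<Rightarrow> real"
  assumes "l \<in> Lp_dual p \<Omega>"
  shows "u \<in> Lp p \<Omega> \<Longrightarrow> v \<in> Lp p \<Omega> \<Longrightarrow> l (\<lambda>x. u x + v x) = l u + l v"
    "u \<in> Lp p \<Omega> \<Longrightarrow> l (\<lambda>x. c *\<^sub>R u x) = c * l u"
    "\<exists>K\<ge>0. \<forall>u\<in>Lp p \<Omega>. \<bar>l u\<bar> \<le> K * Lp_norm p \<Omega> u"
proof -
  obtain K where K: "\<forall>u\<in>Lp p \<Omega>. \<bar>l u\<bar> \<le> K * Lp_norm p \<Omega> u" using assms by (auto simp: Lp_dual_def)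
  have "\<bar>l u\<bar> \<le> \<bar>K\<bar> * Lp_norm p \<Omega> u" if "u \<in> Lp p \<Omega>" for u
    using K that mult_right_mono[OF abs_ge_self[of K], of "Lp_norm p \<Omega> u"] by (force simp: Lp_norm_def)
  then show "\<exists>K\<ge>0. \<forall>u\<in>Lp p \<Omega>. \<bar>l u\<bar> \<le> K * Lp_norm p \<Omega> u" by (intro exI[of _ "\<bar>K\<bar>"]) simp
qed (use assms in \<open>auto simp: Lp_dual_def\<close>)

lemma integrable_pgrad_inner:
  fixes w z :: "'a \<Rightarrow> 'b::euclidean_space"
  assumes "w \<in> Lp p \<Omega>" "z \<in> Lp p \<Omega>"
  shows "integrable M (\<lambda>x. pgrad p (w x) \<bullet> z x)"
proof (rule Bochner_Integration.integrable_bound)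
  show "integrable M (\<lambda>x. p * (norm (w x) powr p + norm (z x) powr p))"
    using assms[THEN LpD(2)] by simp
  have "(\<lambda>x. pgrad p (w x)) \<in> borel_measurable M"
    by (rule measurable_compose[OF LpD(1)[OF assms(1)] borel_measurable_continuous_onI[OF continuous_pgrad[OF p_gt_1]]])
  then show "(\<lambda>x. pgrad p (w x) \<bullet> z x) \<in> borel_measurable M"
    by (rule borel_measurable_inner) (rule LpD(1)[OF assms(2)])
  have "\<bar>pgrad p a \<bullet> b\<bar> \<le> p * (norm a powr p + norm b powr p)" for a b :: 'b
  proof -
    define m where "m = max (norm a) (norm b)"
    have "\<bar>pgrad p a \<bullet> b\<bar> \<le> (p * norm a powr (p - 1)) * norm b"
      using Cauchy_Schwarz_ineq2[of "pgrad p a" b] p_pos by (simp add: norm_pgrad)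
    also have "\<dots> \<le> (p * m powr (p - 1)) * m"
      using p_gt_1 by (intro mult_mono mult_left_mono powr_mono2) (auto simp: m_def)
    also have "\<dots> = p * (m * m powr (p - 1))" by simp
    also have "m * m powr (p - 1) = m powr p"
      using powr_mult_base[of m "p - 1"] by (simp add: m_def le_max_iff_disj)
    also have "p * m powr p \<le> p * (norm a powr p + norm b powr p)"
      using p_pos by (intro mult_left_mono) (auto simp: m_def max_def)
    finally show ?thesis .
  qed
  then show "AE x in M. norm (pgrad p (w x) \<bullet> z x) \<le> norm (p * (norm (w x) powr p + norm (z x) powr p))"
    by (intro AE_I2) (auto intro: order_trans[OF _ abs_ge_self])
qed

text \<open>A near-minimiser \<open>w\<close> of \<open>\<integral>\<bar>w\<bar>\<^sup>p - l w\<close> almost satisfies the Euler-Lagrange equation \<open>l = pgrad p w\<close>.\<close>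

lemma approximate_Riesz:
  fixes l :: "('a \<Rightarrow> 'b::euclidean_space) \<Rightarrow> real"
  assumes l: "l \<in> Lp_dual p \<Omega>" and "0 \<le> B" "0 < \<kappa>"
  obtains w where "w \<in> Lp p \<Omega>"
    "\<And>z. z \<in> Lp p \<Omega> \<Longrightarrow> (\<integral>x. norm (z x) powr p \<partial>M) \<le> B \<Longrightarrow> \<bar>l z - (\<integral>x. pgrad p (w x) \<bullet> z x \<partial>M)\<bar> \<le> \<kappa>"
proof -
  define N where "N z = (\<integral>x. norm (z x) powr p \<partial>M)" for z :: "'a \<Rightarrow> 'b"
  have N0: "0 \<le> N z" for z by (simp add: N_def)
  define J where "J z = N z - l z" for z
  obtain K where K: "0 \<le> K" "\<And>u. u \<in> Lp p \<Omega> \<Longrightarrow> \<bar>l u\<bar> \<le> K * Lp_norm p \<Omega> u"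
    using Lp_dualD(3)[OF l] by blast
  obtain c where c: "0 \<le> c" "\<And>s. 0 \<le> s \<Longrightarrow> K * s \<le> (1/2) * s powr p + c"
    using linear_le_powr[OF p_gt_1 _ K(1), of "1/2"] by (metis half_gt_zero zero_less_one)
  \<comment> \<open>Half of the \<open>p\<close>-th power absorbs the linear term, so
    \<open>J\<close> is bounded below and its sublevel sets are bounded.\<close>
  have Jlow: "J z \<ge> N z / 2 - c" if "z \<in> Lp p \<Omega>" for z
  proof -
    have "Lp_norm p \<Omega> z powr p = N z" using p_pos N0[of z] by (simp add: Lp_norm_def N_def powr_powr)
    moreover have "0 \<le> Lp_norm p \<Omega> z" by (simp add: Lp_norm_def)
    ultimately have "l z \<le> N z / 2 + c" using K(2)[OF that] c(2)[of "Lp_norm p \<Omega> z"] by force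
    then show ?thesis by (simp add: J_def)
  qed
  define m where "m = Inf (J ` Lp p \<Omega>)"
  have bdd: "bdd_below (J ` Lp p \<Omega>)"
    using Jlow N0 by (intro bdd_belowI[of _ "- c"]) (force intro: order_trans[of "- c" "N _ / 2 - c"])
  have zero: "(\<lambda>x. 0::'b) \<in> Lp p \<Omega>" by (rule Lp_bounded[of _ 0]) auto
  have J0: "J (\<lambda>x. 0) = 0" using Lp_dualD(2)[OF l zero, of 0] p_pos by (simp add: J_def N_def)
  have m_le: "m \<le> J z" if "z \<in> Lp p \<Omega>" for z
    unfolding m_def using that bdd by (intro cInf_lower) auto
  have "m \<le> 0" using m_le[OF zero] J0 by simp
  \<comment> \<open>The bound for a near-minimiser \<open>w\<close>: \<open>J w\<close> is below 1
    because \<open>J 0 = 0\<close> and \<open>\<eta> <= 1\<close>, and \<open>Jlow\<close> then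
    controls \<open>N w\<close>.\<close>
  define B0 where "B0 = 2 * (c + 1)"
  define \<delta> where "\<delta> = \<kappa> / (2 * (B0 + B + 1))"
  have B0: "0 < B0 + B + 1" using c(1) \<open>0 \<le> B\<close> by (simp add: B0_def)
  have \<delta>: "0 < \<delta>" using \<open>0 < \<kappa>\<close> B0 by (simp add: \<delta>_def)
  have \<delta>B: "\<delta> * (B0 + B) \<le> \<kappa> / 2"
    using B0 \<open>0 < \<kappa>\<close> by (simp add: \<delta>_def field_simps)
  obtain t where t: "0 < t" "t < 1" and
    Taylor: "\<And>a b :: 'b. norm (a + t *\<^sub>R b) powr p \<le> norm a powr p + t * (pgrad p a \<bullet> b) + t * \<delta> * (norm a powr p + norm b powr p)"
    using norm_powr_Taylor[OF p_gt_1 \<delta>] by blast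
  \<comment> \<open>Chosen after \<open>t\<close>: the minimisation defect \<eta> is divided by
    \<open>t\<close> at the end and must still leave at most half of \<kappa>.\<close>
  define \<eta> where "\<eta> = min 1 (t * \<kappa> / 2)"
  have \<eta>: "0 < \<eta>" "\<eta> \<le> 1" "\<eta> \<le> t * \<kappa> / 2" using t \<open>0 < \<kappa>\<close> by (auto simp: \<eta>_def)
  have "\<exists>y\<in>J ` Lp p \<Omega>. y < m + \<eta>"
    unfolding m_def using zero \<eta>(1) bdd by (intro cInf_lessD) auto
  then obtain w where w: "w \<in> Lp p \<Omega>" "J w < m + \<eta>" by auto
  have NwB: "N w \<le> B0" using Jlow[OF w(1)] w(2) \<open>m \<le> 0\<close> \<eta>(2) by (simp add: B0_def)
  have one: "l z \<le> (\<integral>x. pgrad p (w x) \<bullet> z x \<partial>M) + \<kappa>" if z: "z \<in> Lp p \<Omega>" "N z \<le> B" for z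
  proof -
    have tz: "(\<lambda>x. t *\<^sub>R z x) \<in> Lp p \<Omega>" by (rule Lp_scaleR[OF z(1)])
    note wz = Lp_add[OF w(1) tz]
    note [simp] = integrable_pgrad_inner[OF w(1) z(1)] LpD(2)[OF w(1)] LpD(2)[OF z(1)] LpD(2)[OF wz]
    have "N (\<lambda>x. w x + t *\<^sub>R z x) \<le>
        (\<integral>x. norm (w x) powr p + t * (pgrad p (w x) \<bullet> z x) + t * \<delta> * (norm (w x) powr p + norm (z x) powr p) \<partial>M)"
      unfolding N_def by (intro integral_mono Taylor) auto
    also have "\<dots> = N w + t * (\<integral>x. pgrad p (w x) \<bullet> z x \<partial>M) + t * \<delta> * (N w + N z)"
      by (simp add: N_def)
    also have "t * \<delta> * (N w + N z) \<le> t * \<delta> * (B0 + B)"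
      using t \<delta> NwB z(2) by (intro mult_left_mono) auto
    also have "\<dots> \<le> t * (\<kappa> / 2)" using \<delta>B t by (simp add: mult.assoc)
    finally have 1: "N (\<lambda>x. w x + t *\<^sub>R z x) \<le> N w + t * (\<integral>x. pgrad p (w x) \<bullet> z x \<partial>M) + t * (\<kappa> / 2)" by simp
    have "J w - \<eta> < J (\<lambda>x. w x + t *\<^sub>R z x)" using m_le[OF wz] w(2) by linarith
    moreover have "l (\<lambda>x. w x + t *\<^sub>R z x) = l w + t * l z"
      using Lp_dualD(1)[OF l w(1) tz] Lp_dualD(2)[OF l z(1)] by simp
    ultimately have "t * l z < t * (\<integral>x. pgrad p (w x) \<bullet> z x \<partial>M) + t * (\<kappa> / 2) + \<eta>"
      using 1 by (simp add: J_def)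
    also have "\<dots> \<le> t * ((\<integral>x. pgrad p (w x) \<bullet> z x \<partial>M) + \<kappa>)" using \<eta>(3) by (simp add: algebra_simps)
    finally show ?thesis using t by simp
  qed
  show thesis
  proof (rule that[OF w(1)])
    fix z :: "'a \<Rightarrow> 'b" assume z: "z \<in> Lp p \<Omega>" "(\<integral>x. norm (z x) powr p \<partial>M) \<le> B"
    have mz: "(\<lambda>x. (-1) *\<^sub>R z x) \<in> Lp p \<Omega>" by (rule Lp_scaleR[OF z(1)])
    have "l (\<lambda>x. (-1) *\<^sub>R z x) = - l z" using Lp_dualD(2)[OF l z(1), of "-1"] by simp
    moreover have "N (\<lambda>x. (-1) *\<^sub>R z x) \<le> B" using z(2) by (simp add: N_def)
    ultimately have "- l z \<le> - (\<integral>x. pgrad p (w x) \<bullet> z x \<partial>M) + \<kappa>" using one[OF mz] by simp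
    then show "\<bar>l z - (\<integral>x. pgrad p (w x) \<bullet> z x \<partial>M)\<bar> \<le> \<kappa>" using one[OF z(1)] z(2) by (simp add: N_def)
  qed
qed

text \<open>Up to \<kappa> the functional is integration against \<open>pgrad p (w x)\<close>, whose
  coordinates lie in the conjugate space \<open>L^q\<close> and are approximated there by
  exponential sums. The bound \<open>B\<close> makes both errors uniform along the filter.\<close>

lemma weak_tendsto_zeroI:
  fixes z :: "'i \<Rightarrow> 'a \<Rightarrow> 'b::euclidean_space"
  assumes bdd: "bounded \<Omega>" and l: "l \<in> Lp_dual p \<Omega>"
    and z: "\<forall>\<^sub>F i in F. z i \<in> Lp p \<Omega> \<and> (\<integral>x. norm (z i x) powr p \<partial>M) \<le> B"
    and lim: "\<And>a b. b \<in> Basis \<Longrightarrow> ((\<lambda>i. \<integral>x. exp (a \<bullet> x) * (z i x \<bullet> b) \<partial>M) \<longlongrightarrow> 0) F"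
  shows "((\<lambda>i. l (z i)) \<longlongrightarrow> 0) F"
proof (rule tendstoI)
  fix e :: real assume "0 < e"
  define B' where "B' = max B 0"
  define D where "D = real (DIM('b))"
  have D: "1 \<le> D" using DIM_positive[where 'a = 'b] by (simp add: D_def Suc_leI)
  \<comment> \<open>One \<kappa> is lost in the representation of \<open>l\<close>, and three per
    coordinate: two from replacing the density by an exponential sum, one from the moment
    itself.\<close>
  define \<kappa> where "\<kappa> = e / (2 + 3 * D)"
  have \<kappa>: "0 < \<kappa>" using \<open>0 < e\<close> D by (simp add: \<kappa>_def)
  obtain w where w: "w \<in> Lp p \<Omega>" and
    R: "\<And>z. z \<in> Lp p \<Omega> \<Longrightarrow> (\<integral>x. norm (z x) powr p \<partial>M) \<le> B' \<Longrightarrow> \<bar>l z - (\<integral>x. pgrad p (w x) \<bullet> z x \<partial>M)\<bar> \<le> \<kappa>"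
    using approximate_Riesz[OF l _ \<kappa>, of B'] by (auto simp: B'_def)
  \<comment> \<open>Since \<open>(p - 1) * q = p\<close>, the \<open>q\<close>-th power of
    \<open>norm (pgrad p (w x))\<close> is a multiple of the integrable
    \<open>norm (w x) powr p\<close>.\<close>
  define q where "q = p / (p - 1)"
  have q: "1 < q" "(p - 1) * q = p" using p_gt_1 by (auto simp: q_def field_simps)
  interpret Q: finite_domain \<Omega> q by unfold_locales (use lm q in auto)
  define g where "g b x = pgrad p (w x) \<bullet> b" for b x
  have pm: "(\<lambda>x. pgrad p (w x)) \<in> borel_measurable M"
    by (rule measurable_compose[OF LpD(1)[OF w] borel_measurable_continuous_onI[OF continuous_pgrad[OF p_gt_1]]])
  have gq: "g b \<in> Lp q \<Omega>" if b: "b \<in> Basis" for b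
  proof (rule Q.Lp_dominated)
    show "g b \<in> borel_measurable M" unfolding g_def[abs_def]
      by (intro borel_measurable_inner pm borel_measurable_const)
    show "integrable M (\<lambda>x. p powr q * norm (w x) powr p)" using LpD(2)[OF w] by simp
    fix x
    have "norm (g b x) \<le> norm (pgrad p (w x))" using b by (simp add: g_def Basis_le_norm)
    then have "norm (g b x) powr q \<le> (p * norm (w x) powr (p - 1)) powr q"
      using q p_pos by (intro powr_mono2) (auto simp: norm_pgrad)
    also have "\<dots> = p powr q * norm (w x) powr p" using q p_pos by (simp add: powr_mult powr_powr)
    finally show "norm (g b x) powr q \<le> p powr q * norm (w x) powr p" .
  qed
  have B': "0 < B' + 1" by (simp add: B'_def)
  have "0 < \<kappa> / (B' + 1)" using \<kappa> B' by simp
  \<comment> \<open>This weighting spends at most \<kappa> on the \<open>z\<close> part; the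
    constant \<open>C\<close> is compensated by approximating the density to within
    \<open>\<kappa> / C\<close>.\<close>
  then obtain C where C: "0 < C" "\<And>\<alpha> \<beta>. 0 \<le> \<alpha> \<Longrightarrow> 0 \<le> \<beta> \<Longrightarrow> \<alpha> * \<beta> \<le> \<kappa> / (B' + 1) * \<beta> powr p + C * \<alpha> powr q"
    using Young_eps[OF p_gt_1 _ q_def] by blast
  have "\<exists>f. \<forall>b\<in>Basis. expsum (f b) \<and> (\<integral>x. norm (g b x - f b x) powr q \<partial>M) < \<kappa> / C"
    by (intro bchoice ballI) (metis Q.expsum_dense[OF gq bdd] \<kappa> C(1) divide_pos_pos)
  then obtain f where f: "\<And>b. b \<in> Basis \<Longrightarrow> expsum (f b)"
    "\<And>b. b \<in> Basis \<Longrightarrow> (\<integral>x. norm (g b x - f b x) powr q \<partial>M) < \<kappa> / C" by blast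
  have exp_int: "integrable M (\<lambda>x. h x * (z x \<bullet> b))" if eh: "expsum h" and zL: "z \<in> Lp p \<Omega>" for h b and z :: "'a \<Rightarrow> 'b"
  proof -
    obtain K where K: "\<And>x. x \<in> \<Omega> \<Longrightarrow> norm (h x) \<le> K"
      using continuous_bounded_on[OF expsum_continuous[OF eh] bdd] by blast
    have "integrable M (\<lambda>x. (h x *\<^sub>R b) \<bullet> z x)"
    proof (rule Lp_inner_integrable[OF zL])
      show "(\<lambda>x. h x *\<^sub>R b) \<in> borel_measurable M"
        by (intro borel_measurable_scaleR borel_measurable_const measurable_continuous[OF expsum_continuous[OF eh]])
      show "norm (h x *\<^sub>R b) \<le> K * norm b" if "x \<in> \<Omega>" for x using K[OF that] by (simp add: mult_right_mono)
    qed
    then show ?thesis by (simp add: inner_commute)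
  qed
  have exp_lim: "((\<lambda>i. \<integral>x. h x * (z i x \<bullet> b) \<partial>M) \<longlongrightarrow> 0) F" if "expsum h" "b \<in> Basis" for h b
    using that(1)
  proof (induction rule: expsum.induct)
    case (base c a)
    have "((\<lambda>i. c * (\<integral>x. exp (a \<bullet> x) * (z i x \<bullet> b) \<partial>M)) \<longlongrightarrow> c * 0) F"
      by (intro tendsto_mult tendsto_const lim that)
    then show ?case by (simp add: mult.assoc)
  next
    case (add h1 h2)
    have "\<forall>\<^sub>F i in F. (\<integral>x. h1 x * (z i x \<bullet> b) \<partial>M) + (\<integral>x. h2 x * (z i x \<bullet> b) \<partial>M) = (\<integral>x. (h1 x + h2 x) * (z i x \<bullet> b) \<partial>M)"
      using z by eventually_elim (simp add: distrib_right exp_int add.hyps)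
    then show ?case using tendsto_add[OF add.IH] by (simp cong: filterlim_cong)
  qed
  have diff: "\<bar>\<integral>x. (g b x - f b x) * (z x \<bullet> b) \<partial>M\<bar> \<le> 2 * \<kappa>"
    and g_int: "integrable M (\<lambda>x. g b x * (z x \<bullet> b))"
    if b: "b \<in> Basis" and z: "z \<in> Lp p \<Omega>" "(\<integral>x. norm (z x) powr p \<partial>M) \<le> B'" for b and z :: "'a \<Rightarrow> 'b"
  proof -
    define d where "d x = g b x - f b x" for x
    have dL: "d \<in> Lp q \<Omega>" unfolding d_def by (rule Q.Lp_diff[OF gq[OF b] Q.expsum_in_Lp[OF bdd f(1)[OF b]]])
    have pw: "\<bar>d x * (z x \<bullet> b)\<bar> \<le> \<kappa> / (B' + 1) * norm (z x) powr p + C * norm (d x) powr q" for x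
    proof -
      have "\<bar>d x * (z x \<bullet> b)\<bar> \<le> norm (d x) * norm (z x)"
        using Basis_le_norm[OF b, of "z x"] by (simp add: abs_mult mult_left_mono)
      also have "\<dots> \<le> \<kappa> / (B' + 1) * norm (z x) powr p + C * norm (d x) powr q" by (intro C) auto
      finally show ?thesis .
    qed
    have i: "integrable M (\<lambda>x. \<kappa> / (B' + 1) * norm (z x) powr p + C * norm (d x) powr q)"
      using LpD(2)[OF z(1)] Q.LpD(2)[OF dL] by (intro Bochner_Integration.integrable_add integrable_mult_right) auto
    have i2: "integrable M (\<lambda>x. d x * (z x \<bullet> b))"
    proof (rule Bochner_Integration.integrable_bound[OF i])
      show "(\<lambda>x. d x * (z x \<bullet> b)) \<in> borel_measurable M"
        by (intro borel_measurable_times borel_measurable_inner borel_measurable_const Q.LpD(1)[OF dL] LpD(1)[OF z(1)])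
      show "AE x in M. norm (d x * (z x \<bullet> b)) \<le> norm (\<kappa> / (B' + 1) * norm (z x) powr p + C * norm (d x) powr q)"
        using pw by (intro AE_I2) (auto intro: order_trans[OF _ abs_ge_self])
    qed
    have "\<bar>\<integral>x. d x * (z x \<bullet> b) \<partial>M\<bar> \<le> (\<integral>x. \<bar>d x * (z x \<bullet> b)\<bar> \<partial>M)" by (rule integral_abs_bound)
    also have "\<dots> \<le> (\<integral>x. \<kappa> / (B' + 1) * norm (z x) powr p + C * norm (d x) powr q \<partial>M)"
      by (rule integral_mono[OF integrable_abs[OF i2] i pw])
    also have "\<dots> = \<kappa> / (B' + 1) * (\<integral>x. norm (z x) powr p \<partial>M) + C * (\<integral>x. norm (d x) powr q \<partial>M)"
      using LpD(2)[OF z(1)] Q.LpD(2)[OF dL] by simp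
    also have "\<dots> \<le> \<kappa> / (B' + 1) * B' + C * (\<kappa> / C)"
      using z(2) f(2)[OF b] \<kappa> B' C(1) by (intro add_mono mult_left_mono) (auto simp: d_def)
    also have "\<dots> \<le> 2 * \<kappa>" using \<kappa> B' C(1) by (simp add: field_simps)
    finally show "\<bar>\<integral>x. (g b x - f b x) * (z x \<bullet> b) \<partial>M\<bar> \<le> 2 * \<kappa>" by (simp add: d_def)
    show "integrable M (\<lambda>x. g b x * (z x \<bullet> b))"
      using Bochner_Integration.integrable_add[OF i2 exp_int[OF f(1)[OF b] z(1), of b]] by (simp add: d_def algebra_simps)
  qed
  have "\<forall>\<^sub>F i in F. \<forall>b\<in>Basis. \<bar>\<integral>x. f b x * (z i x \<bullet> b) \<partial>M\<bar> < \<kappa>"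
  proof (intro eventually_ball_finite ballI finite_Basis)
    fix b :: 'b assume b: "b \<in> Basis"
    show "\<forall>\<^sub>F i in F. \<bar>\<integral>x. f b x * (z i x \<bullet> b) \<partial>M\<bar> < \<kappa>"
      using tendstoD[OF exp_lim[OF f(1)[OF b] b] \<kappa>] by simp
  qed
  with z show "\<forall>\<^sub>F i in F. dist (l (z i)) 0 < e"
  proof eventually_elim
    case (elim i)
    then have zi: "z i \<in> Lp p \<Omega>" "(\<integral>x. norm (z i x) powr p \<partial>M) \<le> B'" by (auto simp: B'_def)
    have "\<bar>\<integral>x. g b x * (z i x \<bullet> b) \<partial>M\<bar> \<le> 3 * \<kappa>" if b: "b \<in> Basis" for b
    proof -
      have "(\<integral>x. (g b x - f b x) * (z i x \<bullet> b) \<partial>M) = (\<integral>x. g b x * (z i x \<bullet> b) \<partial>M) - (\<integral>x. f b x * (z i x \<bullet> b) \<partial>M)"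
        unfolding left_diff_distrib by (rule Bochner_Integration.integral_diff[OF g_int[OF b zi] exp_int[OF f(1)[OF b] zi(1)]])
      then show ?thesis using diff[OF b zi] elim(2) b by fastforce
    qed
    then have "\<bar>\<Sum>b\<in>Basis. \<integral>x. g b x * (z i x \<bullet> b) \<partial>M\<bar> \<le> D * (3 * \<kappa>)"
      unfolding D_def by (intro order_trans[OF sum_abs] sum_bounded_above)
    moreover have "(\<integral>x. pgrad p (w x) \<bullet> z i x \<partial>M) = (\<Sum>b\<in>Basis. \<integral>x. g b x * (z i x \<bullet> b) \<partial>M)"
      unfolding g_def by (subst euclidean_inner) (rule Bochner_Integration.integral_sum, use g_int[OF _ zi] in \<open>simp add: g_def\<close>)
    ultimately have "\<bar>l (z i)\<bar> \<le> \<kappa> + D * (3 * \<kappa>)" using R[OF zi] by linarith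
    also have "\<dots> < \<kappa> * (2 + 3 * D)" using \<kappa> by (simp add: algebra_simps)
    also have "\<dots> = e" using D by (simp add: \<kappa>_def)
    finally show ?case by simp
  qed
qed

end

subsection \<open>Midpoint convexity\<close>

text \<open>A maximum principle on a segment: if the excess over the chord had a positive maximum,
  its leftmost maximum point would be interior, and the midpoint inequality there would involve a
  strictly smaller value on the left.\<close>

lemma continuous_midpoint_convex_imp_convex:
  fixes g :: "'b::euclidean_space \<Rightarrow> real"
  assumes cont: "continuous_on UNIV g" and mid: "\<And>\<mu> \<xi>. g \<mu> \<le> (g (\<mu> + \<xi>) + g (\<mu> - \<xi>)) / 2"
  shows "convex_on UNIV g"
proof (rule convex_onI)
  fix t :: real and a b :: 'b
  assume t: "0 < t" "t < 1"
  define l where "l s = (1 - s) *\<^sub>R a + s *\<^sub>R b" for s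
  define \<phi> where "\<phi> s = g (l s) - ((1 - s) * g a + s * g b)" for s
  have "continuous_on {0..1} (\<lambda>s. g (l s))"
    unfolding l_def by (rule continuous_on_compose2[OF cont]) (auto intro!: continuous_intros)
  then have c\<phi>: "continuous_on {0..1} \<phi>" unfolding \<phi>_def by (intro continuous_intros)
  have l_mid: "l (s + h) = l s + h *\<^sub>R (b - a)" "l (s - h) = l s - h *\<^sub>R (b - a)" for s h
    by (auto simp: l_def algebra_simps)
  have \<phi>mid: "\<phi> s \<le> (\<phi> (s + h) + \<phi> (s - h)) / 2" for s h
    using mid[of "l s" "h *\<^sub>R (b - a)", folded l_mid] by (simp add: \<phi>_def field_simps)
  obtain s1 where s1: "s1 \<in> {0..1}" "\<And>s. s \<in> {0..1} \<Longrightarrow> \<phi> s \<le> \<phi> s1"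
    using continuous_attains_sup[OF _ _ c\<phi>] by auto
  have "closed {s\<in>{0..1}. \<phi> s = \<phi> s1}"
    by (rule continuous_closed_preimage_constant[OF c\<phi>]) simp
  then have "compact ({s\<in>{0..1}. \<phi> s = \<phi> s1})"
    unfolding compact_eq_bounded_closed by (metis (no_types, lifting) bounded_closed_interval bounded_subset mem_Collect_eq subsetI)
  moreover have "{s\<in>{0..1}. \<phi> s = \<phi> s1} \<noteq> {}" using s1(1) by auto
  ultimately have "\<exists>s\<in>{s\<in>{0..1}. \<phi> s = \<phi> s1}. \<forall>t\<in>{s\<in>{0..1}. \<phi> s = \<phi> s1}. s \<le> t"
    by (rule compact_attains_inf)
  then obtain s0 where s0: "s0 \<in> {0..1}" "\<phi> s0 = \<phi> s1"
    "\<And>s. s \<in> {0..1} \<Longrightarrow> \<phi> s = \<phi> s1 \<Longrightarrow> s0 \<le> s"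
    by auto
  have "\<phi> s1 \<le> 0"
  proof (rule ccontr)
    assume pos: "\<not> \<phi> s1 \<le> 0"
    have "\<phi> 0 = 0" "\<phi> 1 = 0" by (auto simp: \<phi>_def l_def)
    then have s01: "0 < s0" "s0 < 1" using s0(1,2) pos by (auto simp: less_le)
    define h where "h = min s0 (1 - s0)"
    have h: "0 < h" "s0 + h \<in> {0..1}" "s0 - h \<in> {0..1}" using s01 by (auto simp: h_def)
    have "\<phi> (s0 - h) \<noteq> \<phi> s1" using s0(3)[OF h(3)] h(1) by auto
    then have "\<phi> (s0 - h) < \<phi> s1" using s1(2)[OF h(3)] by simp
    then show False using \<phi>mid[of s0 h] s1(2)[OF h(2)] s0(2) by simp
  qed
  then have "\<phi> t \<le> 0" using s1(2)[of t] t by simp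
  then show "g ((1 - t) *\<^sub>R a + t *\<^sub>R b) \<le> (1 - t) * g a + t * g b"
    by (simp add: \<phi>_def l_def)
qed simp

text \<open>Iterating midpoint convexity \<open>k\<close> times bounds increments of \<open>g\<close> over steps of size \<open>2\<^sup>-\<^sup>k\<close>
  by \<open>2\<^sup>-\<^sup>k\<close> times its oscillation; this makes \<open>g\<close> lower semicontinuous.\<close>

lemma dense_midpoint_convex_imp_convex:
  fixes g :: "'b::euclidean_space \<Rightarrow> real"
  assumes mid: "\<And>\<mu> \<xi>. \<xi> \<in> D \<Longrightarrow> g \<mu> \<le> (g (\<mu> + \<xi>) + g (\<mu> - \<xi>)) / 2"
    and dbl: "\<And>\<xi>. \<xi> \<in> D \<Longrightarrow> 2 *\<^sub>R \<xi> \<in> D"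
    and dense: "\<And>\<mu> e. 0 < e \<Longrightarrow> \<exists>\<xi>\<in>D. dist \<xi> \<mu> < e"
    and low: "\<And>\<mu>. - C \<le> g \<mu>"
    and up: "\<And>\<mu>. \<exists>K. \<forall>y\<in>cball \<mu> 1. g y \<le> K"
    and usc: "\<And>\<mu> e. 0 < e \<Longrightarrow> \<exists>\<delta>>0. \<forall>y. dist y \<mu> < \<delta> \<longrightarrow> g y < g \<mu> + e"
  shows "convex_on UNIV g"
proof -
  have iter: "2 ^ k * (g (\<mu> + \<xi>) - g \<mu>) \<le> g (\<mu> + (2 ^ k) *\<^sub>R \<xi>) - g \<mu>" if "\<xi> \<in> D" for k \<mu> \<xi>
  proof (induction k)
    case (Suc k)
    have "(2 ^ k) *\<^sub>R \<xi> \<in> D"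
    proof (induction k)
      case (Suc k)
      then show ?case using dbl[of "(2 ^ k) *\<^sub>R \<xi>"] by simp
    qed (simp add: that)
    from mid[OF this, of "\<mu> + (2 ^ k) *\<^sub>R \<xi>"]
    have "2 * g (\<mu> + (2 ^ k) *\<^sub>R \<xi>) \<le> g (\<mu> + (2 ^ Suc k) *\<^sub>R \<xi>) + g \<mu>"
      by (simp add: add.assoc flip: scaleR_add_left)
    then show ?case using Suc.IH by simp
  qed simp
  have lsc: "\<exists>\<delta>>0. \<forall>y. dist y \<mu> < \<delta> \<longrightarrow> g \<mu> \<le> g y + e" if "0 < e" for \<mu> e
  proof -
    obtain K where K: "\<And>y. y \<in> cball \<mu> 1 \<Longrightarrow> g y \<le> K" using up by blast
    obtain k :: nat where "2 * (\<bar>K\<bar> + \<bar>C\<bar>) / e < 2 ^ k" using real_arch_pow[of 2] by auto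
    then have k: "(\<bar>K\<bar> + \<bar>C\<bar>) / 2 ^ k < e / 2" using \<open>0 < e\<close> by (simp add: field_simps)
    have "g \<mu> \<le> g y + e" if y: "dist y \<mu> < 1 / 2 ^ k" for y
    proof -
      obtain \<delta> where \<delta>: "0 < \<delta>" "\<And>y'. dist y' y < \<delta> \<Longrightarrow> g y' < g y + e / 2"
        using usc[of "e / 2" y] \<open>0 < e\<close> by auto
      \<comment> \<open>The point \<open>a = \<mu> - \<xi>\<close> is close enough to
        \<open>y\<close> for upper semicontinuity at \<open>y\<close>, while the step from
        \<open>a\<close> to \<mu> is an admissible direction so short that \<open>2 ^ k\<close>
        repetitions stay in the unit ball around \<mu>.\<close>
      obtain \<xi> where \<xi>: "\<xi> \<in> D" "dist \<xi> (\<mu> - y) < min \<delta> (1 / 2 ^ k - dist y \<mu>)"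
        using dense[of "min \<delta> (1 / 2 ^ k - dist y \<mu>)" "\<mu> - y"] \<delta>(1) y by auto
      have "norm \<xi> \<le> norm (\<xi> - (\<mu> - y)) + norm (\<mu> - y)" using norm_triangle_ineq[of "\<xi> - (\<mu> - y)" "\<mu> - y"] by simp
      then have n\<xi>: "norm \<xi> < 1 / 2 ^ k" using \<xi>(2) by (simp add: dist_norm norm_minus_commute)
      define a where "a = \<mu> - \<xi>"
      have "dist a y = dist \<xi> (\<mu> - y)" by (simp add: a_def dist_norm norm_minus_commute algebra_simps)
      then have ga: "g a < g y + e / 2" using \<delta>(2) \<xi>(2) by simp
      have a2: "a + (2 ^ k) *\<^sub>R \<xi> = \<mu> + (2 ^ k - 1) *\<^sub>R \<xi>" by (simp add: a_def algebra_simps)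
      have "(2 ^ k - 1) * norm \<xi> \<le> 2 ^ k * norm \<xi>" by (intro mult_right_mono) auto
      moreover have "2 ^ k * norm \<xi> \<le> 1" using n\<xi> by (simp add: field_simps)
      ultimately have "(2 ^ k - 1) * norm \<xi> \<le> 1" by linarith
      then have "\<bar>2 ^ k - 1\<bar> * norm \<xi> \<le> 1" by simp
      then have "g (a + (2 ^ k) *\<^sub>R \<xi>) \<le> K" unfolding a2 by (intro K) (simp add: dist_norm)
      then have "2 ^ k * (g \<mu> - g a) \<le> \<bar>K\<bar> + \<bar>C\<bar>"
        using iter[OF \<xi>(1), of k a] low[of a] by (simp add: a_def)
      then have "g \<mu> - g a \<le> (\<bar>K\<bar> + \<bar>C\<bar>) / 2 ^ k" by (simp add: field_simps)
      then show ?thesis using k ga by linarith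
    qed
    then show ?thesis by (intro exI[of _ "1 / 2 ^ k"]) auto
  qed
  have cont: "continuous_on UNIV g"
    unfolding continuous_on_iff
  proof (intro ballI allI impI)
    fix \<mu> :: 'b and e :: real assume "0 < e"
    then obtain d1 where d1: "0 < d1" "\<And>y. dist y \<mu> < d1 \<Longrightarrow> g y < g \<mu> + e" using usc[of e \<mu>] by auto
    obtain d2 where d2: "0 < d2" "\<And>y. dist y \<mu> < d2 \<Longrightarrow> g \<mu> \<le> g y + e / 2" using lsc[of "e / 2" \<mu>] \<open>0 < e\<close> by auto
    show "\<exists>d>0. \<forall>x'\<in>UNIV. dist x' \<mu> < d \<longrightarrow> dist (g x') (g \<mu>) < e"
    proof (intro exI[of _ "min d1 d2"] conjI ballI impI)
      fix y assume "dist y \<mu> < min d1 d2"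
      then show "dist (g y) (g \<mu>) < e" using d1(2)[of y] d2(2)[of y] \<open>0 < e\<close> by (simp add: dist_real_def)
    qed (use d1(1) d2(1) in auto)
  qed
  have "g \<mu> \<le> (g (\<mu> + \<xi>) + g (\<mu> - \<xi>)) / 2" for \<mu> \<xi>
  proof -
    have "\<exists>\<xi>'\<in>D. dist \<xi>' \<xi> < 1 / real (Suc n)" for n by (rule dense) simp
    then obtain X where X: "\<And>n. X n \<in> D" "\<And>n. dist (X n) \<xi> < 1 / real (Suc n)" by metis
    have "(\<lambda>n. dist (X n) \<xi>) \<longlonglongrightarrow> 0"
      by (rule tendsto_sandwich[OF _ _ tendsto_const LIMSEQ_inverse_real_of_nat])
         (use X(2) in \<open>auto simp: inverse_eq_divide intro!: always_eventually less_imp_le\<close>)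
    then have lim: "X \<longlonglongrightarrow> \<xi>" by (rule tendsto_dist_iff[THEN iffD2])
    have c: "isCont g z" for z using cont by (simp add: continuous_on_eq_continuous_at)
    have "(\<lambda>n. (g (\<mu> + X n) + g (\<mu> - X n)) / 2) \<longlonglongrightarrow> (g (\<mu> + \<xi>) + g (\<mu> - \<xi>)) / 2"
      by (intro tendsto_intros isCont_tendsto_compose[OF c] lim) simp
    then show ?thesis by (rule LIMSEQ_le_const) (use mid[OF X(1)] in auto)
  qed
  then show ?thesis by (rule continuous_midpoint_convex_imp_convex[OF cont])
qed

subsection \<open>Affine minorants of convex functions\<close>

text \<open>Separate the point of the graph from the strict epigraph; the separating hyperplane
  cannot be vertical because \<open>h\<close> is finite everywhere.\<close>

lemma convex_on_subgradient:
  fixes h :: "'b::euclidean_space \<Rightarrow> real"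
  assumes h: "convex_on UNIV h"
  obtains b where "\<And>y. h \<mu> + b \<bullet> (y - \<mu>) \<le> h y"
proof -
  define T where "T = {z :: 'b \<times> real. h (fst z) < snd z}"
  have "convex T"
    unfolding T_def convex_alt
  proof (intro ballI allI impI, clarsimp)
    fix y1 t1 y2 t2 and u :: real
    assume *: "h y1 < t1" "h y2 < t2" "0 \<le> u" "u \<le> 1"
    have "h ((1 - u) *\<^sub>R y1 + u *\<^sub>R y2) \<le> (1 - u) * h y1 + u * h y2"
      using h * by (intro convex_onD) auto
    also have "\<dots> < (1 - u) * t1 + u * t2"
    proof (cases "u = 0")
      case False
      then have "(1 - u) * h y1 \<le> (1 - u) * t1" "u * h y2 < u * t2" using * by (auto intro: mult_left_mono)
      then show ?thesis by linarith
    qed (use * in simp)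
    finally show "h ((1 - u) *\<^sub>R y1 + u *\<^sub>R y2) < (1 - u) * t1 + u * t2" .
  qed
  moreover have "T \<noteq> {}"
    by (rule ex_in_conv[THEN iffD1], rule exI[of _ "(\<mu>, h \<mu> + 1)"]) (simp add: T_def)
  moreover have "{(\<mu>, h \<mu>)} \<inter> T = {}" by (auto simp: T_def)
  ultimately have "\<exists>ab k. ab \<noteq> 0 \<and> (\<forall>z\<in>{(\<mu>, h \<mu>)}. ab \<bullet> z \<le> k) \<and> (\<forall>z\<in>T. k \<le> ab \<bullet> z)"
    by (intro separating_hyperplane_sets convex_singleton) blast+
  then obtain ab k where ab: "ab \<noteq> 0" "ab \<bullet> (\<mu>, h \<mu>) \<le> k" "\<And>z. z \<in> T \<Longrightarrow> k \<le> ab \<bullet> z"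
    by (elim exE conjE) blast
  obtain a \<beta> where [simp]: "ab = (a, \<beta>)" by (cases ab)
  have sep: "a \<bullet> \<mu> + \<beta> * h \<mu> \<le> a \<bullet> y + \<beta> * t" if "h y < t" for y t
    using ab(2) ab(3)[of "(y, t)"] that by (simp add: T_def)
  have "0 \<le> \<beta>" using sep[of \<mu> "h \<mu> + 1"] by (simp add: algebra_simps)
  \<comment> \<open>A vertical hyperplane would put all of the domain on one side; the point
    \<open>\<mu> - a\<close> refutes this.\<close>
  have "\<beta> \<noteq> 0"
  proof
    assume "\<beta> = 0"
    then have "a \<bullet> \<mu> \<le> a \<bullet> (\<mu> - a)" using sep[of "\<mu> - a" "h (\<mu> - a) + 1"] by simp
    then have "a \<bullet> a \<le> 0" by (simp add: inner_diff_right)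
    then have "a = 0" by (metis inner_gt_zero_iff not_less)
    then show False using ab(1) \<open>\<beta> = 0\<close> by (simp add: zero_prod_def)
  qed
  then have \<beta>: "0 < \<beta>" using \<open>0 \<le> \<beta>\<close> by simp
  have "h \<mu> + (- a /\<^sub>R \<beta>) \<bullet> (y - \<mu>) \<le> h y" for y
  proof (rule field_le_epsilon)
    fix e :: real assume "0 < e"
    then have "a \<bullet> \<mu> + \<beta> * h \<mu> \<le> a \<bullet> y + \<beta> * (h y + e)" by (intro sep) simp
    then show "h \<mu> + (- a /\<^sub>R \<beta>) \<bullet> (y - \<mu>) \<le> h y + e"
      using \<beta> by (simp add: inner_diff_right field_simps)
  qed
  then show thesis by (rule that)
qed

text \<open>One dense sequence serves three purposes: sample points for \<open>intercept\<close>,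
  slopes of affine minorants, and directions of lamination.\<close>

definition dseq :: "nat \<Rightarrow> 'b::euclidean_space" where
  "dseq = (SOME d. \<forall>x e. 0 < e \<longrightarrow> (\<exists>n. dist (d n) x < e))"

lemma dseq_dense:
  fixes x :: "'b::euclidean_space"
  shows "0 < e \<Longrightarrow> \<exists>n. dist (dseq n) x < e"
proof -
  obtain D :: "'b set" where D: "countable D" "\<And>X. open X \<Longrightarrow> X \<noteq> {} \<Longrightarrow> \<exists>d\<in>D. d \<in> X"
    by (erule countable_dense_setE)
  have "D \<noteq> {}" using D(2)[of UNIV] by auto
  have "\<exists>n. dist (from_nat_into D n) x < e" if e: "0 < e" for x e
  proof -
    obtain d where d: "d \<in> D" "d \<in> ball x e" using D(2)[of "ball x e"] e by auto
    obtain n where "from_nat_into D n = d" using from_nat_into_surj[OF D(1) d(1)] by auto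
    then show ?thesis using d(2) by (auto simp: dist_commute)
  qed
  then have "\<exists>d :: nat \<Rightarrow> 'b. \<forall>x e. 0 < e \<longrightarrow> (\<exists>n. dist (d n) x < e)" by blast
  then show "0 < e \<Longrightarrow> \<exists>n. dist (dseq n) x < e"
    unfolding dseq_def by (rule someI2_ex) blast
qed

text \<open>Minus the Legendre conjugate; the infimum runs over a countable dense set for the sake of measurability.\<close>

definition intercept :: "('b::euclidean_space \<Rightarrow> real) \<Rightarrow> 'b \<Rightarrow> real" where
  "intercept \<phi> b = (INF n. \<phi> (dseq n) - b \<bullet> dseq n)"

section \<open>Legendre conjugate and convex envelope of a coercive function\<close>

locale coercive_fun =
  fixes \<phi> :: "'b::euclidean_space \<Rightarrow> real" and p C :: real
  assumes p_gt_1': "1 < p" and C_pos: "0 < C" and cont_\<phi>: "continuous_on UNIV \<phi>"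
    and coercive: "\<And>\<mu>. 1 / C * norm \<mu> powr p - C \<le> \<phi> \<mu>"
begin

lemma affine_bounded_below:
  obtains c where "0 \<le> c" "\<And>\<mu>. - c \<le> \<phi> \<mu> - b \<bullet> \<mu>"
proof -
  obtain c where c: "0 \<le> c" "\<And>s. 0 \<le> s \<Longrightarrow> norm b * s \<le> 1 / C * s powr p + c"
    using linear_le_powr[OF p_gt_1', of "1 / C" "norm b"] C_pos by (metis norm_ge_zero zero_less_divide_1_iff)
  have "- (c + C) \<le> \<phi> \<mu> - b \<bullet> \<mu>" for \<mu>
    using c(2)[of "norm \<mu>"] coercive[of \<mu>] norm_cauchy_schwarz[of b \<mu>] by simp
  then show thesis using that[of "c + C"] c C_pos by simp
qed

lemma bdd: "bdd_below (range (\<lambda>n. \<phi> (dseq n) - b \<bullet> dseq n))" for b :: 'b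
proof -
  obtain c where "\<And>\<mu>. - c \<le> \<phi> \<mu> - b \<bullet> \<mu>" using affine_bounded_below by blast
  then show ?thesis by (intro bdd_belowI2)
qed

text \<open>Continuity carries the inequality from the dense sample points to all \<mu>.\<close>

lemma intercept_le: "intercept \<phi> b + b \<bullet> \<mu> \<le> \<phi> \<mu>"
proof (rule field_le_epsilon)
  fix e :: real assume "0 < e"
  have "isCont (\<lambda>y. \<phi> y - b \<bullet> y) \<mu>"
    using cont_\<phi> by (intro continuous_intros) (simp add: continuous_on_eq_continuous_at)
  then obtain d where d: "0 < d" "\<And>y. dist y \<mu> < d \<Longrightarrow> dist (\<phi> y - b \<bullet> y) (\<phi> \<mu> - b \<bullet> \<mu>) < e"
    using \<open>0 < e\<close> unfolding continuous_at_eps_delta by blast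
  obtain n where "dist (dseq n) \<mu> < d" using dseq_dense[OF d(1)] by blast
  then have "dist (\<phi> (dseq n) - b \<bullet> dseq n) (\<phi> \<mu> - b \<bullet> \<mu>) < e" by (rule d(2))
  then have "\<phi> (dseq n) - b \<bullet> dseq n < \<phi> \<mu> - b \<bullet> \<mu> + e" by (simp add: dist_real_def)
  moreover have "intercept \<phi> b \<le> \<phi> (dseq n) - b \<bullet> dseq n"
    unfolding intercept_def by (rule cINF_lower[OF bdd]) simp
  ultimately show "intercept \<phi> b + b \<bullet> \<mu> \<le> \<phi> \<mu> + e" by linarith
qed

lemma intercept_greatest: "(\<And>\<mu>. m \<le> \<phi> \<mu> - b \<bullet> \<mu>) \<Longrightarrow> m \<le> intercept \<phi> b"
  unfolding intercept_def by (rule cINF_greatest) auto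

text \<open>An infimum of affine functions of the slope is concave; being finite everywhere in
  finite dimension, it is continuous.\<close>

lemma continuous_intercept: "continuous_on UNIV (intercept \<phi>)"
proof -
  have "convex_on UNIV (\<lambda>b. - intercept \<phi> b)"
  proof (rule convex_onI)
    fix t :: real and a b assume t: "0 < t" "t < 1"
    have "(1 - t) * intercept \<phi> a + t * intercept \<phi> b \<le> intercept \<phi> ((1 - t) *\<^sub>R a + t *\<^sub>R b)"
    proof (rule intercept_greatest)
      fix \<mu>
      have "(1 - t) * intercept \<phi> a + t * intercept \<phi> b \<le> (1 - t) * (\<phi> \<mu> - a \<bullet> \<mu>) + t * (\<phi> \<mu> - b \<bullet> \<mu>)"
        using intercept_le[of a \<mu>] intercept_le[of b \<mu>] t by (intro add_mono mult_left_mono) auto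
      also have "\<dots> = \<phi> \<mu> - ((1 - t) *\<^sub>R a + t *\<^sub>R b) \<bullet> \<mu>"
        by (simp add: inner_add_left algebra_simps)
      finally show "(1 - t) * intercept \<phi> a + t * intercept \<phi> b \<le> \<dots>" .
    qed
    then show "- intercept \<phi> ((1 - t) *\<^sub>R a + t *\<^sub>R b) \<le> (1 - t) * - intercept \<phi> a + t * - intercept \<phi> b"
      by simp
  qed simp
  then have "continuous_on UNIV (\<lambda>b. - intercept \<phi> b)" by (intro convex_on_continuous) auto
  then show ?thesis using continuous_on_minus by fastforce
qed

lemma bdd_above_envelope: "bdd_above {h \<mu> | h. convex_on UNIV h \<and> (\<forall>\<xi>. h \<xi> \<le> \<phi> \<xi>)}"
  by (intro bdd_aboveI[of _ "\<phi> \<mu>"]) auto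

lemma convex_minorant_le_envelope:
  "convex_on UNIV h \<Longrightarrow> (\<And>\<xi>. h \<xi> \<le> \<phi> \<xi>) \<Longrightarrow> h \<mu> \<le> convex_envelope \<phi> \<mu>"
  unfolding convex_envelope_def by (intro cSup_upper bdd_above_envelope) auto

lemma convex_on_affine: "convex_on UNIV (\<lambda>y. a + b \<bullet> y)"
  by (rule convex_onI) (auto simp: algebra_simps inner_add_right)

lemma envelope_leI:
  assumes "\<And>h. convex_on UNIV h \<Longrightarrow> (\<And>\<xi>. h \<xi> \<le> \<phi> \<xi>) \<Longrightarrow> h \<mu> \<le> m"
  shows "convex_envelope \<phi> \<mu> \<le> m"
  unfolding convex_envelope_def
proof (rule cSup_least)
  \<comment> \<open>A constant minorant shows that the set of minorants is nonempty, so that its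
    \<open>Sup\<close> is a genuine supremum.\<close>
  have "convex_on UNIV (\<lambda>y. intercept \<phi> 0 + 0 \<bullet> y) \<and> (\<forall>\<xi>. intercept \<phi> 0 + 0 \<bullet> \<xi> \<le> \<phi> \<xi>)"
    using intercept_le[of 0] convex_on_affine[of "intercept \<phi> 0" 0] by blast
  then show "{h \<mu> | h. convex_on UNIV h \<and> (\<forall>\<xi>. h \<xi> \<le> \<phi> \<xi>)} \<noteq> {}" by blast
qed (use assms in auto)

lemma intercept_le_envelope: "intercept \<phi> b + b \<bullet> \<mu> \<le> convex_envelope \<phi> \<mu>"
  by (rule convex_minorant_le_envelope[OF convex_on_affine intercept_le])

text \<open>A nearly optimal convex minorant has a supporting affine function at \<mu>, which is
  itself a minorant; continuity of \<open>intercept\<close> in the slope allows the slope to be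
  moved into the dense sequence.\<close>

lemma envelope_approx:
  assumes "0 < e" shows "\<exists>j. convex_envelope \<phi> \<mu> - e < intercept \<phi> (dseq j) + dseq j \<bullet> \<mu>"
proof -
  have "\<exists>h. convex_on UNIV h \<and> (\<forall>\<xi>. h \<xi> \<le> \<phi> \<xi>) \<and> convex_envelope \<phi> \<mu> - e / 2 < h \<mu>"
  proof (rule ccontr)
    assume "\<not> ?thesis"
    then have "convex_envelope \<phi> \<mu> \<le> convex_envelope \<phi> \<mu> - e / 2" by (intro envelope_leI) force
    then show False using \<open>0 < e\<close> by simp
  qed
  then obtain h where h: "convex_on UNIV h" "\<And>\<xi>. h \<xi> \<le> \<phi> \<xi>" "convex_envelope \<phi> \<mu> - e / 2 < h \<mu>" by blast
  obtain b where b: "\<And>y. h \<mu> + b \<bullet> (y - \<mu>) \<le> h y" using convex_on_subgradient[OF h(1)] by blast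
  have "h \<mu> - b \<bullet> \<mu> \<le> intercept \<phi> b"
  proof (rule intercept_greatest)
    show "h \<mu> - b \<bullet> \<mu> \<le> \<phi> y - b \<bullet> y" for y
      using b[of y] h(2)[of y] by (simp add: inner_diff_right)
  qed
  have "isCont (\<lambda>b. intercept \<phi> b + b \<bullet> \<mu>) b"
    using continuous_intercept by (intro continuous_intros) (simp add: continuous_on_eq_continuous_at)
  then obtain d where d: "0 < d" "\<And>y. dist y b < d \<Longrightarrow> dist (intercept \<phi> y + y \<bullet> \<mu>) (intercept \<phi> b + b \<bullet> \<mu>) < e / 2"
    using \<open>0 < e\<close> unfolding continuous_at_eps_delta by (metis half_gt_zero)
  obtain j where "dist (dseq j) b < d" using dseq_dense[OF d(1)] by blast
  then have "dist (intercept \<phi> (dseq j) + dseq j \<bullet> \<mu>) (intercept \<phi> b + b \<bullet> \<mu>) < e / 2" by (rule d(2))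
  then have "intercept \<phi> b + b \<bullet> \<mu> - e / 2 < intercept \<phi> (dseq j) + dseq j \<bullet> \<mu>"
    by (simp add: dist_real_def abs_if split: if_splits)
  then show ?thesis using \<open>h \<mu> - b \<bullet> \<mu> \<le> intercept \<phi> b\<close> h(3) by (intro exI[of _ j]) linarith
qed

end

subsection \<open>Integrands\<close>

context finite_domain
begin

text \<open>Approximate \<open>u\<close> by simple functions: composition with finitely many values
  is measurable, and continuity in the second variable passes to the limit.\<close>

lemma caratheodory_measurable:
  fixes u :: "'a \<Rightarrow> 'b::euclidean_space"
  assumes g: "caratheodory \<Omega> g" and u: "u \<in> borel_measurable M"
  shows "(\<lambda>x. g x (u x)) \<in> borel_measurable M"
proof -
  obtain F where F: "\<And>i. simple_function M (F i)" "\<And>x. x \<in> \<Omega> \<Longrightarrow> (\<lambda>i. F i x) \<longlonglongrightarrow> u x"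
    using borel_measurable_implies_sequence_metric[OF u, of 0] by auto
  show ?thesis
  proof (rule borel_measurable_LIMSEQ_real)
    fix x assume "x \<in> space M"
    then have x: "x \<in> \<Omega>" by simp
    then have "isCont (g x) (u x)"
      using g by (simp add: caratheodory_def continuous_on_eq_continuous_at)
    then show "(\<lambda>i. g x (F i x)) \<longlonglongrightarrow> g x (u x)"
      by (rule isCont_tendsto_compose[OF _ F(2)[OF x]])
  next
    fix i
    let ?I = "F i ` space M"
    have fin: "finite ?I" using simple_functionD(1)[OF F(1)] .
    show "(\<lambda>x. g x (F i x)) \<in> borel_measurable M"
    proof (rule measurable_compose_countable'[where I = ?I])
      show "(\<lambda>x. g x \<mu>) \<in> borel_measurable M" for \<mu> using g by (simp add: caratheodory_def)
      show "F i \<in> M \<rightarrow>\<^sub>M count_space ?I"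
        unfolding measurable_count_space_eq2[OF fin] using simple_functionD(2)[OF F(1)] by blast
      show "countable ?I" using fin by (rule countable_finite)
    qed
  qed
qed

text \<open>\<open>midpoint_min\<close> preserves these bounds with the same \<open>C\<close>, which
  gives one integrable majorant for the whole iteration.\<close>

definition admissible :: "real \<Rightarrow> ('a \<Rightarrow> 'b::euclidean_space \<Rightarrow> real) \<Rightarrow> bool" where
  "admissible C g \<longleftrightarrow> caratheodory \<Omega> g \<and> (\<forall>x\<in>\<Omega>. \<forall>\<mu>. - C \<le> g x \<mu> \<and> g x \<mu> \<le> C * norm \<mu> powr p + C)"

lemma integrable_growth:
  fixes u :: "'a \<Rightarrow> 'b::euclidean_space" and h :: "'a \<Rightarrow> real"
  assumes "h \<in> borel_measurable M" "u \<in> Lp p \<Omega>" "0 \<le> C"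
    and "\<And>x. x \<in> \<Omega> \<Longrightarrow> - C \<le> h x \<and> h x \<le> C * norm (u x) powr p + C"
  shows "integrable M h"
proof (rule Bochner_Integration.integrable_bound)
  show "integrable M (\<lambda>x. C * norm (u x) powr p + C)" using LpD(2)[OF assms(2)] by simp
  show "AE x in M. norm (h x) \<le> norm (C * norm (u x) powr p + C)"
  proof (rule AE_I2)
    fix x assume "x \<in> space M"
    then have "- C \<le> h x \<and> h x \<le> C * norm (u x) powr p + C" using assms(4) by simp
    moreover have "0 \<le> C * norm (u x) powr p" using assms(3) by simp
    ultimately show "norm (h x) \<le> norm (C * norm (u x) powr p + C)" by (auto simp: abs_le_iff)
  qed
qed (rule assms(1))

lemma admissible_integrable:
  fixes u :: "'a \<Rightarrow> 'b::euclidean_space"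
  assumes "admissible C g" "u \<in> Lp p \<Omega>" "0 \<le> C"
  shows "integrable M (\<lambda>x. g x (u x))"
  by (rule integrable_growth[OF caratheodory_measurable[OF _ LpD(1)[OF assms(2)]] assms(2,3)])
     (use assms(1) in \<open>auto simp: admissible_def\<close>)

end

section \<open>The midpoint iteration and its limit\<close>

definition midpoint_min :: "'b::euclidean_space \<Rightarrow> ('a \<Rightarrow> 'b \<Rightarrow> real) \<Rightarrow> 'a \<Rightarrow> 'b \<Rightarrow> real" where
  "midpoint_min \<xi> g x \<mu> = min (g x \<mu>) ((g x (\<mu> + \<xi>) + g x (\<mu> - \<xi>)) / 2)"

text \<open>The factors \<open>2\<^sup>i\<close> make the set of directions closed under doubling,
  which \<open>dense_midpoint_convex_imp_convex\<close> requires.\<close>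

definition direction :: "nat \<Rightarrow> 'b::euclidean_space" where
  "direction n = (case prod_decode (fst (prod_decode n)) of (i, j) \<Rightarrow> (2 ^ i) *\<^sub>R dseq j)"

text \<open>\<open>direction\<close> ignores the second component of the outer pair. This component
  acts as a counter that makes each pair \<open>(i, j)\<close> recur beyond any bound.\<close>

lemma direction_frequent: "\<exists>n\<ge>m. direction n = (2 ^ i) *\<^sub>R dseq j"
  by (rule exI[of _ "prod_encode (prod_encode (i, j), m)"])
     (simp add: direction_def le_prod_encode_2)

primrec midpoint_iter :: "('a \<Rightarrow> 'b::euclidean_space \<Rightarrow> real) \<Rightarrow> nat \<Rightarrow> 'a \<Rightarrow> 'b \<Rightarrow> real" where
  "midpoint_iter f 0 = f"
| "midpoint_iter f (Suc n) = midpoint_min (direction n) (midpoint_iter f n)"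

locale integrand = finite_domain \<Omega> p for \<Omega> :: "'a::euclidean_space set" and p +
  fixes f :: "'a \<Rightarrow> 'b::euclidean_space \<Rightarrow> real" and C :: real
  assumes C_pos: "0 < C" and carath: "caratheodory \<Omega> f"
    and upper: "\<And>x \<mu>. x \<in> \<Omega> \<Longrightarrow> f x \<mu> \<le> C * norm \<mu> powr p + C"
    and lower: "\<And>x \<mu>. x \<in> \<Omega> \<Longrightarrow> 1 / C * norm \<mu> powr p - C \<le> f x \<mu>"
begin

abbreviation "G \<equiv> midpoint_iter f"

abbreviation "env x \<equiv> convex_envelope (f x)"

lemma coercive: "x \<in> \<Omega> \<Longrightarrow> coercive_fun (f x) p C"
  by unfold_locales (use p_gt_1 C_pos carath lower in \<open>auto simp: caratheodory_def\<close>)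

lemma lower': "x \<in> \<Omega> \<Longrightarrow> - C \<le> f x \<mu>"
  using lower[of x \<mu>] C_pos by (smt (verit) divide_nonneg_pos mult_nonneg_nonneg powr_ge_zero zero_le_divide_1_iff)

lemma admissible_midpoint_min:
  assumes "admissible C g" shows "admissible C (midpoint_min \<xi> g)"
proof -
  have g: "caratheodory \<Omega> g" "\<And>x \<mu>. x \<in> \<Omega> \<Longrightarrow> - C \<le> g x \<mu>" "\<And>x \<mu>. x \<in> \<Omega> \<Longrightarrow> g x \<mu> \<le> C * norm \<mu> powr p + C"
    using assms by (auto simp: admissible_def)
  have "(\<lambda>x. g x \<mu>) \<in> borel_measurable M" for \<mu> using g(1) by (simp add: caratheodory_def)
  then have "(\<lambda>x. midpoint_min \<xi> g x \<mu>) \<in> borel_measurable M" for \<mu>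
    unfolding midpoint_min_def by (intro borel_measurable_min borel_measurable_divide borel_measurable_add borel_measurable_const)
  moreover have "continuous_on UNIV (midpoint_min \<xi> g x)" if "x \<in> \<Omega>" for x
  proof -
    have c: "continuous_on UNIV (g x)" using g(1) that by (simp add: caratheodory_def)
    have "continuous_on UNIV (\<lambda>\<mu>. g x (\<mu> + \<xi>))" "continuous_on UNIV (\<lambda>\<mu>. g x (\<mu> - \<xi>))"
      by (rule continuous_on_compose2[OF c], auto intro!: continuous_intros)+
    then show ?thesis unfolding midpoint_min_def[abs_def] using c by (intro continuous_intros) auto
  qed
  moreover have "- C \<le> midpoint_min \<xi> g x \<mu>" if "x \<in> \<Omega>" for x \<mu>
    using g(2)[OF that, of \<mu>] g(2)[OF that, of "\<mu> + \<xi>"] g(2)[OF that, of "\<mu> - \<xi>"] by (simp add: midpoint_min_def)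
  moreover have "midpoint_min \<xi> g x \<mu> \<le> C * norm \<mu> powr p + C" if "x \<in> \<Omega>" for x \<mu>
    using g(3)[OF that, of \<mu>] by (simp add: midpoint_min_def)
  ultimately show ?thesis by (simp add: admissible_def caratheodory_def)
qed

lemma admissible_f: "admissible C f"
  using carath upper lower' by (simp add: admissible_def)

lemma admissible_G: "admissible C (G n)"
  by (induction n) (auto simp: admissible_f admissible_midpoint_min)

lemma G_lower: "x \<in> \<Omega> \<Longrightarrow> - C \<le> G n x \<mu>"
  using admissible_G[of n] by (simp add: admissible_def)

lemma G_decseq: "decseq (\<lambda>n. G n x \<mu>)"
  by (rule decseq_SucI) (simp add: midpoint_min_def)

text \<open>A convex function satisfies every midpoint inequality, so taking
  \<open>midpoint_min\<close> never pushes below it.\<close>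

lemma convex_minorant_le_G:
  assumes "convex_on UNIV h" "\<And>\<xi>. h \<xi> \<le> f x \<xi>" shows "h \<mu> \<le> G n x \<mu>"
proof (induction n arbitrary: \<mu>)
  case (Suc n)
  have "h (midpoint (\<mu> + direction n) (\<mu> - direction n)) \<le> (h (\<mu> + direction n) + h (\<mu> - direction n)) / 2"
    using convex_onD[OF assms(1), of "1/2" "\<mu> + direction n" "\<mu> - direction n"]
    by (simp add: midpoint_def scaleR_add_right field_simps)
  moreover have "midpoint (\<mu> + direction n) (\<mu> - direction n) = \<mu>"
    by (simp add: midpoint_def flip: scaleR_2)
  ultimately show ?case
    using Suc[of \<mu>] Suc[of "\<mu> + direction n"] Suc[of "\<mu> - direction n"] by (simp add: midpoint_min_def)
qed (simp add: assms)

text \<open>The limit is an infimum of continuous functions, hence upper semicontinuous, and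
  satisfies the midpoint inequality along a dense set closed under doubling, so it is a convex
  minorant of \<open>f x\<close>. It is the largest one because all convex minorants survive the
  iteration.\<close>

lemma G_tendsto_env:
  assumes x: "x \<in> \<Omega>" shows "(\<lambda>n. G n x \<mu>) \<longlonglongrightarrow> env x \<mu>" and convex_env: "convex_on UNIV (env x)"
proof -
  interpret cf: coercive_fun "f x" p C by (rule coercive[OF x])
  define g where "g \<mu> = (INF n. G n x \<mu>)" for \<mu>
  have bdd: "bdd_below (range (\<lambda>n. G n x \<mu>))" for \<mu>
    using G_lower[OF x] by (intro bdd_belowI2)
  have lim: "(\<lambda>n. G n x \<mu>) \<longlonglongrightarrow> g \<mu>" for \<mu>
    unfolding g_def by (rule LIMSEQ_decseq_INF[OF bdd G_decseq])
  have g_le: "g \<mu> \<le> G n x \<mu>" for n \<mu>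
    unfolding g_def by (rule cINF_lower[OF bdd]) simp
  have "convex_on UNIV g"
  proof (rule dense_midpoint_convex_imp_convex[where D = "{(2 ^ i) *\<^sub>R dseq j | i j. True}" and C = C])
    fix \<mu> \<xi> :: 'b assume "\<xi> \<in> {(2 ^ i) *\<^sub>R dseq j | i j. True}"
    then obtain i j where \<xi>: "\<xi> = (2 ^ i) *\<^sub>R dseq j" by blast
    show "g \<mu> \<le> (g (\<mu> + \<xi>) + g (\<mu> - \<xi>)) / 2"
    proof (rule field_le_epsilon)
      fix e :: real assume "0 < e"
      then have "\<forall>\<^sub>F n in sequentially. G n x (\<mu> + \<xi>) < g (\<mu> + \<xi>) + e"
        "\<forall>\<^sub>F n in sequentially. G n x (\<mu> - \<xi>) < g (\<mu> - \<xi>) + e"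
        using order_tendstoD(2)[OF lim[of "\<mu> + \<xi>"], of "g (\<mu> + \<xi>) + e"]
          order_tendstoD(2)[OF lim[of "\<mu> - \<xi>"], of "g (\<mu> - \<xi>) + e"] by auto
      then have "\<forall>\<^sub>F n in sequentially. G n x (\<mu> + \<xi>) < g (\<mu> + \<xi>) + e \<and> G n x (\<mu> - \<xi>) < g (\<mu> - \<xi>) + e"
        by (rule eventually_conj)
      then obtain m where m: "\<And>n. n \<ge> m \<Longrightarrow> G n x (\<mu> + \<xi>) < g (\<mu> + \<xi>) + e \<and> G n x (\<mu> - \<xi>) < g (\<mu> - \<xi>) + e"
        unfolding eventually_sequentially by blast
      \<comment> \<open>Recurrence of directions matters here: \<xi> must be used at a stage where
        the iterate is already close to its limit at \<open>\<mu> + \<xi>\<close> and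
        \<open>\<mu> - \<xi>\<close>.\<close>
      obtain n where n: "n \<ge> m" "direction n = \<xi>" using direction_frequent[of m i j] \<xi> by auto
      have "g \<mu> \<le> G (Suc n) x \<mu>" by (rule g_le)
      also have "\<dots> \<le> (G n x (\<mu> + \<xi>) + G n x (\<mu> - \<xi>)) / 2"
        unfolding midpoint_iter.simps midpoint_min_def n(2) by (rule min.cobounded2)
      finally show "g \<mu> \<le> (g (\<mu> + \<xi>) + g (\<mu> - \<xi>)) / 2 + e" using m[OF n(1)] by (simp add: field_simps)
    qed
  next
    fix \<xi> :: 'b assume "\<xi> \<in> {(2 ^ i) *\<^sub>R dseq j | i j. True}"
    then obtain i j where "\<xi> = (2 ^ i) *\<^sub>R dseq j" by blast
    then have "2 *\<^sub>R \<xi> = (2 ^ Suc i) *\<^sub>R dseq j" by simp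
    then show "2 *\<^sub>R \<xi> \<in> {(2 ^ i) *\<^sub>R dseq j | i j. True}" by blast
  next
    fix \<mu> :: 'b and e :: real assume "0 < e"
    then obtain j where j: "dist (dseq j) \<mu> < e" using dseq_dense by blast
    have "dseq j \<in> {(2 ^ i) *\<^sub>R dseq j | i j. True}" by (rule CollectI, rule exI[of _ 0], rule exI[of _ j]) simp
    then show "\<exists>\<xi>\<in>{(2 ^ i) *\<^sub>R dseq j | i j. True}. dist \<xi> \<mu> < e" using j by blast
  next
    show "- C \<le> g \<mu>" for \<mu> unfolding g_def by (rule cINF_greatest) (auto intro: G_lower[OF x])
  next
    fix \<mu> :: 'b
    have "g y \<le> C * (norm \<mu> + 1) powr p + C" if "y \<in> cball \<mu> 1" for y
    proof -
      have "norm y \<le> norm \<mu> + 1" using that norm_triangle_ineq2[of y \<mu>] by (simp add: dist_norm norm_minus_commute)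
      have "g y \<le> G 0 x y" by (rule g_le)
      also have "\<dots> \<le> C * norm y powr p + C" using upper[OF x] by simp
      also have "\<dots> \<le> C * (norm \<mu> + 1) powr p + C"
        using C_pos p_pos \<open>norm y \<le> norm \<mu> + 1\<close> by (intro add_right_mono mult_left_mono powr_mono2) auto
      finally show ?thesis .
    qed
    then show "\<exists>K. \<forall>y\<in>cball \<mu> 1. g y \<le> K" by blast
  next
    fix \<mu> :: 'b and e :: real assume "0 < e"
    then have "\<forall>\<^sub>F n in sequentially. G n x \<mu> < g \<mu> + e" using order_tendstoD(2)[OF lim[of \<mu>], of "g \<mu> + e"] by auto
    then obtain n where n: "G n x \<mu> < g \<mu> + e" by (auto dest: eventually_happens)
    have "isCont (G n x) \<mu>"
      using admissible_G[of n] x by (simp add: admissible_def caratheodory_def continuous_on_eq_continuous_at)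
    then obtain d where d: "0 < d" "\<And>y. dist y \<mu> < d \<Longrightarrow> dist (G n x y) (G n x \<mu>) < g \<mu> + e - G n x \<mu>"
      using n unfolding continuous_at_eps_delta by (metis diff_gt_0_iff_gt)
    have "g y < g \<mu> + e" if "dist y \<mu> < d" for y
      using d(2)[OF that] g_le[of y n] by (simp add: dist_real_def)
    then show "\<exists>\<delta>>0. \<forall>y. dist y \<mu> < \<delta> \<longrightarrow> g y < g \<mu> + e" using d(1) by blast
  qed
  moreover have "g \<mu> \<le> f x \<mu>" for \<mu> using g_le[of \<mu> 0] by simp
  ultimately have "g \<mu> \<le> env x \<mu>" for \<mu> by (rule cf.convex_minorant_le_envelope)
  moreover have "env x \<mu> \<le> g \<mu>" for \<mu>
    unfolding g_def by (intro cf.envelope_leI cINF_greatest convex_minorant_le_G) auto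
  ultimately have eq: "env x = g" by (auto simp: fun_eq_iff intro: antisym)
  show "(\<lambda>n. G n x \<mu>) \<longlonglongrightarrow> env x \<mu>" using lim eq by simp
  show "convex_on UNIV (env x)" using \<open>convex_on UNIV g\<close> eq by simp
qed

lemma env_bounds:
  assumes x: "x \<in> \<Omega>" shows "- C \<le> env x \<mu>" "env x \<mu> \<le> f x \<mu>" "env x \<mu> \<le> C * norm \<mu> powr p + C"
proof -
  show "- C \<le> env x \<mu>" by (rule LIMSEQ_le_const[OF G_tendsto_env(1)[OF x]]) (use G_lower[OF x] in auto)
  show "env x \<mu> \<le> f x \<mu>"
    using decseq_ge[OF G_decseq G_tendsto_env(1)[OF x], of \<mu> 0] by simp
  then show "env x \<mu> \<le> C * norm \<mu> powr p + C" using upper[OF x, of \<mu>] by linarith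
qed

text \<open>The supremum over an uncountable family becomes measurable as a pointwise limit of the
  iterates.\<close>

lemma env_measurable:
  assumes u: "u \<in> Lp p \<Omega>" shows "(\<lambda>x. env x (u x)) \<in> borel_measurable M"
proof (rule borel_measurable_LIMSEQ_real[of _ "\<lambda>n x. G n x (u x)"])
  show "(\<lambda>x. G n x (u x)) \<in> borel_measurable M" for n
    using caratheodory_measurable[OF _ LpD(1)[OF u]] admissible_G by (auto simp: admissible_def)
qed (simp add: G_tendsto_env(1))

lemma env_integrable:
  assumes u: "u \<in> Lp p \<Omega>" shows "integrable M (\<lambda>x. env x (u x))"
  by (rule integrable_growth[OF env_measurable[OF u] u, of C]) (use env_bounds C_pos in auto)

context
  fixes u :: "'a \<Rightarrow> 'b" assumes u: "u \<in> Lp p \<Omega>"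
begin

lemma integral_G_tendsto: "(\<lambda>n. \<integral>x. G n x (u x) \<partial>M) \<longlonglongrightarrow> (\<integral>x. env x (u x) \<partial>M)"
proof (rule integral_dominated_convergence[where w = "\<lambda>x. C * norm (u x) powr p + C"])
  show "(\<lambda>x. G n x (u x)) \<in> borel_measurable M" for n
    using caratheodory_measurable[OF _ LpD(1)[OF u]] admissible_G by (auto simp: admissible_def)
  show "integrable M (\<lambda>x. C * norm (u x) powr p + C)" using LpD(2)[OF u] by simp
  show "AE x in M. (\<lambda>n. G n x (u x)) \<longlonglongrightarrow> env x (u x)" by (rule AE_I2) (simp add: G_tendsto_env(1))
  show "AE x in M. norm (G n x (u x)) \<le> C * norm (u x) powr p + C" for n
  proof (rule AE_I2)
    fix x assume "x \<in> space M"
    then have "- C \<le> G n x (u x)" "G n x (u x) \<le> C * norm (u x) powr p + C"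
      using admissible_G[of n] by (auto simp: admissible_def)
    moreover have "0 \<le> C * norm (u x) powr p" using C_pos by simp
    ultimately show "norm (G n x (u x)) \<le> C * norm (u x) powr p + C" by (simp add: abs_le_iff)
  qed
qed (rule env_measurable[OF u])

text \<open>Convexity, applied on the ray from \<open>a\<close> through \<open>b\<close>, bounds \<open>env x b - env x a\<close> from above.\<close>

lemma integral_env_upper:
  assumes v: "v \<in> Lp p \<Omega>" and t: "0 < t" "t < 1"
  shows "(\<integral>x. env x (v x) \<partial>M) \<le> (\<integral>x. env x (u x) \<partial>M)
    + t * (\<integral>x. 2 * C + C * 2 powr p * norm (u x) powr p \<partial>M)
    + t * C * 2 powr p * (1 / t) powr p * (\<integral>x. norm (v x - u x) powr p \<partial>M)"
proof -
  have pw: "env x b \<le> env x a + t * (2 * C + C * 2 powr p * norm a powr p) + t * C * 2 powr p * (1 / t) powr p * norm (b - a) powr p"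
    if x: "x \<in> \<Omega>" for x a b
  proof -
    let ?c = "a + (1 / t) *\<^sub>R (b - a)"
    have "b = (1 - t) *\<^sub>R a + t *\<^sub>R ?c" using t by (simp add: algebra_simps)
    then have "env x b \<le> (1 - t) * env x a + t * env x ?c"
      using convex_onD[OF convex_env[OF x], of t a ?c] t by simp
    also have "env x ?c \<le> C * norm ?c powr p + C" by (rule env_bounds[OF x])
    also have "norm ?c powr p \<le> 2 powr p * (norm a powr p + norm ((1 / t) *\<^sub>R (b - a)) powr p)"
      by (rule norm_add_powr_le[OF p_pos])
    also have "norm ((1 / t) *\<^sub>R (b - a)) powr p = (1 / t) powr p * norm (b - a) powr p"
      using t by (simp add: powr_mult powr_divide)
    finally have 1: "env x b \<le> (1 - t) * env x a + t * (C * (2 powr p * (norm a powr p + (1 / t) powr p * norm (b - a) powr p)) + C)"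
      using t C_pos by simp
    \<comment> \<open>Replacing \<open>(1 - t) * env x a\<close> by \<open>env x a\<close> costs at
      most \<open>t * C\<close>, since the envelope is at least \<open>- C\<close>.\<close>
    have "0 \<le> t * (C + env x a)"
      using env_bounds(1)[OF x, of a] t by (intro mult_nonneg_nonneg) auto
    then have "(1 - t) * env x a \<le> env x a + t * C" by (simp add: algebra_simps)
    then show ?thesis using 1 by (simp add: algebra_simps)
  qed
  note [simp] = LpD(2)[OF u] LpD(2)[OF Lp_diff[OF v u]] env_integrable[OF u] env_integrable[OF v]
  have "(\<integral>x. env x (v x) \<partial>M) \<le> (\<integral>x. env x (u x) + t * (2 * C + C * 2 powr p * norm (u x) powr p)
      + t * C * 2 powr p * (1 / t) powr p * norm (v x - u x) powr p \<partial>M)"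
    by (intro integral_mono) (auto intro: pw)
  also have "\<dots> = (\<integral>x. env x (u x) \<partial>M)
    + t * (\<integral>x. 2 * C + C * 2 powr p * norm (u x) powr p \<partial>M)
    + t * C * 2 powr p * (1 / t) powr p * (\<integral>x. norm (v x - u x) powr p \<partial>M)"
    by simp
  finally show ?thesis .
qed

text \<open>First \<open>t\<close> is fixed so small that the term linear in \<open>t\<close> is
  harmless; for this \<open>t\<close> the remaining term vanishes by strong convergence.\<close>

lemma env_limsup:
  assumes v: "\<forall>\<^sub>F i in F. v i \<in> Lp p \<Omega>" and lim: "((\<lambda>i. \<integral>x. norm (v i x - u x) powr p \<partial>M) \<longlongrightarrow> 0) F" and "0 < \<delta>"
  shows "\<forall>\<^sub>F i in F. (\<integral>x. env x (v i x) \<partial>M) \<le> (\<integral>x. env x (u x) \<partial>M) + \<delta>"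
proof -
  define A where "A = (\<integral>x. 2 * C + C * 2 powr p * norm (u x) powr p \<partial>M)"
  have A: "0 \<le> A" unfolding A_def using C_pos by (intro integral_nonneg_AE AE_I2) auto
  define t where "t = min (1/2) (\<delta> / (2 * (A + 1)))"
  have t: "0 < t" "t < 1" using A \<open>0 < \<delta>\<close> by (auto simp: t_def)
  have "t * A \<le> \<delta> / (2 * (A + 1)) * A" using A by (intro mult_right_mono) (auto simp: t_def)
  also have "\<dots> \<le> \<delta> / 2" using A \<open>0 < \<delta>\<close> by (simp add: field_simps)
  finally have tA: "t * A \<le> \<delta> / 2" .
  define K where "K = t * C * 2 powr p * (1 / t) powr p"
  have "((\<lambda>i. K * (\<integral>x. norm (v i x - u x) powr p \<partial>M)) \<longlongrightarrow> K * 0) F"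
    by (intro tendsto_intros lim)
  then have "\<forall>\<^sub>F i in F. K * (\<integral>x. norm (v i x - u x) powr p \<partial>M) < \<delta> / 2"
    using \<open>0 < \<delta>\<close> by (intro order_tendstoD(2)[of _ 0]) auto
  with v show ?thesis
  proof eventually_elim
    case (elim i)
    then show ?case using integral_env_upper[OF elim(1) t] tA unfolding A_def[symmetric] K_def[symmetric] by linarith
  qed
qed

end

subsection \<open>Weak lower semicontinuity\<close>

lemma intercept_measurable: "(\<lambda>x. intercept (f x) b) \<in> borel_measurable M"
  unfolding intercept_def
proof (rule borel_measurable_cINF_real)
  show "(\<lambda>x. f x (dseq n) - b \<bullet> dseq n) \<in> borel_measurable M" for n
    using carath by (intro borel_measurable_diff borel_measurable_const) (simp add: caratheodory_def)
qed simp

lemma intercept_bounded: "\<exists>K. \<forall>x\<in>\<Omega>. \<bar>intercept (f x) b\<bar> \<le> K"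
proof -
  obtain c where c: "0 \<le> c" "\<And>s. 0 \<le> s \<Longrightarrow> norm b * s \<le> 1 / C * s powr p + c"
    using linear_le_powr[OF p_gt_1, of "1 / C" "norm b"] C_pos by (metis norm_ge_zero zero_less_divide_1_iff)
  have "\<bar>intercept (f x) b\<bar> \<le> c + C" if x: "x \<in> \<Omega>" for x
  proof -
    interpret cf: coercive_fun "f x" p C by (rule coercive[OF x])
    have "- (c + C) \<le> intercept (f x) b"
    proof (rule cf.intercept_greatest)
      show "- (c + C) \<le> f x \<mu> - b \<bullet> \<mu>" for \<mu>
        using c(2)[of "norm \<mu>"] lower[OF x, of \<mu>] norm_cauchy_schwarz[of b \<mu>] by simp
    qed
    moreover have "intercept (f x) b \<le> C" using cf.intercept_le[of b 0] upper[OF x, of 0] p_pos by simp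
    ultimately show ?thesis using c(1) by (simp add: abs_le_iff)
  qed
  then show ?thesis by blast
qed

text \<open>The best of the first \<open>n + 1\<close> affine minorants at the point \<open>u x\<close>: slope and intercept.\<close>

primrec best_affine :: "('a \<Rightarrow> 'b) \<Rightarrow> nat \<Rightarrow> 'a \<Rightarrow> 'b \<times> real" where
  "best_affine u 0 x = (dseq 0, intercept (f x) (dseq 0))"
| "best_affine u (Suc n) x =
    (if snd (best_affine u n x) + fst (best_affine u n x) \<bullet> u x < intercept (f x) (dseq (Suc n)) + dseq (Suc n) \<bullet> u x
     then (dseq (Suc n), intercept (f x) (dseq (Suc n))) else best_affine u n x)"

lemma best_affine_measurable:
  assumes u: "u \<in> borel_measurable M"
  shows "(\<lambda>x. fst (best_affine u n x)) \<in> borel_measurable M" "(\<lambda>x. snd (best_affine u n x)) \<in> borel_measurable M"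
proof (induction n)
  case (Suc n)
  note Suc[measurable] u[measurable] intercept_measurable[measurable]
  have P: "Measurable.pred M (\<lambda>x. snd (best_affine u n x) + fst (best_affine u n x) \<bullet> u x < intercept (f x) (dseq (Suc n)) + dseq (Suc n) \<bullet> u x)"
    by measurable
  { case 1 show ?case unfolding best_affine.simps if_distrib[of fst] fst_conv
      by (rule measurable_If[OF borel_measurable_const Suc(1)]) (use P in \<open>simp add: pred_def\<close>) }
  { case 2 show ?case unfolding best_affine.simps if_distrib[of snd] snd_conv
      by (rule measurable_If[OF intercept_measurable Suc(2)]) (use P in \<open>simp add: pred_def\<close>) }
qed (simp_all add: intercept_measurable)

lemma best_affine_bounded: "\<exists>K. \<forall>x\<in>\<Omega>. norm (fst (best_affine u n x)) \<le> K \<and> \<bar>snd (best_affine u n x)\<bar> \<le> K"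
proof (induction n)
  case 0
  obtain K where "\<forall>x\<in>\<Omega>. \<bar>intercept (f x) (dseq 0)\<bar> \<le> K" using intercept_bounded by blast
  then show ?case by (intro exI[of _ "max K (norm (dseq 0 :: 'b))"]) auto
next
  case (Suc n)
  obtain K where K: "\<forall>x\<in>\<Omega>. \<bar>intercept (f x) (dseq (Suc n))\<bar> \<le> K" using intercept_bounded by blast
  obtain K' where K': "\<forall>x\<in>\<Omega>. norm (fst (best_affine u n x)) \<le> K' \<and> \<bar>snd (best_affine u n x)\<bar> \<le> K'" using Suc by blast
  show ?case
    by (intro exI[of _ "max K' (max K (norm (dseq (Suc n) :: 'b)))"]) (use K K' in \<open>auto simp: le_max_iff_disj\<close>)
qed

lemma best_affine_le: "x \<in> \<Omega> \<Longrightarrow> snd (best_affine u n x) + fst (best_affine u n x) \<bullet> \<mu> \<le> f x \<mu>"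
  by (induction n) (auto simp: coercive_fun.intercept_le[OF coercive])

lemma best_affine_le_env: "x \<in> \<Omega> \<Longrightarrow> snd (best_affine u n x) + fst (best_affine u n x) \<bullet> \<mu> \<le> env x \<mu>"
  by (induction n) (auto simp: coercive_fun.intercept_le_envelope[OF coercive])

lemma best_affine_mono: "incseq (\<lambda>n. snd (best_affine u n x) + fst (best_affine u n x) \<bullet> u x)"
  by (rule incseq_SucI) auto

lemma best_affine_ge: "intercept (f x) (dseq n) + dseq n \<bullet> u x \<le> snd (best_affine u n x) + fst (best_affine u n x) \<bullet> u x"
  by (cases n) auto

lemma best_affine_tendsto:
  assumes x: "x \<in> \<Omega>" shows "(\<lambda>n. snd (best_affine u n x) + fst (best_affine u n x) \<bullet> u x) \<longlonglongrightarrow> env x (u x)"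
proof (rule LIMSEQ_I)
  fix e :: real assume "0 < e"
  obtain j where j: "env x (u x) - e < intercept (f x) (dseq j) + dseq j \<bullet> u x"
    using coercive_fun.envelope_approx[OF coercive[OF x] \<open>0 < e\<close>] by blast
  have "norm (snd (best_affine u n x) + fst (best_affine u n x) \<bullet> u x - env x (u x)) < e" if "n \<ge> j" for n
    using j best_affine_ge[of x j u] incseqD[OF best_affine_mono that, of u x] best_affine_le_env[OF x, of u n "u x"] \<open>0 < e\<close> by simp
  then show "\<exists>j. \<forall>n\<ge>j. norm (snd (best_affine u n x) + fst (best_affine u n x) \<bullet> u x - env x (u x)) < e" by blast
qed

text \<open>The slopes and intercepts are selected by the limit \<open>u\<close> and not by
  \<open>v i\<close>. For fixed \<open>n\<close> the minorant is therefore affine in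
  \<open>v i\<close> with bounded coefficients, hence weakly continuous.\<close>

lemma weak_lower_semicontinuous:
  assumes u: "u \<in> Lp p \<Omega>" and v: "\<forall>\<^sub>F i in F. v i \<in> Lp p \<Omega>" and weak: "Lp_weak_tendsto p \<Omega> v u F" and "0 < \<delta>"
  shows "\<forall>\<^sub>F i in F. (\<integral>x. env x (u x) \<partial>M) - \<delta> < (\<integral>x. f x (v i x) \<partial>M)"
proof -
  define s where "s n x = fst (best_affine u n x)" for n x
  define c where "c n x = snd (best_affine u n x)" for n x
  have s: "s n \<in> borel_measurable M" and c: "c n \<in> borel_measurable M" for n
    unfolding s_def[abs_def] c_def[abs_def] by (rule best_affine_measurable[OF LpD(1)[OF u]])+
  have bnd: "\<exists>K. \<forall>x\<in>\<Omega>. norm (s n x) \<le> K \<and> \<bar>c n x\<bar> \<le> K" for n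
    unfolding s_def c_def by (rule best_affine_bounded)
  have c_int: "integrable M (c n)" for n
  proof -
    obtain K where "\<forall>x\<in>\<Omega>. norm (s n x) \<le> K \<and> \<bar>c n x\<bar> \<le> K" using bnd by blast
    then show ?thesis by (intro integrable_bounded[OF c, of _ K]) auto
  qed
  have s_int: "integrable M (\<lambda>x. s n x \<bullet> w x)" if "w \<in> Lp p \<Omega>" for n w
  proof -
    obtain K where "\<forall>x\<in>\<Omega>. norm (s n x) \<le> K \<and> \<bar>c n x\<bar> \<le> K" using bnd by blast
    then show ?thesis by (intro Lp_inner_integrable[OF that s, of _ K]) auto
  qed
  have "(\<lambda>n. \<integral>x. c n x + s n x \<bullet> u x \<partial>M) \<longlonglongrightarrow> (\<integral>x. env x (u x) \<partial>M)"
  \<comment> \<open>The sequence increases, so it lies between its first term and the envelope; both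
    are integrable.\<close>
  proof (rule integral_dominated_convergence[where w = "\<lambda>x. \<bar>c 0 x + s 0 x \<bullet> u x\<bar> + \<bar>env x (u x)\<bar>"])
    show "(\<lambda>x. env x (u x)) \<in> borel_measurable M" by (rule env_measurable[OF u])
    show "(\<lambda>x. c n x + s n x \<bullet> u x) \<in> borel_measurable M" for n
      using c_int[of n] s_int[OF u, of n] by (intro borel_measurable_integrable Bochner_Integration.integrable_add)
    show "integrable M (\<lambda>x. \<bar>c 0 x + s 0 x \<bullet> u x\<bar> + \<bar>env x (u x)\<bar>)"
      using c_int[of 0] s_int[OF u, of 0] env_integrable[OF u] by (intro Bochner_Integration.integrable_add integrable_abs)
    show "AE x in M. (\<lambda>n. c n x + s n x \<bullet> u x) \<longlonglongrightarrow> env x (u x)"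
      by (rule AE_I2) (simp add: best_affine_tendsto c_def s_def)
    show "AE x in M. norm (c n x + s n x \<bullet> u x) \<le> \<bar>c 0 x + s 0 x \<bullet> u x\<bar> + \<bar>env x (u x)\<bar>" for n
    proof (rule AE_I2)
      fix x assume "x \<in> space M"
      then have "c n x + s n x \<bullet> u x \<le> env x (u x)"
        using best_affine_le_env[of x u n "u x"] by (simp add: c_def s_def)
      moreover have "c 0 x + s 0 x \<bullet> u x \<le> c n x + s n x \<bullet> u x"
        using incseqD[OF best_affine_mono[of u x], of 0 n] by (simp add: c_def s_def)
      ultimately show "norm (c n x + s n x \<bullet> u x) \<le> \<bar>c 0 x + s 0 x \<bullet> u x\<bar> + \<bar>env x (u x)\<bar>" by simp
    qed
  qed
  then have "\<forall>\<^sub>F n in sequentially. (\<integral>x. env x (u x) \<partial>M) - \<delta> / 2 < (\<integral>x. c n x + s n x \<bullet> u x \<partial>M)"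
    using \<open>0 < \<delta>\<close> by (intro order_tendstoD(1)) auto
  then obtain n where n: "(\<integral>x. env x (u x) \<partial>M) - \<delta> / 2 < (\<integral>x. c n x + s n x \<bullet> u x \<partial>M)"
    by (auto dest: eventually_happens)
  obtain K where K: "\<forall>x\<in>\<Omega>. norm (s n x) \<le> K \<and> \<bar>c n x\<bar> \<le> K" using bnd by blast
  have dual: "(\<lambda>w. \<integral>x. s n x \<bullet> w x \<partial>M) \<in> Lp_dual p \<Omega>"
    by (rule inner_in_Lp_dual[OF s, of _ "max K 0"]) (use K in \<open>auto simp: le_max_iff_disj\<close>)
  have "((\<lambda>i. \<integral>x. s n x \<bullet> v i x \<partial>M) \<longlongrightarrow> (\<integral>x. s n x \<bullet> u x \<partial>M)) F"
    using bspec[OF weak[unfolded Lp_weak_tendsto_def] dual] by simp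
  then have "\<forall>\<^sub>F i in F. (\<integral>x. s n x \<bullet> u x \<partial>M) - \<delta> / 2 < (\<integral>x. s n x \<bullet> v i x \<partial>M)"
    using \<open>0 < \<delta>\<close> by (intro order_tendstoD(1)) auto
  with v show ?thesis
  proof eventually_elim
    case (elim i)
    have "(\<integral>x. c n x \<partial>M) + (\<integral>x. s n x \<bullet> v i x \<partial>M) = (\<integral>x. c n x + s n x \<bullet> v i x \<partial>M)"
      using c_int[of n] s_int[OF elim(1), of n] by simp
    also have "\<dots> \<le> (\<integral>x. f x (v i x) \<partial>M)"
    proof (rule integral_mono)
      show "integrable M (\<lambda>x. c n x + s n x \<bullet> v i x)" using c_int[of n] s_int[OF elim(1), of n] by simp
      show "integrable M (\<lambda>x. f x (v i x))" using admissible_integrable[OF admissible_f elim(1)] C_pos by simp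
      show "c n x + s n x \<bullet> v i x \<le> f x (v i x)" if "x \<in> space M" for x
        using that best_affine_le[of x u n "v i x"] by (simp add: c_def s_def)
    qed
    finally have "(\<integral>x. c n x \<partial>M) + (\<integral>x. s n x \<bullet> v i x \<partial>M) \<le> (\<integral>x. f x (v i x) \<partial>M)" .
    moreover have "(\<integral>x. c n x + s n x \<bullet> u x \<partial>M) = (\<integral>x. c n x \<partial>M) + (\<integral>x. s n x \<bullet> u x \<partial>M)"
      using c_int[of n] s_int[OF u, of n] by simp
    ultimately show ?case using n elim(2) by linarith
  qed
qed

end

subsection \<open>Cut-off functions\<close>

text \<open>Squaring makes the derivative of the positive part continuous at 0, so cut-offs can be
  assembled within \<open>C1\<close>.\<close>

definition pos_sq :: "real \<Rightarrow> real" where "pos_sq t = (max 0 t)\<^sup>2"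

lemma pos_sq_deriv: "(pos_sq has_real_derivative 2 * max 0 t) (at t)"
proof -
  consider "t < 0" | "t > 0" | "t = 0" by linarith
  then show ?thesis
  proof cases
    case 1
    have "((\<lambda>t. 0) has_real_derivative 0) (at t)" by simp
    then have "(pos_sq has_real_derivative 0) (at t)"
      by (rule has_field_derivative_transform_within_open[of _ _ _ "{..<0}"]) (use 1 in \<open>auto simp: pos_sq_def\<close>)
    then show ?thesis using 1 by simp
  next
    case 2
    have "((\<lambda>t. t\<^sup>2) has_real_derivative 2 * t) (at t)" by (auto intro!: derivative_eq_intros)
    then have "(pos_sq has_real_derivative 2 * t) (at t)"
      by (rule has_field_derivative_transform_within_open[of _ _ _ "{0<..}"]) (use 2 in \<open>auto simp: pos_sq_def\<close>)
    then show ?thesis using 2 by simp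
  next
    case 3
    have "((\<lambda>h. (pos_sq (0 + h) - pos_sq 0) / h) \<longlongrightarrow> 0) (at 0)"
    proof (rule Lim_null_comparison[where g = "\<lambda>h. \<bar>h\<bar>"])
      show "\<forall>\<^sub>F h in at 0. norm ((pos_sq (0 + h) - pos_sq 0) / h) \<le> \<bar>h\<bar>"
        by (rule always_eventually) (auto simp: pos_sq_def max_def power2_eq_square)
      show "((\<lambda>h::real. \<bar>h\<bar>) \<longlongrightarrow> 0) (at 0)" by (rule tendsto_rabs_zero) (rule tendsto_ident_at)
    qed
    then show ?thesis using 3 by (simp add: has_field_derivative_iff)
  qed
qed

lemma C1_pos_sq: "C1 \<phi> \<Longrightarrow> C1 (\<lambda>x. pos_sq (\<phi> x))"
  by (rule C1_compose_real[OF _ pos_sq_deriv]) (auto intro!: continuous_intros)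

lemma C1_sq_dist: "C1 (\<lambda>x. (x - a) \<bullet> (x - a))"
  by (rule C1I[where \<phi>' = "\<lambda>x v. 2 * ((x - a) \<bullet> v)"])
     (auto intro!: derivative_eq_intros continuous_intros simp: inner_commute)

text \<open>Cover \<open>K\<close> by finitely many half-size balls, add bumps supported in the full
  balls, and saturate the sum.\<close>

lemma C1_cutoff:
  fixes K V :: "'a::euclidean_space set"
  assumes "compact K" "open V" "K \<subseteq> V"
  obtains \<zeta> where "C1 \<zeta>" "\<And>x. 0 \<le> \<zeta> x" "\<And>x. \<zeta> x \<le> 1" "\<And>x. x \<in> K \<Longrightarrow> \<zeta> x = 1" "\<And>x. x \<notin> V \<Longrightarrow> \<zeta> x = 0"
proof -
  have "\<forall>a\<in>K. \<exists>r>0. ball a r \<subseteq> V" using assms by (meson openE subsetD)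
  then obtain r where r: "\<And>a. a \<in> K \<Longrightarrow> 0 < r a" "\<And>a. a \<in> K \<Longrightarrow> ball a (r a) \<subseteq> V" by metis
  have "K \<subseteq> (\<Union>a\<in>K. ball a (r a / 2))" using r(1) by force
  then obtain D where D: "D \<subseteq> K" "finite D" "K \<subseteq> (\<Union>a\<in>D. ball a (r a / 2))"
    using compactE_image[OF assms(1), of K "\<lambda>a. ball a (r a / 2)"] by blast
  define b where "b a x = pos_sq (1 + (- 1 / (r a)\<^sup>2) * ((x - a) \<bullet> (x - a)))" for a x
  define P where "P x = (\<Sum>a\<in>D. b a x)" for x
  \<comment> \<open>This equals 0 where \<open>P\<close> vanishes and 1 as soon as
    \<open>P >= 1/2\<close>; on the half-size balls one bump alone already gives 9/16.\<close>
  define \<zeta> where "\<zeta> x = 1 + (- 1) * pos_sq (1 + (- 2) * P x)" for x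
  have "C1 (b a)" for a
    unfolding b_def by (intro C1_pos_sq C1_add C1_mult C1_const C1_sq_dist)
  then have "C1 P" unfolding P_def by (intro C1_sum D)
  then have C1: "C1 \<zeta>" unfolding \<zeta>_def by (intro C1_add C1_mult C1_const C1_pos_sq)
  have b0: "0 \<le> b a x" for a x by (simp add: b_def pos_sq_def)
  have P0: "0 \<le> P x" for x unfolding P_def by (intro sum_nonneg b0)
  have "pos_sq (1 + (- 2) * P x) \<le> 1" for x
    using P0[of x] by (simp add: pos_sq_def max_def power_le_one)
  then have ge: "0 \<le> \<zeta> x" for x by (simp add: \<zeta>_def)
  have le: "\<zeta> x \<le> 1" for x by (simp add: \<zeta>_def pos_sq_def)
  have one: "\<zeta> x = 1" if xK: "x \<in> K" for x
  proof -
    obtain a where a: "a \<in> D" "x \<in> ball a (r a / 2)" using D(3) xK by blast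
    then have ra: "0 < r a" using r(1) D(1) by blast
    have "(norm (x - a))\<^sup>2 < (r a / 2)\<^sup>2"
      using a(2) by (intro power_strict_mono) (auto simp: dist_norm norm_minus_commute)
    then have "(x - a) \<bullet> (x - a) / (r a)\<^sup>2 < 1 / 4"
      using ra by (simp add: power2_norm_eq_inner field_simps)
    then have "3 / 4 \<le> max 0 (1 + (- 1 / (r a)\<^sup>2) * ((x - a) \<bullet> (x - a)))" by (simp add: le_max_iff_disj)
    then have "(3/4)\<^sup>2 \<le> b a x"
      unfolding b_def pos_sq_def by (rule power_mono) simp
    also have "b a x \<le> P x" unfolding P_def by (intro member_le_sum a b0 D)
    finally show ?thesis by (simp add: \<zeta>_def pos_sq_def power2_eq_square)
  qed
  have zero: "\<zeta> x = 0" if "x \<notin> V" for x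
  proof -
    have "b a x = 0" if "a \<in> D" for a
    proof -
      have ra: "0 < r a" "x \<notin> ball a (r a)" using r D(1) \<open>x \<notin> V\<close> that by blast+
      then have "(r a)\<^sup>2 \<le> (norm (x - a))\<^sup>2" by (intro power_mono) (auto simp: dist_norm norm_minus_commute)
      then show ?thesis using ra by (simp add: b_def pos_sq_def power2_norm_eq_inner field_simps max_def)
    qed
    then have "P x = 0" by (simp add: P_def)
    then show ?thesis by (simp add: \<zeta>_def pos_sq_def)
  qed
  show thesis by (rule that[OF C1 ge le one zero])
qed

text \<open>For a cut-off with values in \<open>[0, 1]\<close> the derivative vanishes wherever the
  value is 0 or 1, not only in the interior of these sets.\<close>

lemma dd_zero_at_extremum:
  assumes "C1 \<zeta>" "(\<forall>y. \<zeta> y \<le> \<zeta> x) \<or> (\<forall>y. \<zeta> x \<le> \<zeta> y)"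
  shows "dd \<zeta> x v = 0"
proof -
  have "dd \<zeta> x = (\<lambda>v. 0)"
    by (rule differential_zero_maxmin[OF _ open_UNIV C1_has_derivative[OF assms(1)]]) (use assms(2) in auto)
  then show ?thesis by (simp add: fun_eq_iff)
qed

subsection \<open>A smoothed triangle wave\<close>

text \<open>At \<open>c = 1\<close> this is the triangle wave with slopes 1 and -1. For
  \<open>c < 1\<close> the kinks are rounded off while the slope stays bounded by 1.\<close>

definition wave :: "real \<Rightarrow> real \<Rightarrow> real" where "wave c t = arcsin (c * sin t)"

definition wave' :: "real \<Rightarrow> real \<Rightarrow> real" where "wave' c t = c * cos t / sqrt (1 - (c * sin t)\<^sup>2)"

lemma abs_c_sin_less: "0 < c \<Longrightarrow> c < 1 \<Longrightarrow> \<bar>c * sin t\<bar> < 1" for c t :: real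
proof -
  assume c: "0 < c" "c < 1"
  have "\<bar>c * sin t\<bar> = c * \<bar>sin t\<bar>" using c by (simp add: abs_mult)
  also have "\<dots> \<le> c * 1" using c by (intro mult_left_mono abs_sin_le_one) auto
  finally show ?thesis using c by linarith
qed

lemma c_sin_sq_less: "0 < c \<Longrightarrow> c < 1 \<Longrightarrow> (c * sin t)\<^sup>2 < 1" for c t :: real
  using abs_c_sin_less[of c t] by (simp add: abs_square_less_1)

lemma wave_deriv:
  assumes "0 < c" "c < 1" shows "(wave c has_real_derivative wave' c t) (at t)"
proof -
  have "\<bar>c * sin t\<bar> < 1" using abs_c_sin_less[OF assms] .
  then have "(arcsin has_real_derivative inverse (sqrt (1 - (c * sin t)\<^sup>2))) (at (c * sin t))"
    by (intro DERIV_arcsin) (auto simp: abs_less_iff)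
  then have "((\<lambda>t. arcsin (c * sin t)) has_real_derivative inverse (sqrt (1 - (c * sin t)\<^sup>2)) * (c * cos t)) (at t)"
    by (rule DERIV_chain2) (auto intro!: derivative_eq_intros)
  then show ?thesis unfolding wave_def[abs_def] wave'_def by (simp add: divide_inverse mult.commute)
qed

lemma continuous_wave': "0 < c \<Longrightarrow> c < 1 \<Longrightarrow> continuous_on UNIV (wave' c)"
  unfolding wave'_def[abs_def]
  by (intro continuous_intros ballI) (use c_sin_sq_less in \<open>force simp: less_le\<close>)

lemma abs_wave_le:
  assumes "0 < c" "c < 1" shows "\<bar>wave c t\<bar> \<le> 2"
proof -
  have "- (pi / 2) \<le> arcsin (c * sin t) \<and> arcsin (c * sin t) \<le> pi / 2"
    using arcsin_bounded[of "c * sin t"] abs_c_sin_less[OF assms, of t] by (auto simp: abs_less_iff)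
  then show ?thesis using pi_less_4 by (simp add: wave_def abs_le_iff)
qed

lemma abs_wave'_le:
  assumes "0 < c" "c < 1" shows "\<bar>wave' c t\<bar> \<le> 1"
proof -
  have pos: "0 < 1 - (c * sin t)\<^sup>2" using c_sin_sq_less[OF assms] by simp
  have "c\<^sup>2 \<le> 1" using assms by (simp add: power_le_one)
  have "(c * cos t)\<^sup>2 + (c * sin t)\<^sup>2 = c\<^sup>2" by (simp add: power_mult_distrib flip: distrib_left)
  then have "(c * cos t)\<^sup>2 \<le> 1 - (c * sin t)\<^sup>2" using \<open>c\<^sup>2 \<le> 1\<close> by simp
  then have "\<bar>c * cos t\<bar> \<le> sqrt (1 - (c * sin t)\<^sup>2)" by (simp add: real_le_rsqrt)
  then show ?thesis using pos by (simp add: wave'_def)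
qed

text \<open>The offset 2 keeps the parameter strictly between 0 and 1 already at
  \<open>j = 0\<close>.\<close>

definition wave_param :: "nat \<Rightarrow> real" where "wave_param j = 1 - 1 / real (j + 2)"

lemma wave_param: "0 < wave_param j" "wave_param j < 1"
  by (auto simp: wave_param_def)

lemma wave'_tendsto:
  assumes "cos t \<noteq> 0" shows "(\<lambda>j. \<bar>wave' (wave_param j) t\<bar>) \<longlonglongrightarrow> 1"
proof -
  have "(\<lambda>j. 1 / real (j + 2)) \<longlonglongrightarrow> 0"
    using LIMSEQ_ignore_initial_segment[OF lim_1_over_n, of 2] by simp
  then have c: "wave_param \<longlonglongrightarrow> 1"
    unfolding wave_param_def[abs_def] using tendsto_diff[OF tendsto_const, of _ 0 _ 1] by fastforce
  have s: "sqrt (1 - (1 * sin t)\<^sup>2) = \<bar>cos t\<bar>" by (simp add: cos_squared_eq[symmetric])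
  have "(\<lambda>j. wave' (wave_param j) t) \<longlonglongrightarrow> 1 * cos t / sqrt (1 - (1 * sin t)\<^sup>2)"
    unfolding wave'_def by (intro tendsto_intros c) (use assms s in simp)
  then have "(\<lambda>j. \<bar>wave' (wave_param j) t\<bar>) \<longlonglongrightarrow> \<bar>1 * cos t / sqrt (1 - (1 * sin t)\<^sup>2)\<bar>"
    by (rule tendsto_rabs)
  then show ?thesis using assms unfolding s by simp
qed

text \<open>The kinks of the limiting wave lie on countably many parallel hyperplanes.\<close>

lemma negligible_cos_zero:
  assumes "n \<noteq> (0::'a::euclidean_space)" "k \<noteq> 0"
  shows "negligible {x. cos (k * (n \<bullet> x)) = 0}"
proof -
  have "{x. cos (k * (n \<bullet> x)) = 0} \<subseteq> (\<Union>i::int. {x. n \<bullet> x = (of_int i * (pi / 2)) / k})"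
    using assms(2) by (auto simp: cos_zero_iff_int field_simps)
  moreover have "negligible (\<Union>i::int. {x. n \<bullet> x = (of_int i * (pi / 2)) / k})"
    using negligible_hyperplane[of n] assms(1) negligible_countable_Union[of "range (\<lambda>i::int. {x. n \<bullet> x = (of_int i * (pi / 2)) / k})"] by auto
  ultimately show ?thesis by (rule negligible_subset[rotated])
qed

subsection \<open>Lamination\<close>

context finite_domain
begin

text \<open>Absolute continuity of the integral: the excess of \<open>H\<close> over a height
  \<open>n\<close> has small integral, and the rest contributes at most \<open>n\<close> times the
  measure of \<open>B\<close>.\<close>

lemma small_set_integral:
  fixes H :: "'a \<Rightarrow> real"
  assumes H: "integrable M H" "\<And>x. 0 \<le> H x" and "0 < \<delta>"
  obtains \<eta> where "0 < \<eta>" "\<And>B. B \<in> sets lebesgue \<Longrightarrow> emeasure lebesgue B < ennreal \<eta> \<Longrightarrow> (\<integral>x. indicator B x * H x \<partial>M) < \<delta>"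
proof -
  have m[measurable]: "H \<in> borel_measurable M" using H(1) by simp
  have "(\<lambda>n. \<integral>x. H x - min (H x) (real n) \<partial>M) \<longlonglongrightarrow> (\<integral>x. 0 \<partial>M)"
  proof (rule integral_dominated_convergence[where w = H])
    show "AE x in M. (\<lambda>n. H x - min (H x) (real n)) \<longlonglongrightarrow> 0"
    proof (rule AE_I2)
      fix x
      obtain n0 where "H x \<le> real n0" using real_arch_simple by blast
      then have "H x - min (H x) (real n) = 0" if "n \<ge> n0" for n using that by (simp add: min_def)
      then show "(\<lambda>n. H x - min (H x) (real n)) \<longlonglongrightarrow> 0"
        by (intro tendsto_eventually eventually_sequentiallyI[of n0])
    qed
    show "AE x in M. norm (H x - min (H x) (real n)) \<le> H x" for n
      using H(2) by (intro AE_I2) (simp add: min_def)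
  qed (use H(1) in auto)
  then have "\<forall>\<^sub>F n in sequentially. (\<integral>x. H x - min (H x) (real n) \<partial>M) < \<delta> / 2"
    using \<open>0 < \<delta>\<close> by (intro order_tendstoD(2)) auto
  then obtain n where n: "(\<integral>x. H x - min (H x) (real n) \<partial>M) < \<delta> / 2"
    by (auto dest: eventually_happens)
  define \<eta> where "\<eta> = \<delta> / (2 * (real n + 1))"
  have \<eta>: "0 < \<eta>" using \<open>0 < \<delta>\<close> by (simp add: \<eta>_def)
  show thesis
  proof (rule that[OF \<eta>])
    fix B :: "'a set" assume B: "B \<in> sets lebesgue" "emeasure lebesgue B < ennreal \<eta>"
    have BM: "B \<inter> \<Omega> \<in> sets M" using B(1) sets_Omega by (auto simp: sets_restrict_space)
    have "emeasure M (B \<inter> \<Omega>) \<le> emeasure lebesgue B"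
    proof (subst emeasure_restrict_space)
      show "emeasure lebesgue (B \<inter> \<Omega>) \<le> emeasure lebesgue B" by (rule emeasure_mono[OF _ B(1)]) simp
    qed (use sets_Omega in auto)
    then have "emeasure M (B \<inter> \<Omega>) < ennreal \<eta>" using B(2) by (rule le_less_trans)
    then have mB: "measure M (B \<inter> \<Omega>) < \<eta>" using \<eta> by (simp add: emeasure_eq_measure ennreal_less_iff)
    have i1: "integrable M (\<lambda>x. H x - min (H x) (real n))"
      by (rule Bochner_Integration.integrable_bound[OF H(1)]) (use H(2) in \<open>auto simp: min_def intro!: AE_I2\<close>)
    have i2: "integrable M (\<lambda>x. real n * indicator (B \<inter> \<Omega>) x)" using BM by (intro integrable_mult_right integrable_real_indicator) (auto simp: emeasure_eq_measure)
    have "(\<integral>x. indicator B x * H x \<partial>M) \<le> (\<integral>x. (H x - min (H x) (real n)) + real n * indicator (B \<inter> \<Omega>) x \<partial>M)"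
    proof (rule integral_mono)
      have "(\<lambda>x. indicator (B \<inter> \<Omega>) x * H x) \<in> borel_measurable M"
        by (intro borel_measurable_times borel_measurable_indicator BM m)
      then have im: "(\<lambda>x. indicator B x * H x) \<in> borel_measurable M"
        by (rule measurable_cong[THEN iffD1, rotated]) (simp add: indicator_def)
      show "integrable M (\<lambda>x. indicator B x * H x)"
        by (rule Bochner_Integration.integrable_bound[OF H(1) im]) (use H(2) in \<open>auto simp: indicator_def intro!: AE_I2\<close>)
      show "integrable M (\<lambda>x. (H x - min (H x) (real n)) + real n * indicator (B \<inter> \<Omega>) x)"
        by (rule Bochner_Integration.integrable_add[OF i1 i2])
      show "indicator B x * H x \<le> (H x - min (H x) (real n)) + real n * indicator (B \<inter> \<Omega>) x" if "x \<in> space M" for x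
        using that H(2)[of x] by (auto simp: indicator_def min_def)
    qed
    also have "\<dots> = (\<integral>x. H x - min (H x) (real n) \<partial>M) + real n * measure M (B \<inter> \<Omega>)"
      using Bochner_Integration.integral_add[OF i1 i2] BM by (simp add: Int_absorb2)
    also have "\<dots> < \<delta> / 2 + (real n + 1) * \<eta>"
      using n mB \<eta> by (intro add_strict_mono) (auto intro: le_less_trans[OF mult_left_mono[OF less_imp_le[OF mB]]] simp: algebra_simps)
    also have "\<dots> = \<delta>" by (simp add: \<eta>_def field_simps)
    finally show "(\<integral>x. indicator B x * H x \<partial>M) < \<delta>" .
  qed
qed

lemma integrable_exp_inner:
  fixes z :: "'a \<Rightarrow> 'b::euclidean_space"
  assumes bdd: "bounded \<Omega>" and z: "z \<in> Lp p \<Omega>"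
  shows "integrable M (\<lambda>x. exp (a \<bullet> x) * (z x \<bullet> b))"
proof -
  have c: "continuous_on UNIV (\<lambda>x. exp (a \<bullet> x) *\<^sub>R b)" by (intro continuous_intros)
  obtain K where "\<And>x. x \<in> \<Omega> \<Longrightarrow> norm (exp (a \<bullet> x) *\<^sub>R b) \<le> K" using continuous_bounded_on[OF c bdd] by blast
  then have "integrable M (\<lambda>x. (exp (a \<bullet> x) *\<^sub>R b) \<bullet> z x)"
    by (rule Lp_inner_integrable[OF z measurable_continuous[OF c]])
  then show ?thesis by (simp add: inner_commute)
qed

end

context cylinder
begin

text \<open>Lebesgue regularity gives a compact set inside \<open>E\<close> and an open set around
  this compact set, each with little excess; the cut-off between them is wrong only on the two
  differences.\<close>

lemma cutoff_approx_indicator: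
  assumes E: "E \<in> sets lebesgue" "E \<subseteq> \<Omega>" and "0 < \<eta>"
  obtains \<zeta> B where "C1 \<zeta>" "\<And>x. 0 \<le> \<zeta> x" "\<And>x. \<zeta> x \<le> 1" "\<And>x. x \<notin> \<Omega> \<Longrightarrow> \<zeta> x = 0"
    "B \<in> sets lebesgue" "emeasure lebesgue B < ennreal \<eta>" "\<And>x. x \<notin> B \<Longrightarrow> \<zeta> x = indicator E x"
proof -
  obtain T where T: "closed T" "T \<subseteq> E" "E - T \<in> lmeasurable" "emeasure lebesgue (E - T) < ennreal (\<eta> / 2)"
    using sets_lebesgue_inner_closed[OF E(1), of "\<eta> / 2"] \<open>0 < \<eta>\<close> by auto
  have "bounded T" using T(2) E(2) boundedO bounded_subset by (meson subset_trans)
  then have cT: "compact T" using T(1) compact_eq_bounded_closed by blast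
  obtain U where U: "open U" "T \<subseteq> U" "U - T \<in> lmeasurable" "emeasure lebesgue (U - T) < ennreal (\<eta> / 2)"
    using sets_lebesgue_outer_open[of T "\<eta> / 2"] T(1) \<open>0 < \<eta>\<close> by auto
  obtain \<zeta> where \<zeta>: "C1 \<zeta>" "\<And>x. 0 \<le> \<zeta> x" "\<And>x. \<zeta> x \<le> 1" "\<And>x. x \<in> T \<Longrightarrow> \<zeta> x = 1" "\<And>x. x \<notin> U \<inter> \<Omega> \<Longrightarrow> \<zeta> x = 0"
    by (rule C1_cutoff[OF cT, of "U \<inter> \<Omega>"]) (use U openO T(2) E(2) in auto)
  define B where "B = (E - T) \<union> (U - T)"
  have "emeasure lebesgue B \<le> emeasure lebesgue (E - T) + emeasure lebesgue (U - T)"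
    unfolding B_def using T(3) U(3) by (intro emeasure_subadditive) auto
  also have "\<dots> < ennreal (\<eta> / 2) + ennreal (\<eta> / 2)" using T(4) U(4) by (rule add_strict_mono)
  also have "\<dots> = ennreal \<eta>" using \<open>0 < \<eta>\<close> by (simp flip: ennreal_plus)
  finally have "emeasure lebesgue B < ennreal \<eta>" .
  moreover have "B \<in> sets lebesgue" using T(3) U(3) by (auto simp: B_def)
  moreover have "\<zeta> x = indicator E x" if "x \<notin> B" for x
    using that \<zeta>(4)[of x] \<zeta>(5)[of x] T(2) by (auto simp: B_def indicator_def)
  moreover have "\<zeta> x = 0" if "x \<notin> \<Omega>" for x using \<zeta>(5) that by blast
  ultimately show thesis using that \<zeta>(1-3) by blast
qed

text \<open>Integration by parts moves the derivative onto the exponential. The moment is thus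
  controlled by the amplitude of \<phi>, however steep \<phi> is.\<close>

lemma integral_exp_dd_le:
  assumes \<phi>: "C1 \<phi>" and out: "\<And>x. x \<notin> \<Omega> \<Longrightarrow> \<phi> x = 0" and dout: "\<And>x. x \<notin> \<Omega> \<Longrightarrow> dd \<phi> x v = 0"
    and small: "\<And>x. \<bar>\<phi> x\<bar> \<le> \<rho>" and R: "norm a \<le> R" "\<And>x. x \<in> \<Omega> \<Longrightarrow> norm x \<le> R1"
  shows "\<bar>\<integral>x. exp (a \<bullet> x) * dd \<phi> x v \<partial>M\<bar> \<le> R * norm v * exp (R * R1) * measure M \<Omega> * \<rho>"
proof -
  let ?e = "\<lambda>x. exp (a \<bullet> x)"
  have e: "C1 ?e" by (rule C1_compose_real[OF C1_inner DERIV_exp]) (auto intro!: continuous_intros)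
  have de: "dd ?e x v = ?e x * (a \<bullet> v)" for x
    by (rule dd_eqI) (auto intro!: derivative_eq_intros)
  have out': "x \<notin> cball 0 R1 \<Longrightarrow> x \<notin> \<Omega>" for x using R(2)[of x] by auto
  have c1: "continuous_on UNIV (\<lambda>x. ?e x * dd \<phi> x v)"
    by (intro continuous_on_mult C1_continuous[OF e] C1_continuous_dd[OF \<phi>])
  have c2: "continuous_on UNIV (\<lambda>x. (?e x * (a \<bullet> v)) * \<phi> x)"
    by (intro continuous_on_mult C1_continuous[OF e] C1_continuous[OF \<phi>] continuous_on_const)
  have i1: "integrable lborel (\<lambda>x. ?e x * dd \<phi> x v)"
    by (rule integrable_continuous_bounded_support[OF c1, of R1]) (simp add: dout out')
  have i2: "integrable lborel (\<lambda>x. (?e x * (a \<bullet> v)) * \<phi> x)"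
    by (rule integrable_continuous_bounded_support[OF c2, of R1]) (simp add: out out')
  have "(\<integral>x. dd (\<lambda>x. ?e x * \<phi> x) x v \<partial>lborel) = 0"
    by (rule integral_dd_eq_0[OF C1_mult[OF e \<phi>], of R1]) (simp add: out out')
  then have "(\<integral>x. ?e x * dd \<phi> x v + (?e x * (a \<bullet> v)) * \<phi> x \<partial>lborel) = 0"
    unfolding dd_mult[OF e \<phi>] de .
  then have "(\<integral>x. ?e x * dd \<phi> x v \<partial>lborel) = - (\<integral>x. (?e x * (a \<bullet> v)) * \<phi> x \<partial>lborel)"
    unfolding Bochner_Integration.integral_add[OF i1 i2] by linarith
  then have eq: "(\<integral>x. ?e x * dd \<phi> x v \<partial>M) = - (\<integral>x. (?e x * (a \<bullet> v)) * \<phi> x \<partial>M)"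
    using integral_lebesgue_on_eq_lborel[OF c1 _ sets_Omega] integral_lebesgue_on_eq_lborel[OF c2 _ sets_Omega] out dout by simp
  have \<rho>: "0 \<le> \<rho>" using small[of 0] by linarith
  have R0: "0 \<le> R" using R(1) norm_ge_zero order_trans by blast
  have pw: "\<bar>(?e x * (a \<bullet> v)) * \<phi> x\<bar> \<le> exp (R * R1) * (R * norm v) * \<rho>" if x: "x \<in> \<Omega>" for x
  proof -
    have "a \<bullet> x \<le> norm a * norm x" by (rule norm_cauchy_schwarz)
    also have "\<dots> \<le> R * R1" using R(1) R(2)[OF x] R0 by (intro mult_mono) auto
    finally have "?e x \<le> exp (R * R1)" by simp
    moreover have "\<bar>a \<bullet> v\<bar> \<le> R * norm v"
      using R(1) by (intro order_trans[OF Cauchy_Schwarz_ineq2] mult_right_mono) auto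
    ultimately show ?thesis unfolding abs_mult using small[of x] R0 by (intro mult_mono) auto
  qed
  have "integrable M (\<lambda>x. (?e x * (a \<bullet> v)) * \<phi> x)"
    by (rule integrable_bounded[OF measurable_continuous[OF c2]]) (use pw in auto)
  then have "\<bar>\<integral>x. (?e x * (a \<bullet> v)) * \<phi> x \<partial>M\<bar> \<le> (\<integral>x. exp (R * R1) * (R * norm v) * \<rho> \<partial>M)"
    using pw by (intro order_trans[OF integral_abs_bound] integral_mono) auto
  then show ?thesis unfolding eq by (simp add: mult_ac)
qed

end

section \<open>Construction of localised laminates\<close>

context cylinder
begin

abbreviation exp_moments_le :: "real \<Rightarrow> real \<Rightarrow> ('n pt \<Rightarrow> 'n pt) \<Rightarrow> bool" where
  "exp_moments_le R \<rho> z \<equiv> \<forall>a b. norm a \<le> R \<longrightarrow> b \<in> Basis \<longrightarrow> \<bar>\<integral>x. exp (a \<bullet> x) * (z x \<bullet> b) \<partial>M\<bar> \<le> \<rho>"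

text \<open>\<open>B\<close> is the transition set of the cut-off and \<open>s j\<close> the slope
  of the wave. The index \<open>j\<close> sharpens the wave at fixed frequency, so \<open>B\<close>
  and the moment bound do not change with \<open>j\<close>.\<close>

abbreviation laminates :: "real \<Rightarrow> 'n pt \<Rightarrow> real \<Rightarrow> 'n pt set \<Rightarrow> real \<Rightarrow> real \<Rightarrow> real \<Rightarrow> bool" where
  "laminates \<epsilon> \<xi> K0 E \<eta> \<rho> R \<equiv>
    \<exists>B \<psi> s. B \<in> sets lebesgue \<and> emeasure lebesgue B < ennreal \<eta> \<and> (\<forall>j::nat. \<psi> j \<in> U_eps p \<Omega> \<epsilon>) \<and>
      (\<forall>j x. norm (\<psi> j x) \<le> K0) \<and> (\<forall>j x. x \<notin> B \<longrightarrow> \<psi> j x = (indicator E x * s j x) *\<^sub>R \<xi>) \<and>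
      (AE x in M. (\<lambda>j. \<bar>s j x\<bar>) \<longlonglongrightarrow> 1) \<and> (\<forall>j. exp_moments_le R \<rho> (\<psi> j))"

text \<open>The layers are orthogonal to a unit vector \<open>n\<close> with \<open>n \<bullet> Teps \<epsilon> \<xi> = 0\<close>, so that a field oscillating between
  \<open>\<xi>\<close> and \<open>- \<xi>\<close> across them has rescaled divergence zero. It is derived from a potential, hence it can be cut off.
  The bound \<open>K0\<close> must not depend on \<open>\<eta>\<close>: it makes the energy on the exceptional set \<open>B\<close> small.\<close>

lemma lamination_field:
  fixes \<xi> :: "'n pt"
  assumes \<epsilon>: "0 < \<epsilon>"
  obtains K0 where "0 \<le> K0"
    "\<forall>E \<eta> \<rho> R. E \<in> sets lebesgue \<longrightarrow> E \<subseteq> \<Omega> \<longrightarrow> 0 < \<eta> \<longrightarrow> 0 < \<rho> \<longrightarrow> 0 \<le> R \<longrightarrow> laminates \<epsilon> \<xi> K0 E \<eta> \<rho> R"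
proof -
  define X where "X = Teps \<epsilon> \<xi>"
  have TX: "Tinv \<epsilon> X = \<xi>" using \<epsilon> by (simp add: X_def Tinv_Teps)
  have "2 \<le> DIM('n pt)" using zero_less_card_finite[where 'a = 'n] by (simp add: Suc_le_eq)
  then obtain y :: "'n pt" where y: "y \<noteq> 0" "orthogonal X y" by (rule orthogonal_to_vector_exists)
  define n where "n = y /\<^sub>R norm y"
  have n: "norm n = 1" "n \<bullet> X = 0" "n \<bullet> n = 1" "n \<noteq> 0"
    using y by (auto simp: n_def orthogonal_def inner_commute dot_square_norm power2_eq_square)
  obtain L where L: "0 < L" "\<And>v :: 'n pt. norm (Tinv \<epsilon> v) \<le> L * norm v"
    using linear_bounded_pos[OF linear_Tinv] by blast
  \<comment> \<open>For large frequency the potential has derivative at most 2 along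
    \<open>n\<close> and at most \<open>1 + norm X\<close> along \<open>X\<close>; the extra 1 in
    each absorbs the gradient of the cut-off.\<close>
  define K0 where "K0 = L * (2 * norm X + (1 + norm X))"
  obtain R1 where R1: "\<And>x. x \<in> \<Omega> \<Longrightarrow> norm x \<le> R1" using boundedO by (auto simp: bounded_iff)
  show thesis
  proof (rule that[of K0])
    show "0 \<le> K0" using L by (simp add: K0_def)
  next
    show "\<forall>E \<eta> \<rho> R. E \<in> sets lebesgue \<longrightarrow> E \<subseteq> \<Omega> \<longrightarrow> 0 < \<eta> \<longrightarrow> 0 < \<rho> \<longrightarrow> 0 \<le> R \<longrightarrow> laminates \<epsilon> \<xi> K0 E \<eta> \<rho> R"
    proof (intro allI impI)
      fix E and \<eta> \<rho> R :: real
      assume E: "E \<in> sets lebesgue" "E \<subseteq> \<Omega>" and \<eta>: "0 < \<eta>" and \<rho>: "0 < \<rho>" and R: "0 \<le> R"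
      obtain \<zeta> B where \<zeta>: "C1 \<zeta>" "\<And>x. 0 \<le> \<zeta> x" "\<And>x. \<zeta> x \<le> 1" "\<And>x. x \<notin> \<Omega> \<Longrightarrow> \<zeta> x = 0"
        and B: "B \<in> sets lebesgue" "emeasure lebesgue B < ennreal \<eta>" "\<And>x. x \<notin> B \<Longrightarrow> \<zeta> x = indicator E x"
        using cutoff_approx_indicator[OF E \<eta>] by metis
      have dd0: "dd \<zeta> x v = 0" if "\<zeta> x = 0 \<or> \<zeta> x = 1" for x v
        using that \<zeta>(2,3) by (intro dd_zero_at_extremum[OF \<zeta>(1)]) auto
      obtain L1 where L1: "0 < L1" "\<And>x v. x \<in> \<Omega> \<Longrightarrow> \<bar>dd \<zeta> x v\<bar> \<le> L1 * norm v"
      proof -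
        obtain K where K: "K > 0" "\<And>x. x \<in> \<Omega> \<Longrightarrow> norm (grad \<zeta> x) \<le> K" using grad_bounded[OF \<zeta>(1)] by blast
        have "\<bar>dd \<zeta> x v\<bar> \<le> K * norm v" if "x \<in> \<Omega>" for x v
          unfolding dd_eq_grad[OF \<zeta>(1)] using K(2)[OF that]
          by (intro order_trans[OF Cauchy_Schwarz_ineq2] mult_right_mono) auto
        then show thesis using K(1) that by blast
      qed
      have ddb: "\<bar>dd \<zeta> x v\<bar> \<le> L1 * norm v" for x v
        using L1(2)[of x v] dd0[of x v] \<zeta>(4)[of x] L1(1) by (cases "x \<in> \<Omega>") auto
      define A where "A = R * exp (R * R1) * measure M \<Omega>"
      have A: "0 \<le> A" using R by (simp add: A_def)
      \<comment> \<open>The frequency is chosen after the cut-off. Its first term keeps the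
        contribution of the cut-off gradient below 1, its last term makes the moments at most
        \<rho>, and the 1 ensures positivity.\<close>
      define k where "k = 2 * L1 * (1 + norm X) + 1 + 4 * L * A * norm X / \<rho>"
      have k: "0 < k" "2 * L1 * (1 + norm X) \<le> k" "4 * L * A * norm X \<le> k * \<rho>"
      proof -
        have "0 \<le> 4 * L * A * norm X / \<rho>" "0 \<le> 2 * L1 * (1 + norm X)" using L A \<rho> L1 by auto
        then show "0 < k" "2 * L1 * (1 + norm X) \<le> k" unfolding k_def by linarith+
        have "k * \<rho> = (2 * L1 * (1 + norm X) + 1) * \<rho> + 4 * L * A * norm X" using \<rho> by (simp add: k_def field_simps)
        moreover have "0 \<le> (2 * L1 * (1 + norm X) + 1) * \<rho>" using L1 \<rho> by (intro mult_nonneg_nonneg add_nonneg_nonneg) auto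
        ultimately show "4 * L * A * norm X \<le> k * \<rho>" by linarith
      qed
      define s where "s j x = wave' (wave_param j) ((k *\<^sub>R n) \<bullet> x)" for j x
      \<comment> \<open>Dividing by \<open>k\<close> leaves slopes of order one and an amplitude of
        at most \<open>2 / k\<close>.\<close>
      define W where "W j x = wave (wave_param j) ((k *\<^sub>R n) \<bullet> x) * (1 / k)" for j x
      define \<phi> where "\<phi> j x = \<zeta> x * W j x" for j x
      have C1W: "C1 (W j)" for j unfolding W_def[abs_def]
        by (intro C1_mult C1_const C1_compose_real[OF C1_inner wave_deriv continuous_wave'] wave_param)
      have ddinner: "dd (\<lambda>x. a \<bullet> x) x v = a \<bullet> v" for a x v :: "'n pt"
        by (rule dd_eqI) (auto intro!: derivative_eq_intros)
      have ddW: "dd (W j) x v = s j x * (n \<bullet> v)" for j x v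
      proof -
        have "(W j has_derivative (\<lambda>v. wave' (wave_param j) ((k *\<^sub>R n) \<bullet> x) * dd (\<lambda>x. (k *\<^sub>R n) \<bullet> x) x v * (1 / k))) (at x)"
          unfolding W_def[abs_def]
          by (rule has_derivative_mult_left[OF has_derivative_compose_real[OF C1_inner wave_deriv]]) (rule wave_param)+
        from dd_eqI[OF this, of v] show ?thesis unfolding ddinner s_def using k(1) by simp
      qed
      have C1\<phi>: "C1 (\<phi> j)" for j unfolding \<phi>_def[abs_def] by (intro C1_mult \<zeta>(1) C1W)
      have dd\<phi>: "dd (\<phi> j) x v = \<zeta> x * (s j x * (n \<bullet> v)) + dd \<zeta> x v * W j x" for j x v
        unfolding \<phi>_def[abs_def] dd_mult[OF \<zeta>(1) C1W] ddW ..
      have Wb: "\<bar>W j x\<bar> \<le> 2 / k" for j x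
        using abs_wave_le[OF wave_param, of j "(k *\<^sub>R n) \<bullet> x"] k(1) by (simp add: W_def abs_mult divide_right_mono)
      have \<phi>b: "\<bar>\<phi> j x\<bar> \<le> 2 / k" for j x
      proof -
        have "\<bar>\<phi> j x\<bar> \<le> 1 * (2 / k)" unfolding \<phi>_def abs_mult using \<zeta>(2,3) Wb by (intro mult_mono) auto
        then show ?thesis by simp
      qed
      have sb: "\<bar>s j x\<bar> \<le> 1" for j x unfolding s_def by (rule abs_wave'_le[OF wave_param])
      have dd\<phi>b: "\<bar>dd (\<phi> j) x v\<bar> \<le> norm v + (if norm v \<le> 1 + norm X then 1 else norm v * L1 * (2 / k))" for j x v
      proof -
        have "\<bar>s j x * (n \<bullet> v)\<bar> \<le> 1 * norm v"
          unfolding abs_mult using sb[of j x] Cauchy_Schwarz_ineq2[of n v] n(1) by (intro mult_mono) auto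
        then have "\<bar>\<zeta> x * (s j x * (n \<bullet> v))\<bar> \<le> 1 * norm v"
          unfolding abs_mult[of "\<zeta> x"] using \<zeta>(2,3)[of x] by (intro mult_mono) auto
        moreover have 1: "\<bar>dd \<zeta> x v * W j x\<bar> \<le> (L1 * norm v) * (2 / k)"
          unfolding abs_mult using ddb Wb L1 by (intro mult_mono) auto
        moreover have "(L1 * norm v) * (2 / k) \<le> 1" if "norm v \<le> 1 + norm X"
        proof -
          have "2 * L1 * norm v \<le> 2 * L1 * (1 + norm X)" using that L1 by (intro mult_left_mono) auto
          then have "2 * L1 * norm v \<le> k" using k(2) by linarith
          then show ?thesis using k(1) by (simp add: field_simps)
        qed
        ultimately show ?thesis unfolding dd\<phi> by (auto simp: mult_ac)
      qed
      \<comment> \<open>Off \<open>B\<close> the cut-off is locally inactive, and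
        \<open>n \<bullet> n = 1\<close>, \<open>n \<bullet> X = 0\<close> reduce the bracket to
        \<open>\<zeta> x * s j x\<close> times \<open>X\<close>, which \<open>Tinv\<close> maps to
        the direction \<xi>.\<close>
      define \<psi> where "\<psi> j x = Tinv \<epsilon> (dd (\<phi> j) x n *\<^sub>R X - dd (\<phi> j) x X *\<^sub>R n)" for j x
      have U: "\<psi> j \<in> U_eps p \<Omega> \<epsilon>" for j
        unfolding \<psi>_def[abs_def] by (rule potential_in_U_eps[OF C1\<phi> \<epsilon>])
      have nb: "norm (\<psi> j x) \<le> K0" for j x
      proof -
        have "norm (dd (\<phi> j) x n *\<^sub>R X - dd (\<phi> j) x X *\<^sub>R n) \<le> \<bar>dd (\<phi> j) x n\<bar> * norm X + \<bar>dd (\<phi> j) x X\<bar> * norm n"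
          by (metis norm_scaleR norm_triangle_ineq4)
        also have "\<dots> \<le> 2 * norm X + (1 + norm X) * 1"
          using dd\<phi>b[of j x n] dd\<phi>b[of j x X] n(1) by (intro add_mono mult_mono) auto
        finally have *: "norm (dd (\<phi> j) x n *\<^sub>R X - dd (\<phi> j) x X *\<^sub>R n) \<le> 2 * norm X + (1 + norm X)" by simp
        have "norm (\<psi> j x) \<le> L * norm (dd (\<phi> j) x n *\<^sub>R X - dd (\<phi> j) x X *\<^sub>R n)"
          unfolding \<psi>_def by (rule L(2))
        also have "\<dots> \<le> K0" unfolding K0_def using * L(1) by (intro mult_left_mono) auto
        finally show ?thesis .
      qed
      have val: "\<psi> j x = (indicator E x * s j x) *\<^sub>R \<xi>" if "x \<notin> B" for j x
      proof -
        have "dd \<zeta> x v = 0" for v using B(3)[OF that] by (intro dd0) (auto simp: indicator_def)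
        then show ?thesis
          using B(3)[OF that] n(2,3) by (simp add: \<psi>_def dd\<phi> linear_cmul[OF linear_Tinv] TX)
      qed
      have ae: "AE x in M. (\<lambda>j. \<bar>s j x\<bar>) \<longlonglongrightarrow> 1"
      proof -
        have "negligible {x. cos (k * (n \<bullet> x)) = 0}" using n(4) k(1) by (intro negligible_cos_zero) auto
        from AE_lebesgue_on_not_negligible[OF this sets_Omega] show ?thesis
          by (rule eventually_mono) (use wave'_tendsto in \<open>auto simp: s_def\<close>)
      qed
      have dout: "dd (\<phi> j) x v = 0" and out: "\<phi> j x = 0" if "x \<notin> \<Omega>" for j x v
        using dd0[of x v] \<zeta>(4)[OF that] by (simp_all add: dd\<phi>) (simp add: \<phi>_def)
      have close: "\<bar>\<integral>x. exp (a \<bullet> x) * (\<psi> j x \<bullet> b) \<partial>M\<bar> \<le> \<rho>" if a: "norm a \<le> R" and b: "b \<in> Basis" for j a b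
      proof -
        define I where "I v = (\<integral>x. exp (a \<bullet> x) * dd (\<phi> j) x v \<partial>M)" for v
        have I: "\<bar>I v\<bar> \<le> A * norm v * (2 / k)" for v
          using integral_exp_dd_le[OF C1\<phi> out dout \<phi>b a R1, of j v] unfolding I_def A_def by (simp add: mult_ac)
        have c: "continuous_on UNIV (\<lambda>x. exp (a \<bullet> x) * dd (\<phi> j) x v)" for v
          by (intro continuous_intros C1_continuous_dd C1\<phi>)
        have int: "integrable M (\<lambda>x. exp (a \<bullet> x) * dd (\<phi> j) x v)" for v
        proof -
          obtain K where "\<And>x. x \<in> \<Omega> \<Longrightarrow> norm (exp (a \<bullet> x) * dd (\<phi> j) x v) \<le> K" using continuous_bounded_on[OF c boundedO] by blast
          then show ?thesis by (rule integrable_bounded[OF measurable_continuous[OF c]])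
        qed
        have "exp (a \<bullet> x) * (\<psi> j x \<bullet> b) = (Tinv \<epsilon> X \<bullet> b) * (exp (a \<bullet> x) * dd (\<phi> j) x n) - (Tinv \<epsilon> n \<bullet> b) * (exp (a \<bullet> x) * dd (\<phi> j) x X)" for x
          by (simp add: \<psi>_def linear_diff[OF linear_Tinv] linear_cmul[OF linear_Tinv] inner_diff_left algebra_simps)
        then have "(\<integral>x. exp (a \<bullet> x) * (\<psi> j x \<bullet> b) \<partial>M) = (Tinv \<epsilon> X \<bullet> b) * I n - (Tinv \<epsilon> n \<bullet> b) * I X"
          using int by (simp add: I_def)
        also have "\<bar>\<dots>\<bar> \<le> \<bar>Tinv \<epsilon> X \<bullet> b\<bar> * \<bar>I n\<bar> + \<bar>Tinv \<epsilon> n \<bullet> b\<bar> * \<bar>I X\<bar>"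
          by (rule order_trans[OF abs_triangle_ineq4]) (simp add: abs_mult)
        also have "\<dots> \<le> (L * norm X) * (A * norm n * (2 / k)) + (L * norm n) * (A * norm X * (2 / k))"
          by (intro add_mono mult_mono I order_trans[OF Basis_le_norm[OF b] L(2)]) (use L(1) in auto)
        also have "\<dots> = 4 * L * A * norm X / k" using n(1) by (simp add: field_simps)
        also have "\<dots> \<le> \<rho>" using k by (simp add: field_simps)
        finally show ?thesis .
      qed
      show "laminates \<epsilon> \<xi> K0 E \<eta> \<rho> R"
        by (rule exI[of _ B], rule exI[of _ \<psi>], rule exI[of _ s]) (use B U nb val ae close in blast)
    qed
  qed
qed

end

section \<open>Relaxation of the energy by repeated lamination\<close>

locale thin_film = cylinder \<Omega> p + integrand \<Omega> p f C
  for \<Omega> :: "'n::finite pt set" and p and f :: "'n pt \<Rightarrow> 'n pt \<Rightarrow> real" and C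
begin

text \<open>Replacing \<open>\<psi>\<close> by \<open>- \<psi>\<close> if necessary, the energy is at most the average of the two, and this average
  no longer oscillates.\<close>

lemma lamination:
  assumes g: "admissible C g" and \<epsilon>: "0 < \<epsilon>" and u: "u \<in> U_eps p \<Omega> \<epsilon>"
    and E: "E \<in> sets lebesgue" "E \<subseteq> \<Omega>" and \<delta>: "0 < \<delta>" and R: "0 \<le> R"
  shows "\<exists>v\<in>U_eps p \<Omega> \<epsilon>. exp_moments_le R \<delta> (\<lambda>x. v x - u x)
    \<and> (\<integral>x. g x (v x) \<partial>M) \<le> (\<integral>x. (if x \<in> E then (g x (u x + \<xi>) + g x (u x - \<xi>)) / 2 else g x (u x)) \<partial>M) + \<delta>"
proof -
  define h where "h x = (if x \<in> E then (g x (u x + \<xi>) + g x (u x - \<xi>)) / 2 else g x (u x))" for x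
  have uL: "u \<in> Lp p \<Omega>" using u by (simp add: U_eps_iff)
  obtain K0 where K0: "0 \<le> K0" and field:
    "\<forall>E \<eta> \<rho> R. E \<in> sets lebesgue \<longrightarrow> E \<subseteq> \<Omega> \<longrightarrow> 0 < \<eta> \<longrightarrow> 0 < \<rho> \<longrightarrow> 0 \<le> R \<longrightarrow> laminates \<epsilon> \<xi> K0 E \<eta> \<rho> R"
    by (rule lamination_field[OF \<epsilon>, where \<xi> = \<xi>])
  define K where "K = K0 + norm \<xi>"
  define H where "H x = C * (2 powr p * (norm (u x) powr p + K powr p)) + C" for x
  have H_int: "integrable M H" unfolding H_def using LpD(2)[OF uL] by simp
  have H0: "0 \<le> H x" for x using C_pos by (simp add: H_def)
  have gH: "\<bar>g x (u x + w)\<bar> \<le> H x" if x: "x \<in> \<Omega>" and w: "norm w \<le> K" for x w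
  proof -
    have "- C \<le> g x (u x + w)" "g x (u x + w) \<le> C * norm (u x + w) powr p + C"
      using g x unfolding admissible_def by blast+
    moreover have "norm (u x + w) powr p \<le> 2 powr p * (norm (u x) powr p + K powr p)"
      using w p_pos by (intro order_trans[OF norm_add_powr_le[OF p_pos]] mult_left_mono add_left_mono powr_mono2) auto
    then have "C * norm (u x + w) powr p + C \<le> H x" unfolding H_def using C_pos by simp
    moreover have "C \<le> H x" using C_pos by (simp add: H_def)
    ultimately show ?thesis by (simp add: abs_le_iff)
  qed
  have gm: "(\<lambda>x. g x (u x + w x)) \<in> borel_measurable M" if "w \<in> borel_measurable M" for w
    using g caratheodory_measurable[OF _ borel_measurable_add[OF LpD(1)[OF uL] that]] by (auto simp: admissible_def)
  have gi: "integrable M (\<lambda>x. g x (u x + w x))" if "w \<in> borel_measurable M" "\<And>x. norm (w x) \<le> K" for w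
    by (rule Bochner_Integration.integrable_bound[OF H_int gm[OF that(1)] AE_I2]) (simp add: gH[OF _ that(2)] H0)
  obtain \<eta> where \<eta>: "0 < \<eta>"
    "\<And>B. B \<in> sets lebesgue \<Longrightarrow> emeasure lebesgue B < ennreal \<eta> \<Longrightarrow> (\<integral>x. indicator B x * H x \<partial>M) < \<delta> / 4"
    using small_set_integral[OF H_int H0, of "\<delta> / 4"] \<delta> by auto
  from field[rule_format, OF E \<eta>(1) \<delta> R] obtain B \<psi> s where B: "B \<in> sets lebesgue" "emeasure lebesgue B < ennreal \<eta>"
    and \<psi>: "\<And>j::nat. \<psi> j \<in> U_eps p \<Omega> \<epsilon>" "\<And>j x. norm (\<psi> j x) \<le> K0"
      "\<And>j x. x \<notin> B \<Longrightarrow> \<psi> j x = (indicator E x * s j x) *\<^sub>R \<xi>"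
    and s: "AE x in M. (\<lambda>j. \<bar>s j x\<bar>) \<longlonglongrightarrow> 1"
    and close: "\<And>j a b. norm a \<le> R \<Longrightarrow> b \<in> Basis \<Longrightarrow> \<bar>\<integral>x. exp (a \<bullet> x) * (\<psi> j x \<bullet> b) \<partial>M\<bar> \<le> \<delta>"
    by blast
  have \<psi>m: "\<psi> j \<in> borel_measurable M" "(\<lambda>x. - \<psi> j x) \<in> borel_measurable M" for j
    using \<psi>(1)[of j] by (auto simp: U_eps_iff dest: LpD(1))
  have \<psi>K: "norm (\<psi> j x) \<le> K" for j x using \<psi>(2)[of j x] by (simp add: K_def add_increasing2)
  define A where "A j x = (g x (u x + \<psi> j x) + g x (u x + - \<psi> j x)) / 2" for j x
  have i1: "integrable M (\<lambda>x. g x (u x + \<psi> j x))" and i2: "integrable M (\<lambda>x. g x (u x + - \<psi> j x))" for j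
    by (rule gi[OF \<psi>m(1) \<psi>K], rule gi[OF \<psi>m(2)]) (simp add: \<psi>K)
  have A_int: "integrable M (A j)" for j unfolding A_def[abs_def] using i1 i2 by simp
  have AH: "\<bar>A j x\<bar> \<le> H x" if "x \<in> \<Omega>" for j x
    using gH[OF that, of "\<psi> j x"] gH[OF that, of "- \<psi> j x"] \<psi>K[of j x] by (simp add: A_def)
  have hH: "\<bar>h x\<bar> \<le> H x" if "x \<in> \<Omega>" for x
  proof -
    have *: "\<bar>g x (u x)\<bar> \<le> H x" "\<bar>g x (u x + \<xi>)\<bar> \<le> H x" "\<bar>g x (u x - \<xi>)\<bar> \<le> H x"
      using gH[OF that, of 0] gH[OF that, of \<xi>] gH[OF that, of "- \<xi>"] K0 by (simp_all add: K_def)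
    have "\<bar>(g x (u x + \<xi>) + g x (u x - \<xi>)) / 2\<bar> \<le> H x"
      using abs_triangle_ineq[of "g x (u x + \<xi>)" "g x (u x - \<xi>)"] *(2,3) by simp
    then show ?thesis using *(1) by (simp add: h_def)
  qed
  have EM: "{x \<in> space M. x \<in> E} \<in> sets M"
    using E sets_Omega by (auto simp: sets_restrict_space_iff Int_absorb2 Collect_conj_eq)
  have h_m: "h \<in> borel_measurable M" unfolding h_def[abs_def]
    using gm[of "\<lambda>x. \<xi>"] gm[of "\<lambda>x. - \<xi>"] gm[of "\<lambda>x. 0"] by (intro measurable_If EM) simp_all
  have h_int: "integrable M h"
    by (rule Bochner_Integration.integrable_bound[OF H_int h_m AE_I2]) (simp add: hH H0)
  have Bm: "indicator B \<in> borel_measurable M"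
    using B(1) by (intro measurable_restrict_space1 borel_measurable_indicator)
  have ind_int: "integrable M (\<lambda>x. indicator B x * F x)" if "integrable M F" for F :: "'n pt \<Rightarrow> real"
  proof (rule Bochner_Integration.integrable_bound[OF that _ AE_I2])
    show "(\<lambda>x. indicator B x * F x) \<in> borel_measurable M"
      by (intro borel_measurable_times Bm borel_measurable_integrable[OF that])
  qed (simp add: indicator_def)
  \<comment> \<open>The explicit form of \<open>\<psi> j\<close> is known only off \<open>B\<close>;
    on \<open>B\<close> both integrands are bounded by \<open>H\<close>, whose integral there is
    below \<open>\<delta> / 4\<close>.\<close>
  have "(\<lambda>j. \<integral>x. (1 - indicator B x) * A j x \<partial>M) \<longlonglongrightarrow> (\<integral>x. (1 - indicator B x) * h x \<partial>M)"
  proof (rule integral_dominated_convergence[OF _ _ H_int])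
    show "(\<lambda>x. (1 - indicator B x) * h x) \<in> borel_measurable M"
      by (intro borel_measurable_times borel_measurable_diff borel_measurable_const Bm h_m)
    show "(\<lambda>x. (1 - indicator B x) * A j x) \<in> borel_measurable M" for j
      by (intro borel_measurable_times borel_measurable_diff borel_measurable_const Bm borel_measurable_integrable[OF A_int])
    show "AE x in M. norm ((1 - indicator B x) * A j x) \<le> H x" for j
      by (rule AE_I2) (simp add: indicator_def AH H0)
    show "AE x in M. (\<lambda>j. (1 - indicator B x) * A j x) \<longlonglongrightarrow> (1 - indicator B x) * h x"
      using s AE_space
    proof eventually_elim
      case (elim x)
      then have x: "x \<in> \<Omega>" by simp
      show ?case
      proof (cases "x \<in> B \<or> x \<notin> E")
        case True
        then have "(1 - indicator B x) * A j x = (1 - indicator B x) * h x" for j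
          using \<psi>(3)[of x j] by (cases "x \<in> B") (auto simp: A_def h_def)
        then show ?thesis by (simp only: tendsto_const)
      next
        case False
        \<comment> \<open>This function is even in \<open>r\<close>, so convergence of the modulus
          of the slope suffices although the sign keeps oscillating.\<close>
        define \<Phi> where "\<Phi> r = (g x (u x + r *\<^sub>R \<xi>) + g x (u x - r *\<^sub>R \<xi>)) / 2" for r
        have c: "continuous_on UNIV (g x)" using g x by (simp add: admissible_def caratheodory_def)
        have "continuous_on UNIV (\<lambda>r. g x (u x + r *\<^sub>R \<xi>))" "continuous_on UNIV (\<lambda>r. g x (u x - r *\<^sub>R \<xi>))"
          by (rule continuous_on_compose2[OF c], auto intro!: continuous_intros)+
        then have "continuous_on UNIV \<Phi>" unfolding \<Phi>_def[abs_def] by (intro continuous_intros) auto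
        then have "isCont \<Phi> 1" by (simp add: continuous_on_eq_continuous_at)
        then have lim: "(\<lambda>j. \<Phi> \<bar>s j x\<bar>) \<longlonglongrightarrow> \<Phi> 1" by (rule isCont_tendsto_compose) (rule elim(1))
        have "\<Phi> \<bar>r\<bar> = \<Phi> r" for r by (simp add: \<Phi>_def abs_if add.commute)
        moreover have "A j x = \<Phi> (s j x)" for j using \<psi>(3)[of x j] False by (simp add: A_def \<Phi>_def)
        moreover have "h x = \<Phi> 1" using False by (simp add: h_def \<Phi>_def)
        ultimately show ?thesis using lim False by simp
      qed
    qed
  qed
  then have "\<forall>\<^sub>F j in sequentially. (\<integral>x. (1 - indicator B x) * A j x \<partial>M) < (\<integral>x. (1 - indicator B x) * h x \<partial>M) + \<delta> / 4"
    using \<delta> by (intro order_tendstoD(2)) auto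
  then obtain j where j: "(\<integral>x. (1 - indicator B x) * A j x \<partial>M) < (\<integral>x. (1 - indicator B x) * h x \<partial>M) + \<delta> / 4"
    by (auto dest: eventually_happens)
  have split: "(\<integral>x. (1 - indicator B x) * F x \<partial>M) = (\<integral>x. F x \<partial>M) - (\<integral>x. indicator B x * F x \<partial>M)"
    if "integrable M F" for F :: "'n pt \<Rightarrow> real"
    using Bochner_Integration.integral_diff[OF that ind_int[OF that]] by (simp add: left_diff_distrib)
  have le: "\<bar>\<integral>x. indicator B x * F x \<partial>M\<bar> \<le> \<delta> / 4" if F: "integrable M F" "\<And>x. x \<in> \<Omega> \<Longrightarrow> \<bar>F x\<bar> \<le> H x" for F :: "'n pt \<Rightarrow> real"
  proof -
    have "\<bar>\<integral>x. indicator B x * F x \<partial>M\<bar> \<le> (\<integral>x. \<bar>indicator B x * F x\<bar> \<partial>M)" by (rule integral_abs_bound)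
    also have "\<dots> \<le> (\<integral>x. indicator B x * H x \<partial>M)"
      using F(2) by (intro integral_mono integrable_abs ind_int F(1) H_int) (auto simp: indicator_def)
    also have "\<dots> < \<delta> / 4" by (rule \<eta>(2)[OF B])
    finally show ?thesis by simp
  qed
  have "(\<integral>x. A j x \<partial>M) \<le> (\<integral>x. h x \<partial>M) + \<delta>"
    using j split[OF A_int[of j]] split[OF h_int] le[OF A_int[of j] AH] le[OF h_int hH] \<delta> by (simp add: abs_le_iff)
  moreover have "2 * (\<integral>x. A j x \<partial>M) = (\<integral>x. g x (u x + \<psi> j x) \<partial>M) + (\<integral>x. g x (u x + - \<psi> j x) \<partial>M)"
    unfolding A_def using i1 i2 by simp
  ultimately have "(\<integral>x. g x (u x + \<psi> j x) \<partial>M) \<le> (\<integral>x. h x \<partial>M) + \<delta> \<or> (\<integral>x. g x (u x + - \<psi> j x) \<partial>M) \<le> (\<integral>x. h x \<partial>M) + \<delta>"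
    by linarith
  then show ?thesis
  proof
    assume "(\<integral>x. g x (u x + \<psi> j x) \<partial>M) \<le> (\<integral>x. h x \<partial>M) + \<delta>"
    then show ?thesis
      using U_eps_add[OF u \<psi>(1)[of j]] close by (intro bexI[of _ "\<lambda>x. u x + \<psi> j x"]) (auto simp: h_def)
  next
    assume "(\<integral>x. g x (u x + - \<psi> j x) \<partial>M) \<le> (\<integral>x. h x \<partial>M) + \<delta>"
    then show ?thesis
      using U_eps_add[OF u U_eps_minus[OF \<psi>(1)[of j]]] close by (intro bexI[of _ "\<lambda>x. u x + - \<psi> j x"]) (auto simp: h_def)
  qed
qed

text \<open>A preorder on integrands: the errors in moments and energy add up, so finitely many
  laminations compose. Both \<delta> and \<open>R\<close> stay free, to be tied to \<epsilon> only
  in the recovery family.\<close>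

definition relaxes :: "real \<Rightarrow> ('n pt \<Rightarrow> 'n pt \<Rightarrow> real) \<Rightarrow> ('n pt \<Rightarrow> 'n pt \<Rightarrow> real) \<Rightarrow> bool" where
  "relaxes \<epsilon> g h \<longleftrightarrow> (\<forall>u\<in>U_eps p \<Omega> \<epsilon>. \<forall>\<delta>>0. \<forall>R\<ge>0. \<exists>v\<in>U_eps p \<Omega> \<epsilon>.
    exp_moments_le R \<delta> (\<lambda>x. v x - u x)
    \<and> (\<integral>x. g x (v x) \<partial>M) \<le> (\<integral>x. h x (u x) \<partial>M) + \<delta>)"

lemma relaxes_refl: "relaxes \<epsilon> g g"
  unfolding relaxes_def
proof (intro ballI allI impI)
  fix u :: "'n pt \<Rightarrow> 'n pt" and \<delta> R :: real assume "u \<in> U_eps p \<Omega> \<epsilon>" "0 < \<delta>"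
  then show "\<exists>v\<in>U_eps p \<Omega> \<epsilon>. exp_moments_le R \<delta> (\<lambda>x. v x - u x)
    \<and> (\<integral>x. g x (v x) \<partial>M) \<le> (\<integral>x. g x (u x) \<partial>M) + \<delta>"
    by (intro bexI[of _ u]) auto
qed

lemma relaxes_trans:
  assumes "relaxes \<epsilon> f1 f2" "relaxes \<epsilon> f2 f3" shows "relaxes \<epsilon> f1 f3"
  unfolding relaxes_def
proof (intro ballI allI impI)
  fix u :: "'n pt \<Rightarrow> 'n pt" and \<delta> R :: real assume u: "u \<in> U_eps p \<Omega> \<epsilon>" and \<delta>: "0 < \<delta>" and R: "0 \<le> R"
  obtain v where v: "v \<in> U_eps p \<Omega> \<epsilon>"
    "\<And>a b. norm a \<le> R \<Longrightarrow> b \<in> Basis \<Longrightarrow> \<bar>\<integral>x. exp (a \<bullet> x) * ((v x - u x) \<bullet> b) \<partial>M\<bar> \<le> \<delta> / 2"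
    "(\<integral>x. f2 x (v x) \<partial>M) \<le> (\<integral>x. f3 x (u x) \<partial>M) + \<delta> / 2"
    using assms(2)[unfolded relaxes_def, rule_format, OF u, of "\<delta> / 2" R] \<delta> R by auto
  obtain w where w: "w \<in> U_eps p \<Omega> \<epsilon>"
    "\<And>a b. norm a \<le> R \<Longrightarrow> b \<in> Basis \<Longrightarrow> \<bar>\<integral>x. exp (a \<bullet> x) * ((w x - v x) \<bullet> b) \<partial>M\<bar> \<le> \<delta> / 2"
    "(\<integral>x. f1 x (w x) \<partial>M) \<le> (\<integral>x. f2 x (v x) \<partial>M) + \<delta> / 2"
    using assms(1)[unfolded relaxes_def, rule_format, OF v(1), of "\<delta> / 2" R] \<delta> R by auto
  have L: "u \<in> Lp p \<Omega>" "v \<in> Lp p \<Omega>" "w \<in> Lp p \<Omega>" using u v(1) w(1) by (auto simp: U_eps_iff)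
  have "\<bar>\<integral>x. exp (a \<bullet> x) * ((w x - u x) \<bullet> b) \<partial>M\<bar> \<le> \<delta>" if "norm a \<le> R" "b \<in> Basis" for a b
  proof -
    have "(\<integral>x. exp (a \<bullet> x) * ((w x - v x) \<bullet> b) + exp (a \<bullet> x) * ((v x - u x) \<bullet> b) \<partial>M)
        = (\<integral>x. exp (a \<bullet> x) * ((w x - v x) \<bullet> b) \<partial>M) + (\<integral>x. exp (a \<bullet> x) * ((v x - u x) \<bullet> b) \<partial>M)"
      by (intro Bochner_Integration.integral_add integrable_exp_inner boundedO Lp_diff L)
    also have "(\<lambda>x. exp (a \<bullet> x) * ((w x - v x) \<bullet> b) + exp (a \<bullet> x) * ((v x - u x) \<bullet> b)) = (\<lambda>x. exp (a \<bullet> x) * ((w x - u x) \<bullet> b))"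
      by (simp add: fun_eq_iff inner_diff_left algebra_simps)
    finally show ?thesis using v(2)[OF that] w(2)[OF that] by linarith
  qed
  moreover have "(\<integral>x. f1 x (w x) \<partial>M) \<le> (\<integral>x. f3 x (u x) \<partial>M) + \<delta>" using v(3) w(3) by linarith
  ultimately show "\<exists>v\<in>U_eps p \<Omega> \<epsilon>. exp_moments_le R \<delta> (\<lambda>x. v x - u x)
    \<and> (\<integral>x. f1 x (v x) \<partial>M) \<le> (\<integral>x. f3 x (u x) \<partial>M) + \<delta>"
    using w(1) by blast
qed

text \<open>Laminate exactly where mixing lowers the energy at the given \<open>u\<close>. This set
  is only measurable, which is why the laminates had to be localised to such sets.\<close>

lemma relaxes_midpoint_min:
  assumes g: "admissible C g" and \<epsilon>: "0 < \<epsilon>" shows "relaxes \<epsilon> g (midpoint_min \<xi> g)"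
  unfolding relaxes_def
proof (intro ballI allI impI)
  fix u :: "'n pt \<Rightarrow> 'n pt" and \<delta> R :: real assume u: "u \<in> U_eps p \<Omega> \<epsilon>" and \<delta>: "0 < \<delta>" and R: "0 \<le> R"
  have uL: "u \<in> Lp p \<Omega>" using u by (simp add: U_eps_iff)
  have gm: "(\<lambda>x. g x (u x + w)) \<in> borel_measurable M" for w
    using g caratheodory_measurable[OF _ borel_measurable_add[OF LpD(1)[OF uL] borel_measurable_const]] by (auto simp: admissible_def)
  define E where "E = {x \<in> space M. (g x (u x + \<xi>) + g x (u x - \<xi>)) / 2 < g x (u x)}"
  have "E \<in> sets M" unfolding E_def
    using gm[of \<xi>] gm[of "- \<xi>"] gm[of 0] by (intro borel_measurable_less borel_measurable_divide borel_measurable_add borel_measurable_const) simp_all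
  then have E: "E \<in> sets lebesgue" "E \<subseteq> \<Omega>" using sets_Omega by (auto simp: sets_restrict_space_iff)
  have "(\<integral>x. (if x \<in> E then (g x (u x + \<xi>) + g x (u x - \<xi>)) / 2 else g x (u x)) \<partial>M) = (\<integral>x. midpoint_min \<xi> g x (u x) \<partial>M)"
    by (rule Bochner_Integration.integral_cong[OF refl]) (auto simp: E_def midpoint_min_def)
  then show "\<exists>v\<in>U_eps p \<Omega> \<epsilon>. exp_moments_le R \<delta> (\<lambda>x. v x - u x)
    \<and> (\<integral>x. g x (v x) \<partial>M) \<le> (\<integral>x. midpoint_min \<xi> g x (u x) \<partial>M) + \<delta>"
    using lamination[OF g \<epsilon> u E \<delta> R, of \<xi>] by simp
qed

lemma relaxes_G: "0 < \<epsilon> \<Longrightarrow> relaxes \<epsilon> f (G n)"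
  by (induction n) (auto intro: relaxes_refl relaxes_trans relaxes_midpoint_min admissible_G)

text \<open>For a given \<open>u\<close> finitely many laminations suffice, because the energies of
  the iterates converge; their number may depend on \<open>u\<close>.\<close>

lemma relaxes_env:
  assumes \<epsilon>: "0 < \<epsilon>" shows "relaxes \<epsilon> f env"
  unfolding relaxes_def
proof (intro ballI allI impI)
  fix u :: "'n pt \<Rightarrow> 'n pt" and \<delta> R :: real assume u: "u \<in> U_eps p \<Omega> \<epsilon>" and \<delta>: "0 < \<delta>" and R: "0 \<le> R"
  have uL: "u \<in> Lp p \<Omega>" using u by (simp add: U_eps_iff)
  have "\<forall>\<^sub>F n in sequentially. (\<integral>x. G n x (u x) \<partial>M) < (\<integral>x. env x (u x) \<partial>M) + \<delta> / 2"
    using integral_G_tendsto[OF uL] \<delta> by (intro order_tendstoD(2)) auto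
  then obtain n where n: "(\<integral>x. G n x (u x) \<partial>M) < (\<integral>x. env x (u x) \<partial>M) + \<delta> / 2" by (auto dest: eventually_happens)
  obtain v where v: "v \<in> U_eps p \<Omega> \<epsilon>"
    "\<And>a b. norm a \<le> R \<Longrightarrow> b \<in> Basis \<Longrightarrow> \<bar>\<integral>x. exp (a \<bullet> x) * ((v x - u x) \<bullet> b) \<partial>M\<bar> \<le> \<delta> / 2"
    "(\<integral>x. f x (v x) \<partial>M) \<le> (\<integral>x. G n x (u x) \<partial>M) + \<delta> / 2"
    using relaxes_G[OF \<epsilon>, of n, unfolded relaxes_def, rule_format, OF u, of "\<delta> / 2" R] \<delta> R by auto
  have "\<bar>\<integral>x. exp (a \<bullet> x) * ((v x - u x) \<bullet> b) \<partial>M\<bar> \<le> \<delta>" if "norm a \<le> R" "b \<in> Basis" for a b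
    using v(2)[OF that] \<delta> by linarith
  moreover have "(\<integral>x. f x (v x) \<partial>M) \<le> (\<integral>x. env x (u x) \<partial>M) + \<delta>" using n v(3) by linarith
  ultimately show "\<exists>v\<in>U_eps p \<Omega> \<epsilon>. exp_moments_le R \<delta> (\<lambda>x. v x - u x)
    \<and> (\<integral>x. f x (v x) \<partial>M) \<le> (\<integral>x. env x (u x) \<partial>M) + \<delta>"
    using v(1) by blast
qed

end

subsection \<open>Strong approximation of fields in \<open>U_zero\<close>\<close>

lemma sum_powr_le:
  fixes t :: "'i \<Rightarrow> real"
  assumes "finite I" "\<And>i. i \<in> I \<Longrightarrow> 0 \<le> t i" "0 < p"
  shows "(\<Sum>i\<in>I. t i) powr p \<le> real (card I) powr p * (\<Sum>i\<in>I. t i powr p)"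
proof (cases "I = {}")
  case False
  define m where "m = Max (t ` I)"
  have m: "\<And>i. i \<in> I \<Longrightarrow> t i \<le> m" using assms(1) by (simp add: m_def)
  have "m \<in> t ` I" unfolding m_def using assms(1) False by (intro Max_in) auto
  then obtain i0 where i0: "i0 \<in> I" "m = t i0" by auto
  have "(\<Sum>i\<in>I. t i) \<le> real (card I) * m" using sum_bounded_above[of I t m] m by simp
  then have "(\<Sum>i\<in>I. t i) powr p \<le> (real (card I) * m) powr p"
    using assms by (intro powr_mono2 sum_nonneg) auto
  also have "\<dots> = real (card I) powr p * t i0 powr p" using i0 assms(2) by (simp add: powr_mult)
  also have "\<dots> \<le> real (card I) powr p * (\<Sum>i\<in>I. t i powr p)"
    using assms(1) i0(1) by (intro mult_left_mono member_le_sum) auto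
  finally show ?thesis .
qed (use assms in simp)

context cylinder
begin

lemma U_eps_sum:
  assumes "finite I" "\<And>i. i \<in> I \<Longrightarrow> F i \<in> U_eps p \<Omega> \<epsilon>"
  shows "(\<lambda>x. \<Sum>i\<in>I. F i x) \<in> U_eps p \<Omega> \<epsilon>"
  using assms by (induction I rule: finite_induct) (simp_all add: U_eps_zero U_eps_add)

text \<open>The rescaled divergence of this field is a multiple of the vertical derivative that
  vanishes by assumption. The component \<open>u^N\<close> can therefore be kept, and only
  horizontal components need correction.\<close>

lemma vertical_in_U_eps:
  assumes "u \<in> U_zero p \<Omega>" shows "(\<lambda>x. (0, snd (u x))) \<in> U_eps p \<Omega> \<epsilon>"
proof -
  have "linear (\<lambda>v :: 'n pt. (0 :: real ^ 'n, snd v))" by (auto intro!: linearI)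
  from Lp_linear[OF this] have "(\<lambda>x. (0 :: real ^ 'n, snd (u x))) \<in> Lp p \<Omega>" using assms by (simp add: U_zero_iff)
  moreover have "(\<integral>x. dd \<theta> x (Teps \<epsilon> (0, snd (u x))) \<partial>M) = 0" if "\<theta> \<in> test_fun \<Omega>" for \<theta>
  proof -
    have "dd \<theta> x (Teps \<epsilon> (0, snd (u x))) = (1 / \<epsilon>) * dd \<theta> x (0, snd (u x))" for x
      using linear_cmul[OF linear_dd[OF test_fun_C1[OF that]], of x "1 / \<epsilon>" "(0, snd (u x))"] by (simp add: Teps_def)
    then show ?thesis using assms that by (simp add: U_zero_iff)
  qed
  ultimately show ?thesis by (simp add: U_eps_iff)
qed

text \<open>The vertical component \<open>- \<epsilon> * W\<close> compensates the divergence of the horizontal field \<open>w\<close>;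
  \<open>W\<close> comes from a primitive of \<open>w\<close> in the vertical direction, which is explicit for exponentials.\<close>

lemma expsum_correction:
  assumes "expsum (w :: 'n pt \<Rightarrow> real)"
  shows "\<exists>W. continuous_on UNIV W \<and> (\<forall>\<epsilon>>0. (\<lambda>x. (w x *\<^sub>R axis \<alpha> 1, - \<epsilon> * W x)) \<in> U_eps p \<Omega> \<epsilon>)"
  using assms
proof (induction rule: expsum.induct)
  case (base c a)
  have from_potential: "\<exists>W. continuous_on UNIV W \<and> (\<forall>\<epsilon>>0. (\<lambda>x. ((c * exp (a \<bullet> x)) *\<^sub>R axis \<alpha> 1, - \<epsilon> * W x)) \<in> U_eps p \<Omega> \<epsilon>)"
    if P: "C1 P" and dP: "\<And>x. dd P x (0, 1) = c * exp (a \<bullet> x)" for P :: "'n pt \<Rightarrow> real"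
  proof (intro exI[of _ "\<lambda>x. dd P x (axis \<alpha> 1, 0)"] conjI allI impI)
    show "continuous_on UNIV (\<lambda>x. dd P x (axis \<alpha> 1, 0))" by (rule C1_continuous_dd[OF P])
    fix \<epsilon> :: real assume "0 < \<epsilon>"
    from potential_in_U_eps[OF P this, of "(0, 1)" "(axis \<alpha> 1, 0)"]
    show "(\<lambda>x. ((c * exp (a \<bullet> x)) *\<^sub>R axis \<alpha> 1, - \<epsilon> * dd P x (axis \<alpha> 1, 0))) \<in> U_eps p \<Omega> \<epsilon>"
      by (simp add: Tinv_def dP)
  qed
  have e: "C1 (\<lambda>x. exp (a \<bullet> x))" by (rule C1_compose_real[OF C1_inner DERIV_exp]) (auto intro!: continuous_intros)
  have de: "dd (\<lambda>x. exp (a \<bullet> x)) x v = exp (a \<bullet> x) * (a \<bullet> v)" for x v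
    by (rule dd_eqI) (auto intro!: derivative_eq_intros)
  have dc: "dd (\<lambda>x. c) x v = 0" for c x and v :: "'n pt" by (rule dd_eqI) simp
  show ?case
  \<comment> \<open>An exponential that varies vertically is its own primitive up to the factor
    \<open>1 / snd a\<close>; otherwise it is constant in the vertical variable and the primitive is
    that variable times it.\<close>
  proof (cases "snd a = 0")
    case False
    have "C1 (\<lambda>x. (c / snd a) * exp (a \<bullet> x))" by (intro C1_mult C1_const e)
    moreover have "dd (\<lambda>x. (c / snd a) * exp (a \<bullet> x)) x (0, 1) = c * exp (a \<bullet> x)" for x
      unfolding dd_mult[OF C1_const e] dc de using False by (simp add: inner_prod_def)
    ultimately show ?thesis by (rule from_potential)
  next
    case True
    define d where "d = ((0, c) :: 'n pt)"
    have "C1 (\<lambda>x. (d \<bullet> x) * exp (a \<bullet> x))" by (intro C1_mult C1_inner e)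
    moreover have "dd (\<lambda>x. (d \<bullet> x) * exp (a \<bullet> x)) x (0, 1) = c * exp (a \<bullet> x)" for x
    proof -
      have dd_d: "dd (\<lambda>x. d \<bullet> x) x v = d \<bullet> v" for v by (rule dd_eqI) (auto intro!: derivative_eq_intros)
      then show ?thesis unfolding dd_mult[OF C1_inner e] de dd_d using True by (simp add: inner_prod_def d_def)
    qed
    ultimately show ?thesis by (rule from_potential)
  qed
next
  case (add w1 w2)
  obtain W1 where W1: "continuous_on UNIV W1" "\<And>\<epsilon>. 0 < \<epsilon> \<Longrightarrow> (\<lambda>x. (w1 x *\<^sub>R axis \<alpha> 1, - \<epsilon> * W1 x)) \<in> U_eps p \<Omega> \<epsilon>"
    using add.IH(1) by blast
  obtain W2 where W2: "continuous_on UNIV W2" "\<And>\<epsilon>. 0 < \<epsilon> \<Longrightarrow> (\<lambda>x. (w2 x *\<^sub>R axis \<alpha> 1, - \<epsilon> * W2 x)) \<in> U_eps p \<Omega> \<epsilon>"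
    using add.IH(2) by blast
  have "(\<lambda>x. ((w1 x + w2 x) *\<^sub>R axis \<alpha> 1, - \<epsilon> * (W1 x + W2 x))) \<in> U_eps p \<Omega> \<epsilon>" if "0 < \<epsilon>" for \<epsilon>
    using U_eps_add[OF W1(2)[OF that] W2(2)[OF that]] by (simp add: algebra_simps)
  moreover have "continuous_on UNIV (\<lambda>x. W1 x + W2 x)" by (intro continuous_on_add W1(1) W2(1))
  ultimately show ?case by blast
qed

text \<open>The horizontal components are replaced by exponential sums first. The correction
  \<open>V\<close> is then a fixed bounded function, and its contribution
  \<open>\<epsilon> * V\<close> disappears as \<epsilon> tends to 0.\<close>

lemma U_zero_approx:
  assumes u: "u \<in> U_zero p \<Omega>" and \<delta>: "0 < \<delta>"
  shows "\<exists>\<epsilon>0>0. \<forall>\<epsilon>. 0 < \<epsilon> \<and> \<epsilon> < \<epsilon>0 \<longrightarrow> (\<exists>w\<in>U_eps p \<Omega> \<epsilon>. (\<integral>x. norm (w x - u x) powr p \<partial>M) < \<delta>)"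
proof -
  have uL: "u \<in> Lp p \<Omega>" using u by (simp add: U_zero_iff)
  define n where "n = real CARD('n)"
  have n: "0 < n" by (simp add: n_def)
  \<comment> \<open>Collects \<open>2 powr p\<close> from splitting horizontal and vertical errors,
    \<open>n powr p\<close> from the sum over components, and \<open>n\<close> for the number of
    component errors.\<close>
  define c where "c = 2 powr p * n powr p * n"
  have c: "0 < c" using n by (simp add: c_def)
  have "linear (\<lambda>v :: 'n pt. fst v $ \<alpha>)" for \<alpha> by (auto intro!: linearI)
  then have comp: "(\<lambda>x. fst (u x) $ \<alpha>) \<in> Lp p \<Omega>" for \<alpha> using Lp_linear uL by blast
  have "\<exists>w. expsum w \<and> (\<integral>x. norm (fst (u x) $ \<alpha> - w x) powr p \<partial>M) < \<delta> / (2 * c)" for \<alpha>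
  proof -
    have "0 < \<delta> / (2 * c)" using \<delta> c by simp
    then show ?thesis by (rule expsum_dense[OF comp boundedO]) blast
  qed
  then have "\<exists>w. \<forall>\<alpha>. expsum (w \<alpha>) \<and> (\<integral>x. norm (fst (u x) $ \<alpha> - w \<alpha> x) powr p \<partial>M) < \<delta> / (2 * c)"
    by (intro choice allI)
  then obtain w where w: "\<And>\<alpha>. expsum (w \<alpha>)" "\<And>\<alpha>. (\<integral>x. norm (fst (u x) $ \<alpha> - w \<alpha> x) powr p \<partial>M) < \<delta> / (2 * c)"
    by blast
  have "\<exists>W. \<forall>\<alpha>. continuous_on UNIV (W \<alpha>) \<and> (\<forall>\<epsilon>>0. (\<lambda>x. (w \<alpha> x *\<^sub>R axis \<alpha> 1, - \<epsilon> * W \<alpha> x)) \<in> U_eps p \<Omega> \<epsilon>)"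
    by (intro choice allI expsum_correction w(1))
  then obtain W where W: "\<And>\<alpha>. continuous_on UNIV (W \<alpha>)"
    "\<And>\<alpha> \<epsilon>. 0 < \<epsilon> \<Longrightarrow> (\<lambda>x. (w \<alpha> x *\<^sub>R axis \<alpha> 1, - \<epsilon> * W \<alpha> x)) \<in> U_eps p \<Omega> \<epsilon>"
    by blast
  define V where "V x = (\<Sum>\<alpha>\<in>UNIV. W \<alpha> x)" for x
  have Vc: "continuous_on UNIV V" unfolding V_def[abs_def] by (intro continuous_on_sum W(1))
  obtain K where K: "\<And>x. x \<in> \<Omega> \<Longrightarrow> norm (V x) \<le> K" using continuous_bounded_on[OF Vc boundedO] by blast
  have VL: "V \<in> Lp p \<Omega>" by (rule Lp_bounded[OF measurable_continuous[OF Vc] K])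
  define I where "I = (\<integral>x. norm (V x) powr p \<partial>M)"
  have I: "0 \<le> I" by (simp add: I_def)
  \<comment> \<open>Makes the vertical error \<open>2 powr p * \<epsilon> powr p * I\<close> smaller
    than \<open>\<delta> / 2\<close>.\<close>
  define \<epsilon>0 where "\<epsilon>0 = (\<delta> / (2 * 2 powr p * (I + 1))) powr (1 / p)"
  have \<epsilon>0: "0 < \<epsilon>0" "\<epsilon>0 powr p = \<delta> / (2 * 2 powr p * (I + 1))" using \<delta> I p_pos by (auto simp: \<epsilon>0_def powr_powr)
  have dL: "(\<lambda>x. fst (u x) $ \<alpha> - w \<alpha> x) \<in> Lp p \<Omega>" for \<alpha> by (rule Lp_diff[OF comp expsum_in_Lp[OF boundedO w(1)]])
  have "\<exists>v\<in>U_eps p \<Omega> \<epsilon>. (\<integral>x. norm (v x - u x) powr p \<partial>M) < \<delta>" if \<epsilon>: "0 < \<epsilon>" "\<epsilon> < \<epsilon>0" for \<epsilon>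
  proof -
    define v :: "'n pt \<Rightarrow> 'n pt" where "v x = (\<Sum>\<alpha>\<in>UNIV. (w \<alpha> x *\<^sub>R axis \<alpha> 1, - \<epsilon> * W \<alpha> x)) + (0, snd (u x))" for x
    have v: "v \<in> U_eps p \<Omega> \<epsilon>"
      unfolding v_def by (intro U_eps_add U_eps_sum W(2) \<epsilon>(1) vertical_in_U_eps[OF u] finite)
    have vL: "v \<in> Lp p \<Omega>" using v by (simp add: U_eps_iff)
    have v_alt: "v x - u x = ((\<Sum>\<alpha>\<in>UNIV. (w \<alpha> x - fst (u x) $ \<alpha>) *\<^sub>R axis \<alpha> 1), - \<epsilon> * V x)" for x
    proof -
      have "(\<Sum>\<alpha>\<in>UNIV. (fst (u x) $ \<alpha>) *\<^sub>R axis \<alpha> (1::real)) = fst (u x)"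
        using basis_expansion[of "fst (u x)"] by (simp add: scalar_mult_eq_scaleR)
      then show ?thesis
        by (simp add: v_def V_def prod_eq_iff fst_sum snd_sum scaleR_left_diff_distrib sum_subtractf sum_negf sum_distrib_left)
    qed
    have pw: "norm (v x - u x) powr p \<le> 2 powr p * (n powr p * (\<Sum>\<alpha>\<in>UNIV. norm (fst (u x) $ \<alpha> - w \<alpha> x) powr p) + \<epsilon> powr p * norm (V x) powr p)" for x
    proof -
      let ?S = "\<Sum>\<alpha>\<in>UNIV. (w \<alpha> x - fst (u x) $ \<alpha>) *\<^sub>R axis \<alpha> (1::real)"
      have "norm ?S \<le> (\<Sum>\<alpha>\<in>UNIV. norm (fst (u x) $ \<alpha> - w \<alpha> x))"
        by (rule order_trans[OF norm_sum]) (simp add: abs_minus_commute)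
      then have "norm ?S powr p \<le> (\<Sum>\<alpha>\<in>UNIV. norm (fst (u x) $ \<alpha> - w \<alpha> x)) powr p"
        using p_pos by (intro powr_mono2) auto
      also have "\<dots> \<le> n powr p * (\<Sum>\<alpha>\<in>UNIV. norm (fst (u x) $ \<alpha> - w \<alpha> x) powr p)"
        unfolding n_def using p_pos by (intro sum_powr_le) auto
      finally have S: "norm ?S powr p \<le> n powr p * (\<Sum>\<alpha>\<in>UNIV. norm (fst (u x) $ \<alpha> - w \<alpha> x) powr p)" .
      have "norm (v x - u x) = norm ((?S, 0) + (0, - \<epsilon> * V x))" unfolding v_alt by simp
      then have "norm (v x - u x) powr p \<le> 2 powr p * (norm (?S, 0::real) powr p + norm (0 :: real ^ 'n, - \<epsilon> * V x) powr p)"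
        using norm_add_powr_le[OF p_pos, of "(?S, 0)" "(0, - \<epsilon> * V x)"] by simp
      also have "norm (?S, 0::real) = norm ?S" by (simp add: norm_Pair)
      also have "norm (0 :: real ^ 'n, - \<epsilon> * V x) powr p = \<epsilon> powr p * norm (V x) powr p"
        using \<epsilon>(1) by (simp add: norm_Pair abs_mult powr_mult)
      finally show ?thesis using S by (smt (verit) mult_left_mono powr_ge_zero)
    qed
    note [simp] = LpD(2)[OF dL] LpD(2)[OF VL] LpD(2)[OF Lp_diff[OF vL uL]]
    have "(\<integral>x. norm (v x - u x) powr p \<partial>M) \<le>
        (\<integral>x. 2 powr p * (n powr p * (\<Sum>\<alpha>\<in>UNIV. norm (fst (u x) $ \<alpha> - w \<alpha> x) powr p) + \<epsilon> powr p * norm (V x) powr p) \<partial>M)"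
      using LpD(2)[OF dL] LpD(2)[OF VL] by (intro integral_mono pw) (auto simp del: real_norm_def)
    also have "\<dots> = 2 powr p * (n powr p * (\<Sum>\<alpha>\<in>UNIV. \<integral>x. norm (fst (u x) $ \<alpha> - w \<alpha> x) powr p \<partial>M) + \<epsilon> powr p * I)"
      using LpD(2)[OF dL] LpD(2)[OF VL] by (simp add: I_def del: real_norm_def)
    also have "\<dots> < \<delta> / 2 + \<delta> / 2"
    proof -
      have "(\<Sum>\<alpha>\<in>UNIV. \<integral>x. norm (fst (u x) $ \<alpha> - w \<alpha> x) powr p \<partial>M) \<le> n * (\<delta> / (2 * c))"
        unfolding n_def using w(2) by (intro sum_bounded_above) (auto intro: less_imp_le)
      then have "2 powr p * n powr p * (\<Sum>\<alpha>\<in>UNIV. \<integral>x. norm (fst (u x) $ \<alpha> - w \<alpha> x) powr p \<partial>M) \<le> 2 powr p * n powr p * (n * (\<delta> / (2 * c)))"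
        by (intro mult_left_mono) auto
      also have "\<dots> = c * (\<delta> / (2 * c))" by (simp add: c_def)
      also have "\<dots> = \<delta> / 2" using c by simp
      finally have 1: "2 powr p * n powr p * (\<Sum>\<alpha>\<in>UNIV. \<integral>x. norm (fst (u x) $ \<alpha> - w \<alpha> x) powr p \<partial>M) \<le> \<delta> / 2" .
      have "2 powr p * (\<epsilon> powr p * I) \<le> 2 powr p * (\<epsilon>0 powr p * I)"
        using \<epsilon> p_pos I by (intro mult_left_mono mult_right_mono powr_mono2) auto
      also have "\<dots> = (\<delta> / 2) * (I / (I + 1))" unfolding \<epsilon>0(2) by simp
      also have "\<dots> < \<delta> / 2" using I \<delta> by (simp add: field_simps)
      finally have 2: "2 powr p * (\<epsilon> powr p * I) < \<delta> / 2" .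
      show ?thesis using 1 2 by (simp add: distrib_left mult.assoc)
    qed
    finally show ?thesis by (intro bexI[OF _ v]) simp
  qed
  then show ?thesis using \<epsilon>0(1) by blast
qed

text \<open>Near-minimisers of the distance from \<open>u\<close> to \<open>U_eps\<close> replace a
  diagonal sequence: the infimum tends to 0 by \<open>U_zero_approx\<close>, and the slack
  \<epsilon> does so too.\<close>

lemma strong_recovery:
  assumes u: "u \<in> U_zero p \<Omega>"
  obtains v where "\<And>\<epsilon>. 0 < \<epsilon> \<Longrightarrow> v \<epsilon> \<in> U_eps p \<Omega> \<epsilon>"
    "((\<lambda>\<epsilon>. \<integral>x. norm (v \<epsilon> x - u x) powr p \<partial>M) \<longlongrightarrow> 0) (at_right 0)"
proof -
  define d where "d \<epsilon> = Inf ((\<lambda>w. \<integral>x. norm (w x - u x) powr p \<partial>M) ` U_eps p \<Omega> \<epsilon>)" for \<epsilon>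
  have bdd: "bdd_below ((\<lambda>w. \<integral>x. norm (w x - u x) powr p \<partial>M) ` U_eps p \<Omega> \<epsilon>)" for \<epsilon>
    by (rule bdd_belowI2[of _ 0]) simp
  have "\<exists>w\<in>U_eps p \<Omega> \<epsilon>. (\<integral>x. norm (w x - u x) powr p \<partial>M) < d \<epsilon> + \<epsilon>" if "0 < \<epsilon>" for \<epsilon>
    using cInf_lessD[of "(\<lambda>w. \<integral>x. norm (w x - u x) powr p \<partial>M) ` U_eps p \<Omega> \<epsilon>" "d \<epsilon> + \<epsilon>"] U_eps_zero[of \<epsilon>] that
    by (auto simp: d_def)
  then have "\<forall>\<epsilon>. \<exists>w. 0 < \<epsilon> \<longrightarrow> w \<in> U_eps p \<Omega> \<epsilon> \<and> (\<integral>x. norm (w x - u x) powr p \<partial>M) < d \<epsilon> + \<epsilon>" by blast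
  from choice[OF this] obtain v where v: "\<And>\<epsilon>. 0 < \<epsilon> \<Longrightarrow> v \<epsilon> \<in> U_eps p \<Omega> \<epsilon>"
    "\<And>\<epsilon>. 0 < \<epsilon> \<Longrightarrow> (\<integral>x. norm (v \<epsilon> x - u x) powr p \<partial>M) < d \<epsilon> + \<epsilon>" by blast
  have "((\<lambda>\<epsilon>. \<integral>x. norm (v \<epsilon> x - u x) powr p \<partial>M) \<longlongrightarrow> 0) (at_right 0)"
  proof (rule tendstoI)
    fix e :: real assume "0 < e"
    then obtain \<epsilon>0 where \<epsilon>0: "0 < \<epsilon>0" "\<And>\<epsilon>. 0 < \<epsilon> \<Longrightarrow> \<epsilon> < \<epsilon>0 \<Longrightarrow> \<exists>w\<in>U_eps p \<Omega> \<epsilon>. (\<integral>x. norm (w x - u x) powr p \<partial>M) < e / 2"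
      using U_zero_approx[OF u, of "e / 2"] by auto
    have "\<forall>\<^sub>F \<epsilon> in at_right 0. 0 < \<epsilon> \<and> \<epsilon> < min \<epsilon>0 (e / 2)"
      using \<open>0 < e\<close> \<epsilon>0(1) eventually_at_right_real[of 0 "min \<epsilon>0 (e / 2)"] by (auto elim: eventually_mono)
    then show "\<forall>\<^sub>F \<epsilon> in at_right 0. dist (\<integral>x. norm (v \<epsilon> x - u x) powr p \<partial>M) 0 < e"
    proof eventually_elim
      case (elim \<epsilon>)
      then obtain w where w: "w \<in> U_eps p \<Omega> \<epsilon>" "(\<integral>x. norm (w x - u x) powr p \<partial>M) < e / 2" using \<epsilon>0(2)[of \<epsilon>] by auto
      have "d \<epsilon> \<le> (\<integral>x. norm (w x - u x) powr p \<partial>M)" unfolding d_def using w(1) by (intro cInf_lower bdd) auto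
      then show ?case using v(2)[of \<epsilon>] w(2) elim by simp
    qed
  qed
  then show thesis using that v(1) by blast
qed

text \<open>The constraint passes to the limit: multiply it by \<open>\<epsilon>\<close>.\<close>

lemma U_zero_closed:
  assumes u: "u \<in> Lp p \<Omega>" and v: "\<And>\<epsilon>. 0 < \<epsilon> \<Longrightarrow> v \<epsilon> \<in> Lp p \<Omega>" and weak: "Lp_weak_tendsto p \<Omega> v u (at_right 0)"
    and freq: "\<exists>\<^sub>F \<epsilon> in at_right 0. v \<epsilon> \<in> U_eps p \<Omega> \<epsilon>"
  shows "u \<in> U_zero p \<Omega>"
  unfolding U_zero_iff
proof (intro conjI u ballI)
  fix \<theta> assume th: "\<theta> \<in> test_fun \<Omega>"
  then have \<theta>: "C1 \<theta>" by (rule test_fun_C1)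
  obtain K where K: "0 < K" "\<And>x. x \<in> \<Omega> \<Longrightarrow> norm (grad \<theta> x) \<le> K" using grad_bounded[OF \<theta>] by blast
  \<comment> \<open>The two coordinate projections are self-adjoint and do not increase norms, so
    each pairing is integration against a bounded field and weak convergence applies to it
    separately.\<close>
  have conv: "((\<lambda>\<epsilon>. \<integral>x. dd \<theta> x (T (v \<epsilon> x)) \<partial>M) \<longlongrightarrow> (\<integral>x. dd \<theta> x (T (u x)) \<partial>M)) (at_right 0)"
    if T: "\<And>g w. g \<bullet> T w = T g \<bullet> w" "\<And>g. norm (T g) \<le> norm g" "linear T" for T :: "'n pt \<Rightarrow> 'n pt"
  proof -
    have eq: "dd \<theta> x (T w) = T (grad \<theta> x) \<bullet> w" for x w unfolding dd_eq_grad[OF \<theta>] T(1) ..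
    have "T \<in> borel_measurable borel"
      using T(3) linear_continuous_on linear_conv_bounded_linear borel_measurable_continuous_onI by blast
    then have m: "(\<lambda>x. T (grad \<theta> x)) \<in> borel_measurable M"
      by (rule measurable_compose[OF grad_measurable[OF \<theta>]])
    have "(\<lambda>w. \<integral>x. T (grad \<theta> x) \<bullet> w x \<partial>M) \<in> Lp_dual p \<Omega>"
      by (rule inner_in_Lp_dual[OF m order_trans[OF T(2) K(2)]]) (use K(1) in simp_all)
    from bspec[OF weak[unfolded Lp_weak_tendsto_def] this] show ?thesis unfolding eq .
  qed
  have H: "((\<lambda>\<epsilon>. \<integral>x. dd \<theta> x (fst (v \<epsilon> x), 0) \<partial>M) \<longlongrightarrow> (\<integral>x. dd \<theta> x (fst (u x), 0) \<partial>M)) (at_right 0)"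
    by (rule conv[of "\<lambda>w. (fst w, 0)"]) (auto simp: inner_prod_def norm_Pair norm_prod_def real_le_rsqrt intro!: linearI real_sqrt_le_mono)
  have V: "((\<lambda>\<epsilon>. \<integral>x. dd \<theta> x (0, snd (v \<epsilon> x)) \<partial>M) \<longlongrightarrow> (\<integral>x. dd \<theta> x (0, snd (u x)) \<partial>M)) (at_right 0)"
    by (rule conv[of "\<lambda>w. (0, snd w)"]) (auto simp: inner_prod_def norm_Pair norm_prod_def real_le_rsqrt intro!: linearI real_sqrt_le_mono)
  define Q where "Q \<epsilon> = \<epsilon> * (\<integral>x. dd \<theta> x (fst (v \<epsilon> x), 0) \<partial>M) + (\<integral>x. dd \<theta> x (0, snd (v \<epsilon> x)) \<partial>M)" for \<epsilon>
  have "(Q \<longlongrightarrow> 0 * (\<integral>x. dd \<theta> x (fst (u x), 0) \<partial>M) + (\<integral>x. dd \<theta> x (0, snd (u x)) \<partial>M)) (at_right 0)"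
    unfolding Q_def[abs_def] by (intro tendsto_add tendsto_mult H V tendsto_ident_at)
  then have lim: "(Q \<longlongrightarrow> (\<integral>x. dd \<theta> x (0, snd (u x)) \<partial>M)) (at_right 0)" by simp
  have zero: "Q \<epsilon> = 0" if \<epsilon>: "0 < \<epsilon>" and vU: "v \<epsilon> \<in> U_eps p \<Omega> \<epsilon>" for \<epsilon>
  proof -
    have lin: "linear (\<lambda>w :: 'n pt. (fst w, 0 :: real))" "linear (\<lambda>w :: 'n pt. (0 :: real ^ 'n, snd w))" by (auto intro!: linearI)
    have i: "integrable M (\<lambda>x. dd \<theta> x (fst (v \<epsilon> x), 0))" "integrable M (\<lambda>x. dd \<theta> x (0, snd (v \<epsilon> x)))"
      using integrable_dd[OF \<theta> Lp_linear[OF lin(1) v[OF \<epsilon>]]] integrable_dd[OF \<theta> Lp_linear[OF lin(2) v[OF \<epsilon>]]] by auto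
    have "dd \<theta> x (Teps \<epsilon> w) = dd \<theta> x (fst w, 0) + (1 / \<epsilon>) * dd \<theta> x (0, snd w)" for x w
    proof -
      have "Teps \<epsilon> w = (fst w, 0) + (1 / \<epsilon>) *\<^sub>R (0, snd w)" by (simp add: Teps_def)
      then show ?thesis by (simp only: linear_add[OF linear_dd[OF \<theta>]] linear_cmul[OF linear_dd[OF \<theta>]] real_scaleR_def)
    qed
    then have "(\<integral>x. dd \<theta> x (Teps \<epsilon> (v \<epsilon> x)) \<partial>M) = (\<integral>x. dd \<theta> x (fst (v \<epsilon> x), 0) \<partial>M) + (1 / \<epsilon>) * (\<integral>x. dd \<theta> x (0, snd (v \<epsilon> x)) \<partial>M)"
      using i by simp
    then have "(\<integral>x. dd \<theta> x (fst (v \<epsilon> x), 0) \<partial>M) + (1 / \<epsilon>) * (\<integral>x. dd \<theta> x (0, snd (v \<epsilon> x)) \<partial>M) = 0"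
      using vU th by (simp add: U_eps_iff)
    then show ?thesis using \<epsilon> by (simp add: Q_def field_simps)
  qed
  show "(\<integral>x. dd \<theta> x (0, snd (u x)) \<partial>M) = 0"
  proof (rule ccontr)
    assume "(\<integral>x. dd \<theta> x (0, snd (u x)) \<partial>M) \<noteq> 0"
    then have "\<forall>\<^sub>F \<epsilon> in at_right 0. Q \<epsilon> \<noteq> 0" by (rule tendsto_imp_eventually_ne[OF lim])
    then have "\<forall>\<^sub>F \<epsilon> in at_right 0. v \<epsilon> \<notin> U_eps p \<Omega> \<epsilon>"
      using eventually_at_right_less[of 0] by eventually_elim (use zero in blast)
    then show False using freq by (simp add: frequently_def)
  qed
qed

end

subsection \<open>The \<open>\<Gamma>\<close>-limit\<close>

context thin_film
begin

lemma Gamma_liminf_bound: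
  assumes u: "u \<in> Lp p \<Omega>"
  shows "(if u \<in> U_zero p \<Omega> then ereal (\<integral>x. env x (u x) \<partial>M) else \<infinity>) \<le> Gamma_liminf p \<Omega> (F_eps p \<Omega> f) u"
  unfolding Gamma_liminf_def
proof (rule Inf_greatest, clarify)
  fix v :: "real \<Rightarrow> 'n pt \<Rightarrow> 'n pt"
  assume v: "\<forall>\<epsilon>>0. v \<epsilon> \<in> Lp p \<Omega>" and weak: "Lp_weak_tendsto p \<Omega> v u (at_right 0)"
  have ev: "\<forall>\<^sub>F \<epsilon> in at_right 0. v \<epsilon> \<in> Lp p \<Omega>"
    using eventually_at_right_less[of "0::real"] by eventually_elim (use v in blast)
  show "(if u \<in> U_zero p \<Omega> then ereal (\<integral>x. env x (u x) \<partial>M) else \<infinity>) \<le> Liminf (at_right 0) (\<lambda>\<epsilon>. F_eps p \<Omega> f \<epsilon> (v \<epsilon>))"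
  proof (cases "u \<in> U_zero p \<Omega>")
    case True
    have "ereal (\<integral>x. env x (u x) \<partial>M) \<le> Liminf (at_right 0) (\<lambda>\<epsilon>. F_eps p \<Omega> f \<epsilon> (v \<epsilon>)) + ereal \<delta>" if "0 < \<delta>" for \<delta>
    proof -
      have "\<forall>\<^sub>F \<epsilon> in at_right 0. ereal ((\<integral>x. env x (u x) \<partial>M) - \<delta>) \<le> F_eps p \<Omega> f \<epsilon> (v \<epsilon>)"
        using weak_lower_semicontinuous[OF u ev weak that] by eventually_elim (simp add: F_eps_def)
      then have "ereal ((\<integral>x. env x (u x) \<partial>M) - \<delta>) \<le> Liminf (at_right 0) (\<lambda>\<epsilon>. F_eps p \<Omega> f \<epsilon> (v \<epsilon>))"
        by (rule Liminf_bounded)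
      then have "ereal ((\<integral>x. env x (u x) \<partial>M) - \<delta>) + ereal \<delta> \<le> Liminf (at_right 0) (\<lambda>\<epsilon>. F_eps p \<Omega> f \<epsilon> (v \<epsilon>)) + ereal \<delta>"
        by (rule add_right_mono)
      then show ?thesis by simp
    qed
    then show ?thesis using True by (auto intro: ereal_le_epsilon2)
  next
    case False
    \<comment> \<open>Even membership in \<open>U_eps\<close> along a sequence of \<epsilon> tending
      to 0 would force the limit constraint; hence the energies are eventually infinite.\<close>
    then have "\<not> (\<exists>\<^sub>F \<epsilon> in at_right 0. v \<epsilon> \<in> U_eps p \<Omega> \<epsilon>)"
      using U_zero_closed[OF u _ weak] v by blast
    then have "\<forall>\<^sub>F \<epsilon> in at_right 0. \<infinity> \<le> F_eps p \<Omega> f \<epsilon> (v \<epsilon>)"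
      by (auto simp: not_frequently F_eps_def elim: eventually_mono)
    then have "\<infinity> \<le> Liminf (at_right 0) (\<lambda>\<epsilon>. F_eps p \<Omega> f \<epsilon> (v \<epsilon>))" by (rule Liminf_bounded)
    then show ?thesis using False by simp
  qed
qed

text \<open>The bound on the lamination fields degenerates with \<epsilon>; the energy supplies the
  bound in \<open>L^p\<close> that weak convergence of the recovery family requires.\<close>

lemma integral_norm_powr_le_energy:
  assumes v: "v \<in> Lp p \<Omega>"
  shows "(\<integral>x. norm (v x) powr p \<partial>M) \<le> C * ((\<integral>x. f x (v x) \<partial>M) + C * measure M \<Omega>)"
proof -
  have fi: "integrable M (\<lambda>x. f x (v x))" using admissible_integrable[OF admissible_f v] C_pos by simp
  have "(\<integral>x. norm (v x) powr p \<partial>M) \<le> (\<integral>x. C * (f x (v x) + C) \<partial>M)"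
  proof (rule integral_mono)
    show "integrable M (\<lambda>x. norm (v x) powr p)" by (rule LpD(2)[OF v])
    show "integrable M (\<lambda>x. C * (f x (v x) + C))" using fi by simp
    show "norm (v x) powr p \<le> C * (f x (v x) + C)" if "x \<in> space M" for x
      using lower[of x "v x"] that C_pos by (simp add: field_simps)
  qed
  also have "\<dots> = C * ((\<integral>x. f x (v x) \<partial>M) + C * measure M \<Omega>)" using fi by simp
  finally show ?thesis .
qed

text \<open>Each strong recovery field is relaxed with moment radius \<open>1 / \<epsilon>\<close>
  and error \<epsilon>. Every fixed exponential eventually falls within this radius, so all moments
  of the difference tend to 0.\<close>

lemma Gamma_limsup_bound:
  assumes u: "u \<in> U_zero p \<Omega>"
  shows "Gamma_limsup p \<Omega> (F_eps p \<Omega> f) u \<le> ereal (\<integral>x. env x (u x) \<partial>M)"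
proof -
  have uL: "u \<in> Lp p \<Omega>" using u by (simp add: U_zero_iff)
  obtain w where w: "\<And>\<epsilon>. 0 < \<epsilon> \<Longrightarrow> w \<epsilon> \<in> U_eps p \<Omega> \<epsilon>"
    and wlim: "((\<lambda>\<epsilon>. \<integral>x. norm (w \<epsilon> x - u x) powr p \<partial>M) \<longlongrightarrow> 0) (at_right 0)"
    using strong_recovery[OF u] by blast
  have wL: "w \<epsilon> \<in> Lp p \<Omega>" if "0 < \<epsilon>" for \<epsilon> using w[OF that] by (simp add: U_eps_iff)
  have "\<exists>v\<in>U_eps p \<Omega> \<epsilon>. exp_moments_le (1 / \<epsilon>) \<epsilon> (\<lambda>x. v x - w \<epsilon> x)
    \<and> (\<integral>x. f x (v x) \<partial>M) \<le> (\<integral>x. env x (w \<epsilon> x) \<partial>M) + \<epsilon>" if "0 < \<epsilon>" for \<epsilon>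
    using relaxes_env[OF that, unfolded relaxes_def, rule_format, OF w[OF that] that, of "1 / \<epsilon>"] that by simp
  then have "\<forall>\<epsilon>. \<exists>v. 0 < \<epsilon> \<longrightarrow> v \<in> U_eps p \<Omega> \<epsilon> \<and>
      exp_moments_le (1 / \<epsilon>) \<epsilon> (\<lambda>x. v x - w \<epsilon> x)
      \<and> (\<integral>x. f x (v x) \<partial>M) \<le> (\<integral>x. env x (w \<epsilon> x) \<partial>M) + \<epsilon>" by blast
  from choice[OF this] obtain v where v: "\<And>\<epsilon>. 0 < \<epsilon> \<Longrightarrow> v \<epsilon> \<in> U_eps p \<Omega> \<epsilon>"
    and vexp: "\<And>\<epsilon> a b. 0 < \<epsilon> \<Longrightarrow> norm a \<le> 1 / \<epsilon> \<Longrightarrow> b \<in> Basis \<Longrightarrow> \<bar>\<integral>x. exp (a \<bullet> x) * ((v \<epsilon> x - w \<epsilon> x) \<bullet> b) \<partial>M\<bar> \<le> \<epsilon>"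
    and vf: "\<And>\<epsilon>. 0 < \<epsilon> \<Longrightarrow> (\<integral>x. f x (v \<epsilon> x) \<partial>M) \<le> (\<integral>x. env x (w \<epsilon> x) \<partial>M) + \<epsilon>"
    by blast
  have vL: "v \<epsilon> \<in> Lp p \<Omega>" if "0 < \<epsilon>" for \<epsilon> using v[OF that] by (simp add: U_eps_iff)
  have pos: "\<forall>\<^sub>F \<epsilon> in at_right 0. (0::real) < \<epsilon>" by (rule eventually_at_right_less)
  have ltc: "\<forall>\<^sub>F \<epsilon> in at_right 0. \<epsilon> < c" if "0 < c" for c :: real
    using eventually_at_right_real[OF that] by (auto elim: eventually_mono)
  have wev: "\<forall>\<^sub>F \<epsilon> in at_right 0. w \<epsilon> \<in> Lp p \<Omega>" using pos by eventually_elim (rule wL)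
  have energy: "\<forall>\<^sub>F \<epsilon> in at_right 0. (\<integral>x. f x (v \<epsilon> x) \<partial>M) \<le> (\<integral>x. env x (u x) \<partial>M) + \<delta>" if "0 < \<delta>" for \<delta>
  proof -
    have "0 < \<delta> / 2" using that by simp
    from env_limsup[OF uL wev wlim this] pos ltc[OF this] show ?thesis
      by eventually_elim (use vf in force)
  qed
  \<comment> \<open>Combines the two bounds proved below: that of \<open>v \<epsilon>\<close> comes
    from its energy, that of \<open>w \<epsilon>\<close> from strong convergence.\<close>
  define B where "B = 2 powr p * (C * ((\<integral>x. env x (u x) \<partial>M) + 1 + C * measure M \<Omega>) + 2 powr p * (1 + (\<integral>x. norm (u x) powr p \<partial>M)))"
  have bound: "\<forall>\<^sub>F \<epsilon> in at_right 0. (\<lambda>x. v \<epsilon> x - w \<epsilon> x) \<in> Lp p \<Omega> \<and> (\<integral>x. norm (v \<epsilon> x - w \<epsilon> x) powr p \<partial>M) \<le> B"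
    using energy[OF zero_less_one] order_tendstoD(2)[OF wlim zero_less_one] pos
  proof eventually_elim
    case (elim \<epsilon>)
    note vw = vL[OF elim(3)] wL[OF elim(3)]
    have "(\<integral>x. norm ((w \<epsilon> x - u x) + u x) powr p \<partial>M) \<le> 2 powr p * ((\<integral>x. norm (w \<epsilon> x - u x) powr p \<partial>M) + (\<integral>x. norm (u x) powr p \<partial>M))"
      by (rule integral_norm_add_powr_le[OF Lp_diff[OF vw(2) uL] uL])
    also have "\<dots> \<le> 2 powr p * (1 + (\<integral>x. norm (u x) powr p \<partial>M))"
      using elim(2) by (intro mult_left_mono add_right_mono) auto
    finally have 1: "(\<integral>x. norm (w \<epsilon> x) powr p \<partial>M) \<le> 2 powr p * (1 + (\<integral>x. norm (u x) powr p \<partial>M))" by simp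
    have "(\<integral>x. norm (v \<epsilon> x) powr p \<partial>M) \<le> C * ((\<integral>x. f x (v \<epsilon> x) \<partial>M) + C * measure M \<Omega>)"
      by (rule integral_norm_powr_le_energy[OF vw(1)])
    also have "\<dots> \<le> C * ((\<integral>x. env x (u x) \<partial>M) + 1 + C * measure M \<Omega>)"
      using elim(1) C_pos by (intro mult_left_mono add_right_mono) auto
    finally have 2: "(\<integral>x. norm (v \<epsilon> x) powr p \<partial>M) \<le> C * ((\<integral>x. env x (u x) \<partial>M) + 1 + C * measure M \<Omega>)" .
    have "(\<integral>x. norm (v \<epsilon> x + (-1) *\<^sub>R w \<epsilon> x) powr p \<partial>M) \<le> 2 powr p * ((\<integral>x. norm (v \<epsilon> x) powr p \<partial>M) + (\<integral>x. norm ((-1) *\<^sub>R w \<epsilon> x) powr p \<partial>M))"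
      by (rule integral_norm_add_powr_le[OF vw(1) Lp_scaleR[OF vw(2)]])
    also have "\<dots> \<le> B" unfolding B_def using 1 2 by (intro mult_left_mono add_mono) auto
    finally show ?case using Lp_diff[OF vw] by simp
  qed
  have weak: "Lp_weak_tendsto p \<Omega> v u (at_right 0)"
    unfolding Lp_weak_tendsto_def
  proof
    fix l :: "('n pt \<Rightarrow> 'n pt) \<Rightarrow> real" assume l: "l \<in> Lp_dual p \<Omega>"
    have lim1: "((\<lambda>\<epsilon>. l (\<lambda>x. v \<epsilon> x - w \<epsilon> x)) \<longlongrightarrow> 0) (at_right 0)"
    proof (rule weak_tendsto_zeroI[OF boundedO l bound])
      fix a b :: "'n pt" assume b: "b \<in> Basis"
      have na: "0 < norm a + 1" by (simp add: add_nonneg_pos)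
      then have c0: "0 < 1 / (norm a + 1)" by simp
      have "\<forall>\<^sub>F \<epsilon> in at_right 0. norm (\<integral>x. exp (a \<bullet> x) * ((v \<epsilon> x - w \<epsilon> x) \<bullet> b) \<partial>M) \<le> \<epsilon>"
        using pos ltc[OF c0]
      proof (eventually_elim)
        case (elim \<epsilon>)
        then have "\<epsilon> * (norm a + 1) < 1" by (simp add: pos_less_divide_eq[OF na])
        then have "\<epsilon> * norm a \<le> 1" using elim(1) by (simp add: distrib_left)
        then have "norm a \<le> 1 / \<epsilon>" using elim(1) by (simp add: pos_le_divide_eq mult.commute)
        then show ?case using vexp[OF elim(1) _ b, of a] by simp
      qed
      then show "((\<lambda>\<epsilon>. \<integral>x. exp (a \<bullet> x) * ((v \<epsilon> x - w \<epsilon> x) \<bullet> b) \<partial>M) \<longlongrightarrow> 0) (at_right 0)"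
        by (rule Lim_null_comparison) (rule tendsto_ident_at)
    qed
    obtain K where K: "0 \<le> K" "\<And>u. u \<in> Lp p \<Omega> \<Longrightarrow> \<bar>l u\<bar> \<le> K * Lp_norm p \<Omega> u" using Lp_dualD(3)[OF l] by blast
    have lim2: "((\<lambda>\<epsilon>. l (\<lambda>x. w \<epsilon> x - u x)) \<longlongrightarrow> 0) (at_right 0)"
    proof (rule Lim_null_comparison)
      show "\<forall>\<^sub>F \<epsilon> in at_right 0. norm (l (\<lambda>x. w \<epsilon> x - u x)) \<le> K * (\<integral>x. norm (w \<epsilon> x - u x) powr p \<partial>M) powr (1 / p)"
        using wev by eventually_elim (use K(2)[OF Lp_diff[OF _ uL]] in \<open>simp add: Lp_norm_def\<close>)
      have "((\<lambda>\<epsilon>. (\<integral>x. norm (w \<epsilon> x - u x) powr p \<partial>M) powr (1 / p)) \<longlongrightarrow> 0) (at_right 0)"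
        using p_pos by (intro tendsto_zero_powrI[OF wlim tendsto_const]) auto
      then show "((\<lambda>\<epsilon>. K * (\<integral>x. norm (w \<epsilon> x - u x) powr p \<partial>M) powr (1 / p)) \<longlongrightarrow> 0) (at_right 0)"
        by (rule tendsto_mult_right_zero)
    qed
    have "((\<lambda>\<epsilon>. l (\<lambda>x. v \<epsilon> x - w \<epsilon> x) + l (\<lambda>x. w \<epsilon> x - u x) + l u) \<longlongrightarrow> 0 + 0 + l u) (at_right 0)"
      by (intro tendsto_add lim1 lim2 tendsto_const)
    moreover have "\<forall>\<^sub>F \<epsilon> in at_right 0. l (\<lambda>x. v \<epsilon> x - w \<epsilon> x) + l (\<lambda>x. w \<epsilon> x - u x) + l u = l (v \<epsilon>)"
      using pos
    proof eventually_elim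
      case (elim \<epsilon>)
      note d = Lp_diff[OF vL[OF elim] wL[OF elim]] Lp_diff[OF wL[OF elim] uL]
      have "l (\<lambda>x. v \<epsilon> x - w \<epsilon> x) + l (\<lambda>x. w \<epsilon> x - u x) = l (\<lambda>x. v \<epsilon> x - u x)"
        using Lp_dualD(1)[OF l d] by simp
      moreover have "l (\<lambda>x. v \<epsilon> x - u x) + l u = l (v \<epsilon>)"
        using Lp_dualD(1)[OF l Lp_diff[OF vL[OF elim] uL] uL] by simp
      ultimately show ?case by simp
    qed
    ultimately show "((\<lambda>\<epsilon>. l (v \<epsilon>)) \<longlongrightarrow> l u) (at_right 0)"
      by (simp cong: filterlim_cong)
  qed
  have "Limsup (at_right 0) (\<lambda>\<epsilon>. F_eps p \<Omega> f \<epsilon> (v \<epsilon>)) \<le> ereal (\<integral>x. env x (u x) \<partial>M) + ereal \<delta>" if "0 < \<delta>" for \<delta>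
  proof (rule Limsup_bounded)
    show "\<forall>\<^sub>F \<epsilon> in at_right 0. F_eps p \<Omega> f \<epsilon> (v \<epsilon>) \<le> ereal (\<integral>x. env x (u x) \<partial>M) + ereal \<delta>"
      using energy[OF that] pos by eventually_elim (simp add: F_eps_def v)
  qed
  then have "Limsup (at_right 0) (\<lambda>\<epsilon>. F_eps p \<Omega> f \<epsilon> (v \<epsilon>)) \<le> ereal (\<integral>x. env x (u x) \<partial>M)"
    by (auto intro: ereal_le_epsilon2)
  moreover have "Gamma_limsup p \<Omega> (F_eps p \<Omega> f) u \<le> Limsup (at_right 0) (\<lambda>\<epsilon>. F_eps p \<Omega> f \<epsilon> (v \<epsilon>))"
    unfolding Gamma_limsup_def using vL weak by (intro Inf_lower) auto
  ultimately show ?thesis by (rule order_trans[rotated])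
qed

lemma Gamma_liminf_le_limsup:
  fixes u :: "'n pt \<Rightarrow> 'n pt"
  shows "Gamma_liminf p \<Omega> F u \<le> Gamma_limsup p \<Omega> F u"
  unfolding Gamma_limsup_def
proof (rule Inf_greatest, clarify)
  fix v :: "real \<Rightarrow> 'n pt \<Rightarrow> 'n pt"
  assume "\<forall>\<epsilon>>0. v \<epsilon> \<in> Lp p \<Omega>" "Lp_weak_tendsto p \<Omega> v u (at_right 0)"
  then have "Gamma_liminf p \<Omega> F u \<le> Liminf (at_right 0) (\<lambda>\<epsilon>. F \<epsilon> (v \<epsilon>))"
    unfolding Gamma_liminf_def by (intro Inf_lower) blast
  also have "\<dots> \<le> Limsup (at_right 0) (\<lambda>\<epsilon>. F \<epsilon> (v \<epsilon>))" by (rule Liminf_le_Limsup) simp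
  finally show "Gamma_liminf p \<Omega> F u \<le> Limsup (at_right 0) (\<lambda>\<epsilon>. F \<epsilon> (v \<epsilon>))" .
qed

lemma Gamma_limit:
  "has_Gamma_limit p \<Omega> (F_eps p \<Omega> f) (\<lambda>u. if u \<in> U_zero p \<Omega> then ereal (\<integral>x. env x (u x) \<partial>M) else \<infinity>)"
  unfolding has_Gamma_limit_def
proof (intro ballI conjI)
  fix u :: "'n pt \<Rightarrow> 'n pt" assume u: "u \<in> Lp p \<Omega>"
  have up: "Gamma_limsup p \<Omega> (F_eps p \<Omega> f) u \<le> (if u \<in> U_zero p \<Omega> then ereal (\<integral>x. env x (u x) \<partial>M) else \<infinity>)"
    using Gamma_limsup_bound[of u] by simp
  note lo = Gamma_liminf_bound[OF u] and le = Gamma_liminf_le_limsup[of "F_eps p \<Omega> f" u]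
  show "Gamma_liminf p \<Omega> (F_eps p \<Omega> f) u = (if u \<in> U_zero p \<Omega> then ereal (\<integral>x. env x (u x) \<partial>M) else \<infinity>)"
    by (rule antisym[OF order_trans[OF le up] lo])
  show "Gamma_limsup p \<Omega> (F_eps p \<Omega> f) u = (if u \<in> U_zero p \<Omega> then ereal (\<integral>x. env x (u x) \<partial>M) else \<infinity>)"
    by (rule antisym[OF up order_trans[OF lo le]])
qed

end

text \<open>Completeness of Lebesgue measure transfers measurability from \<open>g\<close> to
  \<open>h\<close>. For the original integrand and its envelope measurability is obtained only in
  this way.\<close>

lemma integral_lebesgue_on_cong_AE:
  fixes g h :: "'a::euclidean_space \<Rightarrow> real"
  assumes S: "S \<in> sets lebesgue" and g: "g \<in> borel_measurable (lebesgue_on S)"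
    and ae: "AE x in lebesgue_on S. g x = h x"
  shows "integral\<^sup>L (lebesgue_on S) g = integral\<^sup>L (lebesgue_on S) h"
proof -
  have S': "S \<inter> space lebesgue \<in> sets lebesgue" using S by simp
  have g': "(\<lambda>x. indicator S x *\<^sub>R g x) \<in> borel_measurable lebesgue"
    using g by (subst (asm) borel_measurable_restrict_space_iff[OF S'])
  have ae': "AE x in lebesgue. indicator S x *\<^sub>R g x = indicator S x *\<^sub>R h x"
    using ae unfolding AE_restrict_space_iff[OF S'] by (rule eventually_mono) (auto simp: indicator_def)
  have h': "(\<lambda>x. indicator S x *\<^sub>R h x) \<in> borel_measurable lebesgue"
    by (rule borel_measurable_AE[OF g' ae'])
  show ?thesis
    unfolding integral_restrict_space[OF S'] by (rule integral_cong_AE[OF g' h' ae'])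
qed

theorem theorem1:
  fixes \<omega> :: "(real ^ 'n::finite) set"
    and \<Omega> :: "((real ^ 'n) \<times> real) set"
    and p C :: real
    and f :: "(real ^ 'n) \<times> real \<Rightarrow> (real ^ 'n) \<times> real \<Rightarrow> real"
  assumes "open \<omega>" and "bounded \<omega>"
    and "\<Omega> = \<omega> \<times> {0<..<1}"
    and "1 < p"
    and "caratheodory \<Omega> f"
    and "C > 0"
    and "AE x in lebesgue_on \<Omega>. \<forall>\<mu>. \<bar>f x \<mu>\<bar> \<le> C * norm \<mu> powr p + C
                                 \<and> f x \<mu> \<ge> 1 / C * norm \<mu> powr p - C"
  shows "has_Gamma_limit p \<Omega> (F_eps p \<Omega> f)
           (\<lambda>u. if u \<in> U_zero p \<Omega>
                then ereal (\<integral>x. convex_envelope (f x) (u x) \<partial>lebesgue_on \<Omega>)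
                else \<infinity>)"
proof -
  have op: "open \<Omega>" and bd: "bounded \<Omega>"
    using assms(1-3) by (auto intro: open_Times bounded_Times bounded_Ioo)
  have lm: "\<Omega> \<in> lmeasurable" by (rule lmeasurable_open[OF bd op])
  then have S: "\<Omega> \<in> sets lebesgue" by auto
  interpret cylinder \<Omega> p by unfold_locales (use lm op bd assms(4) in auto)
  \<comment> \<open>One measurable null set has to serve all \<mu> at once, since the integrand is
    redefined on it and must stay measurable.\<close>
  obtain N where N: "{x \<in> space M. \<not> (\<forall>\<mu>. \<bar>f x \<mu>\<bar> \<le> C * norm \<mu> powr p + C \<and> f x \<mu> \<ge> 1 / C * norm \<mu> powr p - C)} \<subseteq> N"
    "emeasure M N = 0" "N \<in> sets M"
    using assms(7) by (rule AE_E)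
  text \<open>On the exceptional null set \<open>f\<close> is replaced by \<open>\<bar>\<mu>\<bar>\<^sup>p\<close>, which satisfies the growth conditions since \<open>D \<ge> 1\<close>.\<close>
  define D where "D = max C 1"
  define f' where "f' x \<mu> = (if x \<in> N then norm \<mu> powr p else f x \<mu>)" for x \<mu>
  have NM: "{x \<in> space M. x \<in> N} \<in> sets M" using N(3) sets.sets_into_space[OF N(3)] by (simp add: Collect_conj_eq Int_absorb1)
  have car': "caratheodory \<Omega> f'"
    unfolding caratheodory_def
  proof (intro conjI allI ballI)
    have "(\<lambda>x. f x \<mu>) \<in> borel_measurable M" for \<mu>
      using assms(5) unfolding caratheodory_def by blast
    then show "(\<lambda>x. f' x \<mu>) \<in> borel_measurable M" for \<mu>
      unfolding f'_def by (intro measurable_If borel_measurable_const NM)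
    fix x assume "x \<in> \<Omega>"
    then have "continuous_on UNIV (f x)" using assms(5) by (simp add: caratheodory_def)
    moreover have "continuous_on UNIV (\<lambda>\<mu> :: 'n pt. norm \<mu> powr p)"
      using assms(4) by (intro continuous_on_powr' continuous_intros) auto
    ultimately show "continuous_on UNIV (f' x)" by (cases "x \<in> N") (simp_all add: f'_def[abs_def])
  qed
  have D: "C \<le> D" "1 \<le> D" "1 / D \<le> 1 / C" "1 / D \<le> 1"
    using assms(6) by (auto simp: D_def frac_le)
  have growth: "f' x \<mu> \<le> D * norm \<mu> powr p + D \<and> 1 / D * norm \<mu> powr p - D \<le> f' x \<mu>" if "x \<in> \<Omega>" for x \<mu>
  proof (cases "x \<in> N")
    case True
    have "1 / D * norm \<mu> powr p \<le> 1 * norm \<mu> powr p" "1 * norm \<mu> powr p \<le> D * norm \<mu> powr p"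
      using D by (intro mult_right_mono; simp)+
    then show ?thesis using True D by (simp add: f'_def)
  next
    case False
    then have "\<forall>\<mu>. \<bar>f x \<mu>\<bar> \<le> C * norm \<mu> powr p + C \<and> 1 / C * norm \<mu> powr p - C \<le> f x \<mu>"
      using N(1) that unfolding space_M by blast
    then have "\<bar>f x \<mu>\<bar> \<le> C * norm \<mu> powr p + C" "1 / C * norm \<mu> powr p - C \<le> f x \<mu>"
      by blast+
    moreover have "C * norm \<mu> powr p \<le> D * norm \<mu> powr p" "1 / D * norm \<mu> powr p \<le> 1 / C * norm \<mu> powr p"
      using D by (intro mult_right_mono; simp)+
    ultimately show ?thesis using False D by (simp add: f'_def)
  qed
  interpret thin_film \<Omega> p f' D
    by unfold_locales (use car' growth D in auto)
  have ae: "AE x in M. x \<notin> N" using N(2,3) by (intro AE_not_in) (auto simp: null_sets_def)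
  have "F_eps p \<Omega> f = F_eps p \<Omega> f'"
  proof (intro ext)
    fix \<epsilon> and u :: "'n pt \<Rightarrow> 'n pt"
    have "(\<integral>x. f' x (u x) \<partial>M) = (\<integral>x. f x (u x) \<partial>M)" if "u \<in> U_eps p \<Omega> \<epsilon>"
    proof (rule integral_lebesgue_on_cong_AE[OF S])
      show "(\<lambda>x. f' x (u x)) \<in> borel_measurable M"
        using that by (intro caratheodory_measurable[OF car']) (simp add: U_eps_iff LpD(1))
      show "AE x in M. f' x (u x) = f x (u x)" using ae by eventually_elim (simp add: f'_def)
    qed
    then show "F_eps p \<Omega> f \<epsilon> u = F_eps p \<Omega> f' \<epsilon> u" by (simp add: F_eps_def)
  qed
  moreover have "(\<integral>x. convex_envelope (f' x) (u x) \<partial>M) = (\<integral>x. convex_envelope (f x) (u x) \<partial>M)" if "u \<in> U_zero p \<Omega>" for u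
  proof (rule integral_lebesgue_on_cong_AE[OF S env_measurable])
    show "u \<in> Lp p \<Omega>" using that by (simp add: U_zero_iff)
    show "AE x in M. convex_envelope (f' x) (u x) = convex_envelope (f x) (u x)"
      using ae by eventually_elim (simp add: f'_def[abs_def])
  qed
  ultimately show ?thesis using Gamma_limit by (simp cong: if_cong)
qed

end
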